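(* Let $N\ge1$, let $G$ be a subgroup of $(\mathbb{Z}/N\mathbb{Z})^2$, and let $a,b,c\in G$ with $a+b+c=0$. Then in $\Lambda^2\mathcal{O}(Y(N))^\times\otimes\mathbb{Z}[\frac1{6N}]$, $$g_a\wedge g_b+g_b\wedge g_c+g_c\wedge g_a=\frac1{|G|}\sum_{x\in G}\delta(0,x,a-x,b+x)+\frac1{4|G|^2}\sum_{x,y\in G}\Bigl(\delta(0,a,b+2x,y)-\delta(0,b,a+2x,y)-\delta(0,a+b,b+2x,y)\Bigr).$$ If $|G|$ is odd, this simplifies to $g_a\wedge g_b+g_b\wedge g_c+g_c\wedge g_a=\frac1{|G|}\sum_{x\in G}\delta(0,x,a-x,b+x)$.
   Context: $Y(N)$ is the modular curve of level $N$ over $\mathbb{Q}$; $\mathcal{O}(Y(N))^\times$ is identified with the modular units for $\Gamma(N)$ whose Fourier expansion at $\infty$ has coefficients in $\mathbb{Q}(\zeta_N)$. Siegel units: for $x\in(\mathbb{Z}/N\mathbb{Z})^2\setminus\{0\}$, writing $x=\overline{(x_1,x_2)}$ with $0\le x_1<N$, $g_x(\tau)=q^{B_2(x_1/N)/2}\prod_{n\ge0}(1-q^n e(\tfrac{x_1\tau+x_2}{N}))\prod_{n\ge1}(1-q^n e(-\tfrac{x_1\tau+x_2}{N}))$ with $e(z)=e^{2\pi iz}$, $q^\alpha=e(\alpha\tau)$, $B_2(t)=t^2-t+\frac16$; $g_x\in\mathcal{O}(Y(N))^\times\otimes\mathbb{Z}[\frac1{6N}]$, and $g_{0,0}=1$.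 For nonzero $x=(x_1,x_2)$, $\wp_x(\tau)=\wp(\tau,\frac{x_1\tau+x_2}{N})$ with $\wp(\tau,\cdot)$ the Weierstrass function of $\mathbb{Z}+\tau\mathbb{Z}$, and $\wp_0=\infty$. For distinct $p,q,r,s\in(\mathbb{Z}/N\mathbb{Z})^2/\pm1$, $u(p,q,r,s)=[\wp_p,\wp_q,\wp_r,\wp_s]\in\mathcal{O}(Y(N))^\times$ where $[x,y,z,w]=\frac{z-x}{z-y}\div\frac{w-x}{w-y}$ (usual convention for $\infty$), and $\delta(p,q,r,s)=u(p,q,r,s)\wedge u(p,r,q,s)$. Elements of $G$ appearing as arguments of $\delta$ are taken in $(\mathbb{Z}/N\mathbb{Z})^2/\pm1$, and $\delta(p,q,r,s)=0$ if these four classes are not distinct. *)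

theory Defs
  imports
    "HOL-Algebra.Algebra"
    "HOL-Algebra.Algebraic_Closure_Type"
    "HOL-Complex_Analysis.Complex_Analysis"
    "HOL-Number_Theory.Cong"
begin

section \<open>Tensor products with a ring of scalars and exterior squares\<close>

text \<open>The fields \<open>mult\<close> and \<open>one\<close> of the record \<open>module\<close> play no role for modules and are left
  unspecified.\<close>

definition free_module :: "('r, 'm) ring_scheme \<Rightarrow> 'k set \<Rightarrow> ('r, 'k \<Rightarrow> 'r) module" where
  "free_module R S =
     \<lparr>carrier = {c. range c \<subseteq> carrier R \<and> finite {k. c k \<noteq> \<zero>\<^bsub>R\<^esub>} \<and> {k. c k \<noteq> \<zero>\<^bsub>R\<^esub>} \<subseteq> S},
      monoid.mult = undefined,
      one = undefined,
      ring.zero = (\<lambda>_. \<zero>\<^bsub>R\<^esub>),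
      add = (\<lambda>c d k. c k \<oplus>\<^bsub>R\<^esub> d k),
      module.smult = (\<lambda>r c k. r \<otimes>\<^bsub>R\<^esub> c k)\<rparr>"

definition basis_elt :: "('r, 'm) ring_scheme \<Rightarrow> 'k \<Rightarrow> 'k \<Rightarrow> 'r" where
  "basis_elt R k = (\<lambda>j. if j = k then \<one>\<^bsub>R\<^esub> else \<zero>\<^bsub>R\<^esub>)"

definition submodule_span ::
    "('r, 'm) ring_scheme \<Rightarrow> ('r, 'a, 'n) module_scheme \<Rightarrow> 'a set \<Rightarrow> 'a set" where
  "submodule_span R M B = \<Inter>{H. submodule H R M \<and> B \<subseteq> H}"

definition quotient_module :: "('r, 'a, 'n) module_scheme \<Rightarrow> 'a set \<Rightarrow> ('r, 'a set) module" where
  "quotient_module M H =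
     \<lparr>carrier = a_rcosets\<^bsub>M\<^esub> H,
      monoid.mult = undefined,
      one = undefined,
      ring.zero = H,
      add = (<+>\<^bsub>M\<^esub>),
      module.smult = (\<lambda>r C. \<Union>x\<in>C. H +>\<^bsub>M\<^esub> (r \<odot>\<^bsub>M\<^esub> x))\<rparr>"

text \<open>For a commutative group \<open>A\<close> (written multiplicatively) and a commutative ring \<open>S\<close>, the
  \<open>S\<close>-module \<open>A \<otimes>\<^bsub>\<int>\<^esub> S\<close>: the symbols \<open>(a, s)\<close> modulo biadditivity and \<open>s (a, t) = (a, s t)\<close>.\<close>

definition tensor_relations ::
    "('a, 'm) monoid_scheme \<Rightarrow> ('s, 'n) ring_scheme \<Rightarrow> ('a \<times> 's \<Rightarrow> 's) set" where
  "tensor_relations A S =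
     (let F = free_module S (carrier A \<times> carrier S); \<beta> = basis_elt S in
        {\<beta> (a \<otimes>\<^bsub>A\<^esub> b, s) \<ominus>\<^bsub>F\<^esub> (\<beta> (a, s) \<oplus>\<^bsub>F\<^esub> \<beta> (b, s)) | a b s.
            a \<in> carrier A \<and> b \<in> carrier A \<and> s \<in> carrier S}
      \<union> {\<beta> (a, s \<oplus>\<^bsub>S\<^esub> t) \<ominus>\<^bsub>F\<^esub> (\<beta> (a, s) \<oplus>\<^bsub>F\<^esub> \<beta> (a, t)) | a s t.
            a \<in> carrier A \<and> s \<in> carrier S \<and> t \<in> carrier S}
      \<union> {\<beta> (a, s \<otimes>\<^bsub>S\<^esub> t) \<ominus>\<^bsub>F\<^esub> (s \<odot>\<^bsub>F\<^esub> \<beta> (a, t)) | a s t.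
            a \<in> carrier A \<and> s \<in> carrier S \<and> t \<in> carrier S})"

definition tensor_null ::
    "('a, 'm) monoid_scheme \<Rightarrow> ('s, 'n) ring_scheme \<Rightarrow> ('a \<times> 's \<Rightarrow> 's) set" where
  "tensor_null A S =
     submodule_span S (free_module S (carrier A \<times> carrier S)) (tensor_relations A S)"

definition tensor_scalars ::
    "('a, 'm) monoid_scheme \<Rightarrow> ('s, 'n) ring_scheme \<Rightarrow> ('s, ('a \<times> 's \<Rightarrow> 's) set) module" where
  "tensor_scalars A S =
     quotient_module (free_module S (carrier A \<times> carrier S)) (tensor_null A S)"

definition pure_tensor ::
    "('a, 'm) monoid_scheme \<Rightarrow> ('s, 'n) ring_scheme \<Rightarrow> 'a \<Rightarrow> 's \<Rightarrow> ('a \<times> 's \<Rightarrow> 's) set" where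
  "pure_tensor A S a s =
     tensor_null A S +>\<^bsub>free_module S (carrier A \<times> carrier S)\<^esub> basis_elt S (a, s)"

definition exterior_relations ::
    "('r, 'm) ring_scheme \<Rightarrow> ('r, 'a, 'n) module_scheme \<Rightarrow> ('a \<times> 'a \<Rightarrow> 'r) set" where
  "exterior_relations R M =
     (let F = free_module R (carrier M \<times> carrier M); \<beta> = basis_elt R in
        {\<beta> (x \<oplus>\<^bsub>M\<^esub> x', y) \<ominus>\<^bsub>F\<^esub> (\<beta> (x, y) \<oplus>\<^bsub>F\<^esub> \<beta> (x', y)) | x x' y.
            x \<in> carrier M \<and> x' \<in> carrier M \<and> y \<in> carrier M}
      \<union> {\<beta> (x, y \<oplus>\<^bsub>M\<^esub> y') \<ominus>\<^bsub>F\<^esub> (\<beta> (x, y) \<oplus>\<^bsub>F\<^esub> \<beta> (x, y')) | x y y'.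
            x \<in> carrier M \<and> y \<in> carrier M \<and> y' \<in> carrier M}
      \<union> {\<beta> (r \<odot>\<^bsub>M\<^esub> x, y) \<ominus>\<^bsub>F\<^esub> (r \<odot>\<^bsub>F\<^esub> \<beta> (x, y)) | r x y.
            r \<in> carrier R \<and> x \<in> carrier M \<and> y \<in> carrier M}
      \<union> {\<beta> (x, r \<odot>\<^bsub>M\<^esub> y) \<ominus>\<^bsub>F\<^esub> (r \<odot>\<^bsub>F\<^esub> \<beta> (x, y)) | r x y.
            r \<in> carrier R \<and> x \<in> carrier M \<and> y \<in> carrier M}
      \<union> {\<beta> (x, x) | x. x \<in> carrier M})"

definition exterior_null ::
    "('r, 'm) ring_scheme \<Rightarrow> ('r, 'a, 'n) module_scheme \<Rightarrow> ('a \<times> 'a \<Rightarrow> 'r) set" where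
  "exterior_null R M =
     submodule_span R (free_module R (carrier M \<times> carrier M)) (exterior_relations R M)"

definition exterior_square ::
    "('r, 'm) ring_scheme \<Rightarrow> ('r, 'a, 'n) module_scheme \<Rightarrow> ('r, ('a \<times> 'a \<Rightarrow> 'r) set) module" where
  "exterior_square R M =
     quotient_module (free_module R (carrier M \<times> carrier M)) (exterior_null R M)"

definition wedge ::
    "('r, 'm) ring_scheme \<Rightarrow> ('r, 'a, 'n) module_scheme \<Rightarrow> 'a \<Rightarrow> 'a \<Rightarrow> ('a \<times> 'a \<Rightarrow> 'r) set" where
  "wedge R M x y =
     exterior_null R M +>\<^bsub>free_module R (carrier M \<times> carrier M)\<^esub> basis_elt R (x, y)"

text \<open>The subring \<open>\<int>[1/m]\<close> of \<open>\<rat>\<close>.\<close>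

definition Z_inv :: "nat \<Rightarrow> rat ring" where
  "Z_inv m =
     \<lparr>carrier = {of_int k / of_nat m ^ n | k n. True},
      monoid.mult = (*), one = 1, ring.zero = 0, add = (+)\<rparr>"

section \<open>Modular units of level \<open>N\<close>\<close>

definition e_fun :: "complex \<Rightarrow> complex" where
  "e_fun z = exp (2 * of_real pi * \<i> * z)"

definition cyclotomic_field :: "nat \<Rightarrow> complex set" where
  "cyclotomic_field N = generate_field ring_of_type_algebra {e_fun (1 / of_nat N)}"

text \<open>\<open>F\<close> is the Fourier expansion of \<open>f\<close> in the local parameter \<open>e(\<tau>/N)\<close> at \<open>\<infinity>\<close>. Formal Laurent
  series have finite principal part, so its existence includes meromorphy at \<open>\<infinity>\<close>.\<close>

definition fourier_expansion :: "nat \<Rightarrow> (complex \<Rightarrow> complex) \<Rightarrow> complex fls \<Rightarrow> bool" where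
  "fourier_expansion N f F \<longleftrightarrow>
     (\<exists>h. h has_laurent_expansion F \<and> (\<forall>\<tau>. Im \<tau> > 0 \<longrightarrow> f \<tau> = h (e_fun (\<tau> / of_nat N))))"

definition moebius_int :: "int \<Rightarrow> int \<Rightarrow> int \<Rightarrow> int \<Rightarrow> complex \<Rightarrow> complex" where
  "moebius_int a b c d \<tau> = (of_int a * \<tau> + of_int b) / (of_int c * \<tau> + of_int d)"

text \<open>Functions on the upper half-plane are represented by functions on \<open>\<complex>\<close> with value \<open>1\<close> outside
  it, so that equality of units is equality of functions and the product is pointwise.
  Meromorphy at all cusps is meromorphy at \<open>\<infinity>\<close> of all translates under \<open>SL\<^sub>2(\<int>)\<close>.\<close>

definition is_modular_unit :: "nat \<Rightarrow> (complex \<Rightarrow> complex) \<Rightarrow> bool" where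
  "is_modular_unit N f \<longleftrightarrow>
     f holomorphic_on {\<tau>. Im \<tau> > 0} \<and>
     (\<forall>\<tau>. Im \<tau> > 0 \<longrightarrow> f \<tau> \<noteq> 0) \<and>
     (\<forall>\<tau>. \<not> Im \<tau> > 0 \<longrightarrow> f \<tau> = 1) \<and>
     (\<forall>a b c d. a * d - b * c = 1 \<and>
        [a = 1] (mod int N) \<and> [b = 0] (mod int N) \<and> [c = 0] (mod int N) \<and> [d = 1] (mod int N) \<longrightarrow>
        (\<forall>\<tau>. Im \<tau> > 0 \<longrightarrow> f (moebius_int a b c d \<tau>) = f \<tau>)) \<and>
     (\<forall>a b c d. a * d - b * c = 1 \<longrightarrow>
        (\<exists>F. fourier_expansion N (\<lambda>\<tau>. f (moebius_int a b c d \<tau>)) F)) \<and>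
     (\<exists>F. fourier_expansion N f F \<and> (\<forall>n. fls_nth F n \<in> cyclotomic_field N))"

text \<open>The group \<open>\<O>(Y(N))\<^sup>\<times>\<close>.\<close>

definition modular_units :: "nat \<Rightarrow> (complex \<Rightarrow> complex) monoid" where
  "modular_units N =
     \<lparr>carrier = {f. is_modular_unit N f},
      monoid.mult = (\<lambda>f g \<tau>. f \<tau> * g \<tau>),
      one = (\<lambda>_. 1)\<rparr>"

abbreviation scalars :: "nat \<Rightarrow> rat ring" where
  "scalars N \<equiv> Z_inv (6 * N)"

type_synonym unit_tensor = "((complex \<Rightarrow> complex) \<times> rat \<Rightarrow> rat) set"

text \<open>\<open>\<O>(Y(N))\<^sup>\<times> \<otimes> \<int>[1/6N]\<close>, written additively.\<close>

definition unit_module :: "nat \<Rightarrow> (rat, unit_tensor) module" where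
  "unit_module N = tensor_scalars (modular_units N) (scalars N)"

text \<open>\<open>\<Lambda>\<^sup>2\<O>(Y(N))\<^sup>\<times> \<otimes> \<int>[1/6N]\<close>, as the exterior square over \<open>\<int>[1/6N]\<close> of
  \<open>\<O>(Y(N))\<^sup>\<times> \<otimes> \<int>[1/6N]\<close> (exterior powers commute with extension of scalars), since this is where
  wedge products of Siegel units are formed.\<close>

definition Lambda2 :: "nat \<Rightarrow> (rat, (unit_tensor \<times> unit_tensor \<Rightarrow> rat) set) module" where
  "Lambda2 N = exterior_square (scalars N) (unit_module N)"

definition unit_wedge ::
    "nat \<Rightarrow> unit_tensor \<Rightarrow> unit_tensor \<Rightarrow> (unit_tensor \<times> unit_tensor \<Rightarrow> rat) set" where
  "unit_wedge N x y = wedge (scalars N) (unit_module N) x y"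

section \<open>Siegel units and cross-ratios of Weierstrass values\<close>

text \<open>\<open>(\<int>/N\<int>)\<^sup>2\<close> as an (additive) group in the multiplicative notation of HOL-Algebra; its elements
  are the pairs of representatives in \<open>{0..<N}\<close>.\<close>

definition ZN2 :: "nat \<Rightarrow> (int \<times> int) monoid" where
  "ZN2 N = integer_mod_group N \<times>\<times> integer_mod_group N"

definition torsion_point :: "nat \<Rightarrow> int \<times> int \<Rightarrow> complex \<Rightarrow> complex" where
  "torsion_point N x \<tau> = (of_int (fst x) * \<tau> + of_int (snd x)) / of_nat N"

definition B2 :: "real \<Rightarrow> real" where
  "B2 t = t\<^sup>2 - t + 1 / 6"

definition siegel_fun :: "nat \<Rightarrow> int \<times> int \<Rightarrow> complex \<Rightarrow> complex" where
  "siegel_fun N x \<tau> =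
     (if x = (0, 0) \<or> \<not> Im \<tau> > 0 then 1
      else e_fun (of_real (B2 (of_int (fst x) / of_nat N) / 2) * \<tau>)
         * prodinf (\<lambda>n. 1 - e_fun (of_nat n * \<tau>) * e_fun (torsion_point N x \<tau>))
         * prodinf (\<lambda>n. 1 - e_fun (of_nat (Suc n) * \<tau>) * e_fun (- torsion_point N x \<tau>)))"

text \<open>The function \<open>g\<^sub>x\<close> itself need not be modular of level \<open>N\<close>; its \<open>12N\<close>-th power is, and the
  element \<open>g\<^sub>x\<close> of \<open>\<O>(Y(N))\<^sup>\<times> \<otimes> \<int>[1/6N]\<close> means \<open>g\<^sub>x\<close> to the power \<open>12N\<close>, tensored with \<open>1/12N\<close>.\<close>

definition siegel_unit :: "nat \<Rightarrow> int \<times> int \<Rightarrow> unit_tensor" where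
  "siegel_unit N x =
     pure_tensor (modular_units N) (scalars N)
       (\<lambda>\<tau>. siegel_fun N x \<tau> ^ (12 * N)) (1 / of_nat (12 * N))"

definition weierstrass_p :: "complex \<Rightarrow> complex \<Rightarrow> complex" where
  "weierstrass_p \<tau> z =
     1 / z\<^sup>2 +
     (\<Sum>\<^sub>\<infinity>(m, n)\<in>UNIV - {(0 :: int, 0 :: int)}.
        1 / (z - (of_int m + of_int n * \<tau>))\<^sup>2 - 1 / (of_int m + of_int n * \<tau>)\<^sup>2)"

text \<open>\<open>None\<close> stands for \<open>\<infinity>\<close>.\<close>

definition wp :: "nat \<Rightarrow> int \<times> int \<Rightarrow> complex \<Rightarrow> complex option" where
  "wp N x \<tau> = (if x = (0, 0) then None else Some (weierstrass_p \<tau> (torsion_point N x \<tau>)))"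

text \<open>If one of four distinct points is \<open>\<infinity>\<close>, the two factors of the cross-ratio that involve it occur
  in numerator and denominator with the same sign and cancel in the limit, hence are replaced by \<open>1\<close>.\<close>

fun diff_infty :: "complex option \<Rightarrow> complex option \<Rightarrow> complex" where
  "diff_infty (Some x) (Some y) = x - y"
| "diff_infty _ _ = 1"

definition cross_ratio ::
    "complex option \<Rightarrow> complex option \<Rightarrow> complex option \<Rightarrow> complex option \<Rightarrow> complex" where
  "cross_ratio x y z w =
     (diff_infty z x / diff_infty z y) / (diff_infty w x / diff_infty w y)"

text \<open>Classes in \<open>(\<int>/N\<int>)\<^sup>2/\<plusminus>1\<close> are given by representatives; the value does not depend on them, as the
  Weierstrass function is even and periodic.\<close>

definition u_fun ::
    "nat \<Rightarrow> int \<times> int \<Rightarrow> int \<times> int \<Rightarrow> int \<times> int \<Rightarrow> int \<times> int \<Rightarrow> complex \<Rightarrow> complex" where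
  "u_fun N p q r s \<tau> =
     (if Im \<tau> > 0 then cross_ratio (wp N p \<tau>) (wp N q \<tau>) (wp N r \<tau>) (wp N s \<tau>) else 1)"

definition u_unit ::
    "nat \<Rightarrow> int \<times> int \<Rightarrow> int \<times> int \<Rightarrow> int \<times> int \<Rightarrow> int \<times> int \<Rightarrow> unit_tensor" where
  "u_unit N p q r s = pure_tensor (modular_units N) (scalars N) (u_fun N p q r s) 1"

definition pm_class :: "nat \<Rightarrow> int \<times> int \<Rightarrow> (int \<times> int) set" where
  "pm_class N x = {x, inv\<^bsub>ZN2 N\<^esub> x}"

definition delta ::
    "nat \<Rightarrow> int \<times> int \<Rightarrow> int \<times> int \<Rightarrow> int \<times> int \<Rightarrow> int \<times> int \<Rightarrow>
     (unit_tensor \<times> unit_tensor \<Rightarrow> rat) set" where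
  "delta N p q r s =
     (if distinct [pm_class N p, pm_class N q, pm_class N r, pm_class N s]
      then unit_wedge N (u_unit N p q r s) (u_unit N p r q s)
      else \<zero>\<^bsub>Lambda2 N\<^esub>)"

end

theory Submission
  imports Defs
begin

text \<open>Siegel functions are theta functions up to an elementary factor, and \<open>\<wp>\<^sub>x - \<wp>\<^sub>y\<close> is a constant
  times \<open>\<theta>(x + y) \<theta>(x - y) / (\<theta>(x)\<^sup>2 \<theta>(y)\<^sup>2)\<close>. Hence, with \<open>v(x, y) = g\<^sub>x\<^sub>+\<^sub>y + g\<^sub>x\<^sub>-\<^sub>y - 2 g\<^sub>x - 2 g\<^sub>y\<close>
  written additively, \<open>u(0, q, r, s) = v(s, q) - v(r, q)\<close> in the group of units with \<open>6N\<close> inverted, and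
  \<open>\<delta>(0, q, r, s)\<close> is the cyclic sum of the wedges of \<open>v(q, r)\<close>, \<open>v(s, q)\<close>, \<open>v(r, s)\<close>. The theorem is
  therefore an identity between wedges of the \<open>g\<^sub>x\<close> that uses only \<open>g\<^sub>-\<^sub>x = g\<^sub>x\<close> and \<open>g\<^sub>0 = 0\<close>.
  Reflections \<open>x \<mapsto> d - x\<close> of \<open>G\<close> kill most terms of the first sum; what remains besides the three
  wedges are sums over \<open>2G\<close>-cosets, which the second sum cancels. If \<open>|G|\<close> is odd, then \<open>2G = G\<close> and
  these remainders vanish by themselves. In coefficients, the identity is checked on the antisymmetrised
  products of two coordinate functionals, which suffices because \<open>2\<close> is invertible.\<close>

section \<open>The Euler product\<close>

text \<open>Two obstacles shape the analytic half. A unit needs expansions at all cusps, with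
  cyclotomic coefficients at infinity, but only expansions at infinity are computed: SL2(Z) maps
  torsion points to torsion points, up to factors that cancel in cross-ratios or disappear in 12N-th
  powers. For Siegel functions this requires the inversion law of theta including its multiplier
  \<open>c\<close>, which is read off from the values at the three half-periods: Euler's product
  identity gives \<open>c ^ 3 = \<i>\<close>, and this is where 12 comes from. Moreover g_x is only
  a formal 12N-th root of a unit, so relations are proved for 12N-th powers of functions, and 12N is
  cancelled afterwards, which is legitimate because it divides (6N)^2.

  In the algebraic half no independence of Siegel units is available, so both sides are lifted to
  coefficient functions on pairs of elements of G; lifts with equal antisymmetric parts give equal
  wedges. The 4 in the second sum is 2 * 2: summing over y produces one factor 2, and the other
  arises because q + (r + 2x) and q - (r + 2x) contribute equal sums over x.\<close>

definition euler_prod :: "complex \<Rightarrow> complex \<Rightarrow> complex" where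
  "euler_prod q t = prodinf (\<lambda>n. 1 - q ^ n * t)"

lemma euler_prod_abs_convergent:
  fixes q t :: complex
  assumes "norm q < 1"
  shows "abs_convergent_prod (\<lambda>n. 1 - q ^ n * t)"
proof -
  have "summable (\<lambda>n. norm (q ^ n) * norm t)"
    using assms by (intro summable_mult2) (simp add: norm_power)
  then show ?thesis
    by (simp add: abs_convergent_prod_conv_summable norm_mult)
qed

lemma euler_prod_has_prod:
  assumes "norm q < 1"
  shows "(\<lambda>n. 1 - q ^ n * t) has_prod euler_prod q t"
  unfolding euler_prod_def convergent_prod_has_prod_iff[symmetric]
  using euler_prod_abs_convergent[OF assms] abs_convergent_prod_imp_convergent_prod by blast

lemma euler_prod_eq_0_iff:
  assumes "norm q < 1"
  shows "euler_prod q t = 0 \<longleftrightarrow> (\<exists>n. q ^ n * t = 1)"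
  using has_prod_eq_0_iff[OF euler_prod_has_prod[OF assms, of t]] by force

lemma euler_prod_LIMSEQ:
  assumes "norm q < 1"
  shows "(\<lambda>n. \<Prod>i<n. 1 - q ^ i * t) \<longlonglongrightarrow> euler_prod q t"
  using has_prod_imp_tendsto'[OF euler_prod_has_prod[OF assms, of t]] by simp

lemma euler_prod_rec:
  assumes "norm q < 1"
  shows "euler_prod q t = (1 - t) * euler_prod q (q * t)"
proof -
  have "(\<lambda>n. \<Prod>i<Suc n. 1 - q ^ i * t) \<longlonglongrightarrow> euler_prod q t"
    by (rule LIMSEQ_Suc[OF euler_prod_LIMSEQ[OF assms]])
  moreover have "(\<Prod>i<Suc n. 1 - q ^ i * t) = (1 - t) * (\<Prod>i<n. 1 - q ^ i * (q * t))" for n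
    by (simp only: prod.lessThan_Suc_shift) (simp add: mult_ac)
  ultimately have "(\<lambda>n. (1 - t) * (\<Prod>i<n. 1 - q ^ i * (q * t))) \<longlonglongrightarrow> euler_prod q t"
    by simp
  moreover have "(\<lambda>n. (1 - t) * (\<Prod>i<n. 1 - q ^ i * (q * t))) \<longlonglongrightarrow> (1 - t) * euler_prod q (q * t)"
    by (intro tendsto_mult tendsto_const euler_prod_LIMSEQ assms)
  ultimately show ?thesis
    using LIMSEQ_unique by blast
qed

text \<open>Factors of equal index combine to a difference of squares. Together with the splitting
  by parity of the index, this yields the Euler identity used in
  \<open>theta_half_product\<close>.\<close>

lemma euler_prod_mult_uminus:
  assumes "norm q < 1"
  shows "euler_prod q t * euler_prod q (- t) = euler_prod (q ^ 2) (t ^ 2)"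
proof -
  have "norm (q ^ 2) < 1"
    using assms by (simp add: norm_power power_less_one_iff)
  then have "(\<lambda>n. \<Prod>i<n. 1 - (q ^ 2) ^ i * t ^ 2) \<longlonglongrightarrow> euler_prod (q ^ 2) (t ^ 2)"
    by (rule euler_prod_LIMSEQ)
  moreover have "(\<Prod>i<n. 1 - (q ^ 2) ^ i * t ^ 2) = (\<Prod>i<n. 1 - q ^ i * t) * (\<Prod>i<n. 1 - q ^ i * (- t))" for n
    by (simp add: prod.distrib[symmetric] power2_eq_square algebra_simps power_mult_distrib)
  moreover have "(\<lambda>n. (\<Prod>i<n. 1 - q ^ i * t) * (\<Prod>i<n. 1 - q ^ i * (- t))) \<longlonglongrightarrow> euler_prod q t * euler_prod q (- t)"
    by (intro tendsto_mult euler_prod_LIMSEQ assms)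
  ultimately show ?thesis
    using LIMSEQ_unique by force
qed

lemma euler_prod_even_odd:
  assumes "norm q < 1"
  shows "euler_prod q t = euler_prod (q ^ 2) t * euler_prod (q ^ 2) (q * t)"
proof -
  have q2: "norm (q ^ 2) < 1"
    using assms by (simp add: norm_power power_less_one_iff)
  have "(\<lambda>n. \<Prod>i<2 * n. 1 - q ^ i * t) \<longlonglongrightarrow> euler_prod q t"
    by (rule filterlim_compose[OF euler_prod_LIMSEQ[OF assms]])
       (rule mult_nat_left_at_top, simp)
  moreover have "(\<Prod>i<2 * n. 1 - q ^ i * t)
      = (\<Prod>i<n. 1 - (q ^ 2) ^ i * t) * (\<Prod>i<n. 1 - (q ^ 2) ^ i * (q * t))" for n
    by (induction n) (simp_all add: power_mult[symmetric] algebra_simps)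
  moreover have "(\<lambda>n. (\<Prod>i<n. 1 - (q ^ 2) ^ i * t) * (\<Prod>i<n. 1 - (q ^ 2) ^ i * (q * t)))
      \<longlonglongrightarrow> euler_prod (q ^ 2) t * euler_prod (q ^ 2) (q * t)"
    by (intro tendsto_mult euler_prod_LIMSEQ q2)
  ultimately show ?thesis
    using LIMSEQ_unique by force
qed

text \<open>By compactness the factors deviate from 1 by at most \<open>r ^ n * B\<close> with
  \<open>r < 1\<close>. The nome varies as well as the argument, because expansions at the cusp use
  both as functions of one local parameter.\<close>

lemma euler_prod_uniform_limit:
  assumes f: "continuous_on K f" and g: "continuous_on K g" and K: "compact K"
    and less: "\<And>z. z \<in> K \<Longrightarrow> norm (f z) < 1"
  shows "uniform_limit K (\<lambda>n z. \<Prod>i<n. 1 - f z ^ i * g z) (\<lambda>z. euler_prod (f z) (g z)) sequentially"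
proof -
  have "compact (f ` K)" "compact (g ` K)"
    using f g K by (auto intro: compact_continuous_image)
  obtain B where B: "\<And>z. z \<in> K \<Longrightarrow> norm (g z) \<le> B"
    using compact_imp_bounded[OF \<open>compact (g ` K)\<close>] unfolding bounded_iff by auto
  obtain r where r: "0 \<le> r" "r < 1" "\<And>z. z \<in> K \<Longrightarrow> norm (f z) \<le> r"
  \<comment> \<open>The maximum that serves as \<open>r\<close> exists only on a nonempty
    set.\<close>
  proof (cases "K = {}")
    case True
    then show thesis using that[of 0] by simp
  next
    case False
    have "continuous_on K (\<lambda>z. norm (f z))" using f by (intro continuous_intros)
    then obtain z0 where "z0 \<in> K" "\<forall>z\<in>K. norm (f z) \<le> norm (f z0)"
      using continuous_attains_sup[OF K False] by blast
    then show thesis using that[of "norm (f z0)"] less by auto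
  qed
  have "uniformly_convergent_on K (\<lambda>n z. \<Prod>i<n. 1 + (- (f z ^ i * g z)))"
  proof (rule uniformly_convergent_on_prod)
    show "uniformly_convergent_on K (\<lambda>n z. \<Sum>i<n. norm (- (f z ^ i * g z)))"
    proof (rule Weierstrass_m_test')
      fix n z assume "z \<in> K"
      then have "norm (f z) ^ n * norm (g z) \<le> r ^ n * B"
        using r B by (intro mult_mono power_mono) auto
      then show "norm (norm (- (f z ^ n * g z))) \<le> r ^ n * B"
        by (simp add: norm_mult norm_power)
    next
      show "summable (\<lambda>n. r ^ n * B)"
        using r by (intro summable_mult2) simp
    qed
  qed (use f g K in \<open>auto intro!: continuous_intros\<close>)
  then obtain l where l: "uniform_limit K (\<lambda>n z. \<Prod>i<n. 1 - f z ^ i * g z) l sequentially"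
    by (auto simp: uniformly_convergent_on_def)
  have "l z = euler_prod (f z) (g z)" if "z \<in> K" for z
    using tendsto_uniform_limitI[OF l that] euler_prod_LIMSEQ[OF less[OF that], of "g z"]
      LIMSEQ_unique by blast
  then show ?thesis
    using l by (simp cong: uniform_limit_cong')
qed

lemma holomorphic_on_euler_prod [holomorphic_intros]:
  assumes f: "f holomorphic_on A" and g: "g holomorphic_on A" and A: "open A"
    and less: "\<And>z. z \<in> A \<Longrightarrow> norm (f z) < 1"
  shows "(\<lambda>z. euler_prod (f z) (g z)) holomorphic_on A"
proof (rule holomorphic_uniform_sequence[OF A])
  fix z assume "z \<in> A"
  then obtain d where d: "d > 0" "cball z d \<subseteq> A"
    using A open_contains_cball by blast
  have "uniform_limit (cball z d) (\<lambda>n z. \<Prod>i<n. 1 - f z ^ i * g z) (\<lambda>z. euler_prod (f z) (g z)) sequentially"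
    using d(2) less f g
    by (intro euler_prod_uniform_limit)
       (auto intro: continuous_on_subset[OF holomorphic_on_imp_continuous_on])
  then show "\<exists>d>0. cball z d \<subseteq> A \<and>
      uniform_limit (cball z d) (\<lambda>n z. \<Prod>i<n. 1 - f z ^ i * g z) (\<lambda>z. euler_prod (f z) (g z)) sequentially"
    using d by blast
qed (use f g in \<open>auto intro!: holomorphic_intros\<close>)

section \<open>The Weierstrass function\<close>

text \<open>The coordinate order follows the summation index of \<open>weierstrass_p\<close>: the
  second one belongs to \<open>\<tau>\<close>. In \<open>torsion_point\<close> it is the
  first.\<close>

definition lattice_point :: "complex \<Rightarrow> int \<times> int \<Rightarrow> complex" where
  "lattice_point \<tau> p = of_int (fst p) + of_int (snd p) * \<tau>"

definition wp_term :: "complex \<Rightarrow> complex \<Rightarrow> int \<times> int \<Rightarrow> complex" where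
  "wp_term \<tau> z p = 1 / (z - lattice_point \<tau> p)\<^sup>2 - 1 / (lattice_point \<tau> p)\<^sup>2"

lemma weierstrass_p_altdef:
  "weierstrass_p \<tau> z = 1 / z\<^sup>2 + (\<Sum>\<^sub>\<infinity>p\<in>UNIV - {(0, 0)}. wp_term \<tau> z p)"
  unfolding weierstrass_p_def wp_term_def lattice_point_def
  by (simp add: case_prod_unfold)

section \<open>Convergence of lattice sums\<close>

lemma summable_on_diff:
  fixes f g :: "'a \<Rightarrow> 'b :: real_normed_vector"
  assumes "f summable_on A" "g summable_on A"
  shows "(\<lambda>x. f x - g x) summable_on A"
    and infsum_diff: "(\<Sum>\<^sub>\<infinity>x\<in>A. f x - g x) = infsum f A - infsum g A"
  using summable_on_add[OF assms(1), of "\<lambda>x. - g x"] infsum_add[OF assms(1), of "\<lambda>x. - g x"] assms(2)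
  by (simp_all add: summable_on_uminus infsum_uminus)

text \<open>The imaginary part controls the coefficient of \<open>\<tau>\<close>, and the triangle
  inequality then controls the other one.\<close>

lemma lattice_point_lower_bound:
  assumes "Im \<tau> > 0"
  obtains c where "c > 0"
    "\<And>p. c * (\<bar>real_of_int (fst p)\<bar> + \<bar>real_of_int (snd p)\<bar>) \<le> norm (lattice_point \<tau> p)"
proof
  \<comment> \<open>The sum of the two bounds: \<open>1 / Im \<tau>\<close> for the second
    coordinate and \<open>1 + norm \<tau> / Im \<tau>\<close> for the first.\<close>
  define K where "K = 1 + norm \<tau> / Im \<tau> + 1 / Im \<tau>"
  have K: "K > 0"
    using assms by (auto simp: K_def intro!: add_pos_nonneg)
  then show "1 / K > 0" by simp
  fix p :: "int \<times> int"
  obtain m n where p: "p = (m, n)" by fastforce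
  define L where "L = lattice_point \<tau> p"
  have "\<bar>real_of_int n\<bar> * Im \<tau> = \<bar>Im L\<bar>"
    using assms by (simp add: L_def p lattice_point_def abs_mult)
  also have "\<dots> \<le> norm L" by (rule abs_Im_le_cmod)
  finally have n: "\<bar>real_of_int n\<bar> \<le> norm L / Im \<tau>"
    using assms by (simp add: field_simps)
  have "of_int m = L - of_int n * \<tau>"
    by (simp add: L_def p lattice_point_def)
  then have "norm (of_int m :: complex) \<le> norm L + norm (of_int n * \<tau>)"
    by (metis norm_triangle_ineq4)
  then have "\<bar>real_of_int m\<bar> \<le> norm L + \<bar>real_of_int n\<bar> * norm \<tau>"
    by (simp add: norm_mult)
  also have "\<dots> \<le> norm L + norm L / Im \<tau> * norm \<tau>"
    by (intro add_left_mono mult_right_mono n) simp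
  finally have "\<bar>real_of_int m\<bar> + \<bar>real_of_int n\<bar> \<le> norm L * K"
    using n by (simp add: K_def algebra_simps)
  then show "1 / K * (\<bar>real_of_int (fst p)\<bar> + \<bar>real_of_int (snd p)\<bar>) \<le> norm (lattice_point \<tau> p)"
    using K unfolding p[symmetric] L_def[symmetric] by (simp add: p field_simps)
qed

lemma lattice_point_eq_0_iff:
  assumes "Im \<tau> > 0"
  shows "lattice_point \<tau> p = 0 \<longleftrightarrow> p = (0, 0)"
proof
  assume *: "lattice_point \<tau> p = 0"
  obtain c where "c > 0" "c * (\<bar>real_of_int (fst p)\<bar> + \<bar>real_of_int (snd p)\<bar>) \<le> norm (lattice_point \<tau> p)"
    using lattice_point_lower_bound[OF assms] by metis
  then show "p = (0, 0)" using * by (auto simp: mult_le_0_iff prod_eq_iff)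
qed (simp add: lattice_point_def)

lemma summable_on_int_powr:
  fixes s :: real
  assumes "s > 1"
  shows "(\<lambda>n :: int. (1 + \<bar>real_of_int n\<bar>) powr (- s)) summable_on UNIV" (is "?f summable_on _")
proof -
  have "summable (\<lambda>n. real (Suc n) powr (- s))"
    using summable_real_powr_iff[of "- s"] assms
      summable_Suc_iff[of "\<lambda>n. real n powr (- s)"] by simp
  then have sm: "(\<lambda>n. real (Suc n) powr (- s)) summable_on UNIV"
    by (subst summable_on_UNIV_nonneg_real_iff) auto
  have "?f \<circ> int = (\<lambda>n. real (Suc n) powr (- s))"
    by (auto simp: fun_eq_iff add_ac)
  with sm have 1: "?f summable_on range int"
    by (subst summable_on_reindex) auto
  have "?f \<circ> (\<lambda>n. - int n) = (\<lambda>n. real (Suc n) powr (- s))"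
    by (auto simp: fun_eq_iff add_ac)
  with sm have 2: "?f summable_on range (\<lambda>n. - int n)"
    by (subst summable_on_reindex) (auto intro: injI)
  have "?f summable_on (range (\<lambda>n. - int n) - range int)"
    using 2 by (rule summable_on_subset_banach) auto
  then have "?f summable_on (range int \<union> (range (\<lambda>n. - int n) - range int))"
    using 1 by (intro summable_on_Un_disjoint) auto
  also have "range int \<union> (range (\<lambda>n. - int n) - range int) = UNIV"
  proof -
    have "x \<in> range int \<or> x \<in> range (\<lambda>n. - int n)" for x
      by (cases x rule: int_cases2) auto
    then show ?thesis by auto
  qed
  finally show ?thesis .
qed

text \<open>With s the sum of the absolute values m and n of the coordinates,
  \<open>(1 + m) * (1 + n)\<close> is at most \<open>(2 * s) ^ 2\<close>. So the inverse cube is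
  dominated by a product of two one-dimensional series with exponent 3/2, which exceeds 1.\<close>

lemma summable_on_lattice:
  assumes "Im \<tau> > 0"
  shows "(\<lambda>p. 1 / norm (lattice_point \<tau> p) ^ 3) summable_on (UNIV - {(0, 0)})"
proof -
  define f where "f = (\<lambda>n :: int. (1 + \<bar>real_of_int n\<bar>) powr (- (3 / 2)))"
  have f: "f summable_on UNIV" unfolding f_def by (rule summable_on_int_powr) simp
  have fpos: "f n > 0" for n by (simp add: f_def)
  have "(\<lambda>p. norm (f (fst p) * f (snd p))) summable_on (UNIV \<times> UNIV)"
    unfolding Infinite_Sum.abs_summable_on_Sigma_iff
  proof (intro conjI ballI)
    show "(\<lambda>y. norm (f (fst (x, y)) * f (snd (x, y)))) summable_on UNIV" for x
      using summable_on_cmult_right[OF f, of "f x"] fpos by (simp add: abs_mult less_imp_le)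
    have "(\<Sum>\<^sub>\<infinity>y. norm (f (fst (x, y)) * f (snd (x, y)))) = f x * infsum f UNIV" for x
      using fpos by (simp add: abs_mult less_imp_le infsum_cmult_right')
    moreover have "(\<lambda>x. f x * infsum f UNIV) summable_on UNIV"
      by (intro summable_on_cmult_left f)
    ultimately have "(\<lambda>x. \<Sum>\<^sub>\<infinity>y. norm (f (fst (x, y)) * f (snd (x, y)))) summable_on UNIV"
      by simp
    then show "(\<lambda>x. norm (\<Sum>\<^sub>\<infinity>y. norm (f (fst (x, y)) * f (snd (x, y))))) summable_on UNIV"
      by (rule summable_on_iff_abs_summable_on_real[THEN iffD1])
  qed
  moreover have "norm (f x * f y) = f x * f y" for x y
    using fpos by (simp add: abs_mult less_imp_le)
  ultimately have sm: "(\<lambda>p. f (fst p) * f (snd p)) summable_on UNIV"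
    by simp
  obtain c where c: "c > 0"
    "\<And>p. c * (\<bar>real_of_int (fst p)\<bar> + \<bar>real_of_int (snd p)\<bar>) \<le> norm (lattice_point \<tau> p)"
    using lattice_point_lower_bound[OF assms] by metis
  have "(\<lambda>p. (8 / c ^ 3) * (f (fst p) * f (snd p))) summable_on (UNIV - {(0, 0)})"
    by (intro summable_on_cmult_right summable_on_subset_banach[OF sm]) auto
  then show ?thesis
  proof (rule summable_on_comparison_test)
    fix p :: "int \<times> int" assume p: "p \<in> UNIV - {(0, 0)}"
    define m n s where "m = \<bar>real_of_int (fst p)\<bar>" and "n = \<bar>real_of_int (snd p)\<bar>" and "s = m + n"
    have "fst p \<noteq> 0 \<or> snd p \<noteq> 0" using p by (cases p) auto
    then have "m \<ge> 1 \<or> n \<ge> 1" unfolding m_def n_def by linarith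
    moreover have mn: "m \<ge> 0" "n \<ge> 0" by (auto simp: m_def n_def)
    ultimately have s: "s \<ge> 1" unfolding s_def by linarith
    have "(1 + m) * (1 + n) \<le> (1 + s) * (1 + s)"
      using mn by (intro mult_mono) (auto simp: s_def)
    also have "\<dots> \<le> (2 * s) * (2 * s)" using s by (intro mult_mono) auto
    finally have le: "(1 + m) * (1 + n) \<le> (2 * s) powr 2" using s by (simp add: power2_eq_square)
    have "1 / norm (lattice_point \<tau> p) ^ 3 \<le> 1 / (c * s) ^ 3"
    proof -
      have "0 < c * s" "c * s \<le> norm (lattice_point \<tau> p)"
        using c(2)[of p] c(1) s by (auto simp: m_def n_def s_def)
      then show ?thesis
        by (intro divide_left_mono power_mono mult_pos_pos[of "norm _ ^ 3"] zero_less_power) auto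
    qed
    also have "1 / (c * s) ^ 3 = 8 / c ^ 3 * (2 * s) powr (- 3)"
      using s c(1) by (simp add: powr_minus powr_numeral field_simps power_mult_distrib)
    finally have le1: "1 / norm (lattice_point \<tau> p) ^ 3 \<le> 8 / c ^ 3 * (2 * s) powr (- 3)" .
    have "(2 * s) powr (- 3) = ((2 * s) powr 2) powr (- (3 / 2))"
      by (simp only: powr_powr) simp
    also have "\<dots> \<le> ((1 + m) * (1 + n)) powr (- (3 / 2))"
      using mn by (intro powr_mono2') (auto intro: le mult_pos_pos)
    also have "\<dots> = f (fst p) * f (snd p)"
      using mn by (simp add: f_def m_def n_def powr_mult)
    finally have "8 / c ^ 3 * (2 * s) powr (- 3) \<le> (8 / c ^ 3) * (f (fst p) * f (snd p))"
      using c(1) by (intro mult_left_mono) auto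
    with le1 show "1 / norm (lattice_point \<tau> p) ^ 3 \<le> (8 / c ^ 3) * (f (fst p) * f (snd p))"
      by (rule order_trans)
  qed auto
qed

lemma finite_lattice_points:
  assumes "Im \<tau> > 0"
  shows "finite {p. norm (lattice_point \<tau> p) < R}"
proof -
  obtain c where c: "c > 0"
    "\<And>p. c * (\<bar>real_of_int (fst p)\<bar> + \<bar>real_of_int (snd p)\<bar>) \<le> norm (lattice_point \<tau> p)"
    using lattice_point_lower_bound[OF assms] by metis
  define B where "B = \<lceil>R / c\<rceil>"
  have "{p. norm (lattice_point \<tau> p) < R} \<subseteq> {- B..B} \<times> {- B..B}"
  proof (safe)
    fix m n assume "norm (lattice_point \<tau> (m, n)) < R"
    then have "c * (\<bar>real_of_int m\<bar> + \<bar>real_of_int n\<bar>) < R"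
      using c(2)[of "(m, n)"] by simp
    then have "\<bar>real_of_int m\<bar> + \<bar>real_of_int n\<bar> < R / c"
      using c(1) by (simp add: field_simps)
    then have "\<bar>m\<bar> \<le> B" "\<bar>n\<bar> \<le> B"
      unfolding B_def by linarith+
    then show "m \<in> {- B..B}" "n \<in> {- B..B}" by auto
  qed
  then show ?thesis by (rule finite_subset) auto
qed

text \<open>Over a common denominator the leading terms cancel and the numerator is
  \<open>z * (2 * w - z)\<close>, only linear in w. The constant 10 is 5/2 from this numerator times
  4 from \<open>norm (z - w) \<ge> norm w / 2\<close>.\<close>

lemma wp_term_bound:
  assumes "norm z \<le> R" "2 * R \<le> norm (lattice_point \<tau> p)" "R > 0"
  shows "norm (wp_term \<tau> z p) \<le> 10 * R * (1 / norm (lattice_point \<tau> p) ^ 3)"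
proof -
  define w where "w = lattice_point \<tau> p"
  have w: "norm w \<ge> 2 * R" "norm w > 0" using assms by (auto simp: w_def)
  have zw: "norm (z - w) \<ge> norm w / 2"
    using norm_triangle_ineq2[of w z] assms(1) w by (simp add: norm_minus_commute)
  then have nz: "z - w \<noteq> 0" "w \<noteq> 0" using w by auto
  have eq: "wp_term \<tau> z p = z * (2 * w - z) / ((z - w)\<^sup>2 * w\<^sup>2)"
    using nz unfolding wp_term_def w_def[symmetric]
    by (simp add: divide_simps) (simp add: power2_eq_square algebra_simps)
  have "norm (wp_term \<tau> z p) = norm z * norm (2 * w - z) / (norm (z - w) ^ 2 * norm w ^ 2)"
    by (simp add: eq norm_mult norm_divide norm_power)
  also have "\<dots> \<le> (R * (5 / 2 * norm w)) / ((norm w / 2) ^ 2 * norm w ^ 2)"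
  proof (intro frac_le mult_mono power_mono)
    show "norm (2 * w - z) \<le> 5 / 2 * norm w"
      using norm_triangle_ineq4[of "2 * w" z] assms(1) w by (simp add: norm_mult)
  qed (use assms zw w in \<open>auto\<close>)
  also have "\<dots> = 10 * R * (1 / norm w ^ 3)"
    using w by (simp add: field_simps power2_eq_square power3_eq_cube)
  finally show ?thesis by (simp add: w_def)
qed

lemma wp_term_summable:
  assumes "Im \<tau> > 0"
  shows "wp_term \<tau> z summable_on (UNIV - {(0, 0)})"
proof -
  define R where "R = norm z + 1"
  have R: "norm z \<le> R" "R > 0" by (auto simp: R_def intro: add_nonneg_pos)
  \<comment> \<open>The cubic bound holds only beyond radius \<open>2 * R\<close>; the finitely many
    points inside are added back at the end.\<close>
  define F where "F = {p. norm (lattice_point \<tau> p) < 2 * R}"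
  have F: "finite F" unfolding F_def by (rule finite_lattice_points[OF assms])
  have "(\<lambda>p. 10 * R * (1 / norm (lattice_point \<tau> p) ^ 3)) summable_on (UNIV - {(0, 0)} - F)"
    by (intro summable_on_cmult_right summable_on_subset_banach[OF summable_on_lattice[OF assms]]) auto
  then have "(\<lambda>p. norm (wp_term \<tau> z p)) summable_on (UNIV - {(0, 0)} - F)"
    by (rule summable_on_comparison_test)
       (use R in \<open>auto intro!: wp_term_bound[where R = R, simplified] simp: F_def\<close>)
  then have "wp_term \<tau> z summable_on (UNIV - {(0, 0)} - F)"
    by (rule abs_summable_summable)
  then have "wp_term \<tau> z summable_on (UNIV - {(0, 0)} - F \<union> F \<inter> (UNIV - {(0, 0)}))"
    using F by (intro summable_on_Un_disjoint) auto
  also have "UNIV - {(0, 0)} - F \<union> F \<inter> (UNIV - {(0, 0)}) = UNIV - {(0 :: int, 0 :: int)}" by auto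
  finally show ?thesis .
qed

text \<open>Near a given point the sum is a finite part plus a far part that converges uniformly on
  a disc. The term \<open>1 / z\<^sup>2\<close> is kept outside, so that 0 belongs to the domain;
  the comparison with theta at the pole uses this.\<close>

lemma wp_sum_holomorphic:
  assumes "Im \<tau> > 0"
  shows "(\<lambda>z. \<Sum>\<^sub>\<infinity>p\<in>UNIV - {(0, 0)}. wp_term \<tau> z p) holomorphic_on
           - lattice_point \<tau> ` (UNIV - {(0, 0)})"
  unfolding holomorphic_on_def
proof
  fix z0 assume z0: "z0 \<in> - lattice_point \<tau> ` (UNIV - {(0, 0)})"
  define R where "R = norm z0 + 1"
  have R: "R > 0" by (auto simp: R_def intro: add_nonneg_pos)
  define F where "F = {p. norm (lattice_point \<tau> p) < 2 * R} - {(0, 0)}"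
  define W where "W = UNIV - {(0, 0)} - F"
  have F: "finite F" unfolding F_def using finite_lattice_points[OF assms] by auto
  have sm: "(\<lambda>p. 10 * R * (1 / norm (lattice_point \<tau> p) ^ 3)) summable_on W"
    unfolding W_def
    by (intro summable_on_cmult_right summable_on_subset_banach[OF summable_on_lattice[OF assms]]) auto
  have ul: "uniform_limit (cball 0 R) (\<lambda>Y z. \<Sum>p\<in>Y. wp_term \<tau> z p) (\<lambda>z. \<Sum>\<^sub>\<infinity>p\<in>W. wp_term \<tau> z p)
      (finite_subsets_at_top W)"
    using R by (intro Weierstrass_m_test_general[OF _ sm] wp_term_bound) (auto simp: W_def F_def)
  have hol: "(\<lambda>z. wp_term \<tau> z p) holomorphic_on cball 0 R" if "p \<in> W" for p
  proof -
    have "z - lattice_point \<tau> p \<noteq> 0" if "z \<in> cball 0 R" for z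
      using that \<open>p \<in> W\<close> R by (auto simp: W_def F_def)
    then show ?thesis unfolding wp_term_def by (intro holomorphic_intros) auto
  qed
  have "eventually (\<lambda>Y. continuous_on (cball 0 R) (\<lambda>z. \<Sum>p\<in>Y. wp_term \<tau> z p) \<and>
      (\<lambda>z. \<Sum>p\<in>Y. wp_term \<tau> z p) holomorphic_on ball 0 R) (finite_subsets_at_top W)"
  proof (rule eventually_finite_subsets_at_top_weakI)
    fix Y assume "finite Y" "Y \<subseteq> W"
    then have "(\<lambda>z. \<Sum>p\<in>Y. wp_term \<tau> z p) holomorphic_on cball 0 R"
      by (intro holomorphic_on_sum hol) auto
    then show "continuous_on (cball 0 R) (\<lambda>z. \<Sum>p\<in>Y. wp_term \<tau> z p) \<and>
      (\<lambda>z. \<Sum>p\<in>Y. wp_term \<tau> z p) holomorphic_on ball 0 R"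
      by (auto intro: holomorphic_on_imp_continuous_on holomorphic_on_subset[OF _ ball_subset_cball])
  qed
  then have hol2: "(\<lambda>z. \<Sum>\<^sub>\<infinity>p\<in>W. wp_term \<tau> z p) holomorphic_on ball 0 R"
    using holomorphic_uniform_limit[OF _ ul] by (metis finite_subsets_at_top_neq_bot)
  have "(\<lambda>z. wp_term \<tau> z p) field_differentiable (at z0)" if "p \<in> F" for p
  proof -
    have "z0 - lattice_point \<tau> p \<noteq> 0" using that z0 by (auto simp: F_def)
    then show ?thesis unfolding wp_term_def
      by (auto intro!: derivative_intros)
  qed
  then have "(\<lambda>z. (\<Sum>p\<in>F. wp_term \<tau> z p) + (\<Sum>\<^sub>\<infinity>p\<in>W. wp_term \<tau> z p)) field_differentiable (at z0)"
    using hol2 by (intro field_differentiable_add field_differentiable_sum)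
      (auto simp: R_def intro!: holomorphic_on_imp_differentiable_at[OF hol2])
  moreover have "(\<Sum>p\<in>F. wp_term \<tau> z p) + (\<Sum>\<^sub>\<infinity>p\<in>W. wp_term \<tau> z p)
      = (\<Sum>\<^sub>\<infinity>p\<in>UNIV - {(0, 0)}. wp_term \<tau> z p)" for z
  proof -
    have "(\<Sum>\<^sub>\<infinity>p\<in>F \<union> W. wp_term \<tau> z p) = (\<Sum>\<^sub>\<infinity>p\<in>F. wp_term \<tau> z p) + (\<Sum>\<^sub>\<infinity>p\<in>W. wp_term \<tau> z p)"
      using F by (intro infsum_Un_disjoint summable_on_subset_banach[OF wp_term_summable[OF assms]])
        (auto simp: W_def F_def)
    moreover have "F \<union> W = UNIV - {(0, 0)}" by (auto simp: W_def F_def)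
    ultimately show ?thesis using F by simp
  qed
  ultimately show "(\<lambda>z. \<Sum>\<^sub>\<infinity>p\<in>UNIV - {(0, 0)}. wp_term \<tau> z p) field_differentiable
      (at z0 within - lattice_point \<tau> ` (UNIV - {(0, 0)}))"
    by (simp add: field_differentiable_at_within)
qed

section \<open>Periods, parity and modular behaviour of the Weierstrass function\<close>

lemma summable_inverse_square_progression:
  fixes \<alpha> w :: complex
  assumes "\<alpha> \<noteq> 0"
  shows "(\<lambda>n :: int. 1 / (w - of_int n * \<alpha>)\<^sup>2) summable_on UNIV"
proof -
  define F where "F = {n :: int. norm (of_int n * \<alpha>) < 2 * norm w + 1}"
  have F: "finite F"
  proof (rule finite_subset)
    show "F \<subseteq> {- \<lceil>(2 * norm w + 1) / norm \<alpha>\<rceil>..\<lceil>(2 * norm w + 1) / norm \<alpha>\<rceil>}"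
    proof
      fix n assume "n \<in> F"
      then have "\<bar>real_of_int n\<bar> < (2 * norm w + 1) / norm \<alpha>"
        using assms by (simp add: F_def norm_mult field_simps)
      then show "n \<in> {- \<lceil>(2 * norm w + 1) / norm \<alpha>\<rceil>..\<lceil>(2 * norm w + 1) / norm \<alpha>\<rceil>}"
        by (simp add: abs_less_iff) linarith
    qed
  qed auto
  \<comment> \<open>Outside \<open>F\<close>, the point w halves the distance at worst, and
    \<open>\<bar>n\<bar>\<close> is at least half of \<open>1 + \<bar>n\<bar>\<close>; the resulting
    factor 4 becomes 16 after squaring.\<close>
  have "(\<lambda>n. 16 / norm \<alpha> ^ 2 * (1 + \<bar>real_of_int n\<bar>) powr (- 2)) summable_on (UNIV - F)"
    by (intro summable_on_cmult_right summable_on_subset_banach[OF summable_on_int_powr]) auto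
  then have "(\<lambda>n. norm (1 / (w - of_int n * \<alpha>)\<^sup>2)) summable_on (UNIV - F)"
  proof (rule summable_on_comparison_test)
    fix n assume n: "n \<in> UNIV - F"
    define x where "x = of_int n * \<alpha>"
    have x: "norm x \<ge> 2 * norm w" "norm x > 0"
      using n norm_ge_zero[of w] unfolding F_def x_def by (simp_all only: mem_Collect_eq Diff_iff not_less) linarith+
    then have "n \<noteq> 0" by (auto simp: x_def)
    then have n1: "\<bar>real_of_int n\<bar> \<ge> 1" by linarith
    have "norm (w - x) \<ge> norm x / 2"
      using norm_triangle_ineq2[of x w] x by (simp add: norm_minus_commute)
    moreover have "norm x / 2 \<ge> (1 + \<bar>real_of_int n\<bar>) / 4 * norm \<alpha>"
    proof -
      have "(1 + \<bar>real_of_int n\<bar>) / 2 * norm \<alpha> \<le> \<bar>real_of_int n\<bar> * norm \<alpha>"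
        using n1 by (intro mult_right_mono) auto
      then show ?thesis by (simp add: x_def norm_mult algebra_simps)
    qed
    ultimately have le: "(1 + \<bar>real_of_int n\<bar>) / 4 * norm \<alpha> \<le> norm (w - x)" by linarith
    have pos: "(1 + \<bar>real_of_int n\<bar>) / 4 * norm \<alpha> > 0"
      using assms by (intro mult_pos_pos) (auto intro: add_pos_nonneg)
    have "norm (1 / (w - x)\<^sup>2) = 1 / norm (w - x) ^ 2"
      by (simp add: norm_divide norm_power)
    also have "\<dots> \<le> 1 / ((1 + \<bar>real_of_int n\<bar>) / 4 * norm \<alpha>) ^ 2"
    proof (intro divide_left_mono power_mono le mult_pos_pos zero_less_power)
      show "0 < cmod (w - x)" using le pos by linarith
    qed (use pos in \<open>auto intro: less_imp_le\<close>)
    also have "\<dots> = 16 / norm \<alpha> ^ 2 * (1 + \<bar>real_of_int n\<bar>) powr (- 2)"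
      by (simp add: powr_minus powr_numeral power_mult_distrib power_divide inverse_eq_divide)
    finally show "norm (1 / (w - of_int n * \<alpha>)\<^sup>2) \<le> 16 / norm \<alpha> ^ 2 * (1 + \<bar>real_of_int n\<bar>) powr (- 2)"
      by (simp add: x_def)
  qed auto
  then have "(\<lambda>n. 1 / (w - of_int n * \<alpha>)\<^sup>2) summable_on (UNIV - F)"
    by (rule abs_summable_summable)
  then have "(\<lambda>n. 1 / (w - of_int n * \<alpha>)\<^sup>2) summable_on (UNIV - F \<union> F)"
    using F by (intro summable_on_Un_disjoint) auto
  then show ?thesis by simp
qed

lemma infsum_inverse_square_shift:
  fixes \<alpha> w :: complex
  assumes "\<alpha> \<noteq> 0"
  shows "(\<Sum>\<^sub>\<infinity>n :: int. 1 / (w + \<alpha> - of_int n * \<alpha>)\<^sup>2 - 1 / (w - of_int n * \<alpha>)\<^sup>2) = 0"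
proof -
  let ?f = "\<lambda>n :: int. 1 / (w - of_int n * \<alpha>)\<^sup>2"
  have *: "1 / (w + \<alpha> - of_int n * \<alpha>)\<^sup>2 = ?f (n - 1)" for n by (simp add: algebra_simps)
  have bij: "bij_betw (\<lambda>n :: int. n - 1) UNIV UNIV"
    by (rule bij_betwI[where g = "\<lambda>n. n + 1"]) auto
  have sm: "?f summable_on UNIV" by (rule summable_inverse_square_progression[OF assms])
  then have "(\<lambda>n. ?f (n - 1)) summable_on UNIV"
    by (subst summable_on_reindex_bij_betw[OF bij])
  then have "(\<Sum>\<^sub>\<infinity>n. ?f (n - 1) - ?f n) = (\<Sum>\<^sub>\<infinity>n. ?f (n - 1)) - infsum ?f UNIV"
    using sm by (rule infsum_diff)
  also have "(\<Sum>\<^sub>\<infinity>n. ?f (n - 1)) = infsum ?f UNIV"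
    by (rule infsum_reindex_bij_betw[OF bij])
  finally show ?thesis by (simp add: *)
qed

text \<open>In a difference of two values the compensating terms cancel, and the separate term
  \<open>1 / z\<^sup>2\<close> fills in the missing index \<open>(0, 0)\<close>. What remains is a
  sum over the full lattice, on which translations act.\<close>

lemma weierstrass_p_shift_eq:
  assumes "Im \<tau> > 0"
  defines "h \<equiv> \<lambda>z \<omega> p. 1 / (z + \<omega> - lattice_point \<tau> p)\<^sup>2 - 1 / (z - lattice_point \<tau> p)\<^sup>2"
  shows "h z \<omega> summable_on UNIV"
    and "weierstrass_p \<tau> (z + \<omega>) - weierstrass_p \<tau> z = infsum (h z \<omega>) UNIV"
proof -
  have eq: "h z \<omega> p = wp_term \<tau> (z + \<omega>) p - wp_term \<tau> z p" for p
    by (simp add: h_def wp_term_def)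
  have sm: "h z \<omega> summable_on (UNIV - {(0, 0)})"
    unfolding eq by (intro summable_on_diff wp_term_summable assms)
  then have "h z \<omega> summable_on (UNIV - {(0, 0)} \<union> {(0, 0)})"
    by (intro summable_on_Un_disjoint) auto
  then show "h z \<omega> summable_on UNIV" by simp
  have "infsum (h z \<omega>) (UNIV - {(0, 0)} \<union> {(0, 0)}) = infsum (h z \<omega>) (UNIV - {(0, 0)}) + h z \<omega> (0, 0)"
    using sm by (subst infsum_Un_disjoint) auto
  also have "infsum (h z \<omega>) (UNIV - {(0, 0)}) = infsum (wp_term \<tau> (z + \<omega>)) (UNIV - {(0, 0)}) - infsum (wp_term \<tau> z) (UNIV - {(0, 0)})"
    unfolding eq by (intro infsum_diff wp_term_summable assms)
  finally show "weierstrass_p \<tau> (z + \<omega>) - weierstrass_p \<tau> z = infsum (h z \<omega>) UNIV"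
    by (simp add: weierstrass_p_altdef h_def lattice_point_def)
qed

text \<open>Summing the differences along the direction of the period first, each inner sum telescopes,
  because the inverse squares along a line are summable.\<close>

lemma weierstrass_p_plus_1:
  assumes "Im \<tau> > 0"
  shows "weierstrass_p \<tau> (z + 1) = weierstrass_p \<tau> z"
proof -
  let ?h = "\<lambda>p. 1 / (z + 1 - lattice_point \<tau> p)\<^sup>2 - 1 / (z - lattice_point \<tau> p)\<^sup>2"
  have bij: "bij_betw prod.swap (UNIV :: (int \<times> int) set) UNIV" by auto
  have sm: "(\<lambda>p. ?h (prod.swap p)) summable_on UNIV \<times> UNIV"
    using weierstrass_p_shift_eq(1)[OF assms, of z 1]
    by (subst UNIV_Times_UNIV, subst summable_on_reindex_bij_betw[OF bij])
  have "infsum ?h UNIV = infsum (\<lambda>p. ?h (prod.swap p)) (UNIV \<times> UNIV)"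
    using infsum_reindex_bij_betw[OF bij, of ?h] by simp
  also have "\<dots> = (\<Sum>\<^sub>\<infinity>n. \<Sum>\<^sub>\<infinity>m. ?h (m, n))"
    using infsum_Sigma_banach[OF sm] by simp
  also have "\<dots> = (\<Sum>\<^sub>\<infinity>n::int. 0)"
  proof (rule infsum_cong)
    fix n :: int
    show "(\<Sum>\<^sub>\<infinity>m. ?h (m, n)) = 0"
      using infsum_inverse_square_shift[of 1 "z - of_int n * \<tau>"]
      by (simp add: lattice_point_def algebra_simps)
  qed
  finally show ?thesis
    using weierstrass_p_shift_eq(2)[OF assms, of z 1] by simp
qed

lemma weierstrass_p_plus_tau:
  assumes "Im \<tau> > 0"
  shows "weierstrass_p \<tau> (z + \<tau>) = weierstrass_p \<tau> z"
proof -
  let ?h = "\<lambda>p. 1 / (z + \<tau> - lattice_point \<tau> p)\<^sup>2 - 1 / (z - lattice_point \<tau> p)\<^sup>2"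
  have sm: "?h summable_on UNIV \<times> UNIV"
    using weierstrass_p_shift_eq(1)[OF assms, of z \<tau>] by simp
  have "infsum ?h UNIV = (\<Sum>\<^sub>\<infinity>m. \<Sum>\<^sub>\<infinity>n. ?h (m, n))"
    using infsum_Sigma_banach[OF sm] by simp
  also have "\<dots> = (\<Sum>\<^sub>\<infinity>n::int. 0)"
  proof (rule infsum_cong)
    fix m :: int
    show "(\<Sum>\<^sub>\<infinity>n. ?h (m, n)) = 0"
      using infsum_inverse_square_shift[of \<tau> "z - of_int m"] assms
      by (cases "\<tau> = 0") (simp_all add: lattice_point_def algebra_simps)
  qed
  finally show ?thesis
    using weierstrass_p_shift_eq(2)[OF assms, of z \<tau>] by simp
qed

lemma weierstrass_p_uminus: "weierstrass_p \<tau> (- z) = weierstrass_p \<tau> z"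
proof -
  have "infsum (wp_term \<tau> (- z)) (UNIV - {(0, 0)}) = infsum (wp_term \<tau> z) (UNIV - {(0, 0)})"
  proof (rule infsum_reindex_bij_witness[where i = "\<lambda>p. (- fst p, - snd p)" and j = "\<lambda>p. (- fst p, - snd p)"])
    fix p :: "int \<times> int"
    have "lattice_point \<tau> (- fst p, - snd p) = - lattice_point \<tau> p" by (simp add: lattice_point_def)
    then show "wp_term \<tau> z (- fst p, - snd p) = wp_term \<tau> (- z) p"
      using power2_minus[of "- z - lattice_point \<tau> p"] by (simp add: wp_term_def add.commute)
  qed (auto simp: prod_eq_iff)
  then show ?thesis by (simp add: weierstrass_p_altdef)
qed

text \<open>The lattice of the transformed modulus is the old lattice divided by \<open>j\<close>.
  The map \<open>k\<close> is the change of basis, inverted by \<open>k'\<close> thanks to the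
  determinant, and every term is homogeneous of degree -2.\<close>

lemma weierstrass_p_modular:
  assumes det: "a * d - b * c = 1" and nz: "of_int c * \<tau> + of_int d \<noteq> 0"
  defines "j \<equiv> of_int c * \<tau> + of_int d"
  shows "weierstrass_p (moebius_int a b c d \<tau>) (z / j) = j\<^sup>2 * weierstrass_p \<tau> z"
proof -
  have j: "j \<noteq> 0" using nz by (simp add: j_def)
  define k where "k = (\<lambda>p :: int \<times> int. (fst p * d + snd p * b, fst p * c + snd p * a))"
  define k' where "k' = (\<lambda>p :: int \<times> int. (fst p * a - snd p * b, snd p * d - fst p * c))"
  have lat: "lattice_point (moebius_int a b c d \<tau>) p = lattice_point \<tau> (k p) / j" for p
  proof -
    have "lattice_point \<tau> (k p) = of_int (fst p) * j + of_int (snd p) * (of_int a * \<tau> + of_int b)"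
      by (simp add: lattice_point_def k_def j_def algebra_simps)
    moreover have "x + y * (w / j) = (x * j + y * w) / j" for x y w
      using j by (simp add: add_divide_distrib)
    moreover have "lattice_point (moebius_int a b c d \<tau>) p
        = of_int (fst p) + of_int (snd p) * ((of_int a * \<tau> + of_int b) / j)"
      by (simp add: lattice_point_def moebius_int_def j_def)
    ultimately show ?thesis by metis
  qed
  have "infsum (wp_term (moebius_int a b c d \<tau>) (z / j)) (UNIV - {(0, 0)})
      = infsum (\<lambda>p. j\<^sup>2 * wp_term \<tau> z p) (UNIV - {(0, 0)})"
  proof (rule infsum_reindex_bij_witness[where i = k' and j = k])
    show "j\<^sup>2 * wp_term \<tau> z (k p) = wp_term (moebius_int a b c d \<tau>) (z / j) p" for p
    proof -
      have "1 / (x / j)\<^sup>2 = j\<^sup>2 * (1 / x\<^sup>2)" for x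
        by (simp add: power_divide)
      then show ?thesis
        unfolding wp_term_def lat diff_divide_distrib[symmetric] by (simp only: right_diff_distrib)
    qed
    have k'k: "k' (k p) = p" for p
    proof -
      have "(fst p * d + snd p * b) * a - (fst p * c + snd p * a) * b = fst p * (a * d - b * c)"
        "(fst p * c + snd p * a) * d - (fst p * d + snd p * b) * c = snd p * (a * d - b * c)"
        by (simp_all add: algebra_simps)
      then show ?thesis
        by (simp only: k_def k'_def fst_conv snd_conv det mult_1_right prod.collapse)
    qed
    have kk': "k (k' p) = p" for p
    proof -
      have "(fst p * a - snd p * b) * d + (snd p * d - fst p * c) * b = fst p * (a * d - b * c)"
        "(fst p * a - snd p * b) * c + (snd p * d - fst p * c) * a = snd p * (a * d - b * c)"
        by (simp_all add: algebra_simps)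
      then show ?thesis
        by (simp only: k_def k'_def fst_conv snd_conv det mult_1_right prod.collapse)
    qed
    have 0: "k (0, 0) = (0, 0)" "k' (0, 0) = (0, 0)" by (simp_all add: k_def k'_def)
    show "k p \<in> UNIV - {(0, 0)}" if "p \<in> UNIV - {(0, 0)}" for p
      using that k'k[of p] 0 by auto
    show "k' p \<in> UNIV - {(0, 0)}" if "p \<in> UNIV - {(0, 0)}" for p
      using that kk'[of p] 0 by auto
    show "k' (k p) = p" for p by (rule k'k)
    show "k (k' p) = p" for p by (rule kk')
  qed
  then show ?thesis
    by (simp add: weierstrass_p_altdef infsum_cmult_right' distrib_left power_divide)
qed

section \<open>Theta functions\<close>

lemma e_fun_0 [simp]: "e_fun 0 = 1"
  by (simp add: e_fun_def)

lemma e_fun_nonzero [simp]: "e_fun z \<noteq> 0"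
  by (simp add: e_fun_def)

lemma e_fun_add: "e_fun (z + w) = e_fun z * e_fun w"
  by (simp add: e_fun_def exp_add distrib_left)

lemma e_fun_diff: "e_fun (z - w) = e_fun z / e_fun w"
  by (simp add: e_fun_def exp_diff right_diff_distrib)

lemma e_fun_minus: "e_fun (- z) = inverse (e_fun z)"
  by (simp add: e_fun_def exp_minus)

lemma e_fun_power: "e_fun z ^ n = e_fun (of_nat n * z)"
  unfolding e_fun_def by (simp add: exp_of_nat_mult[symmetric] mult_ac)

lemma e_fun_eq_1_iff: "e_fun z = 1 \<longleftrightarrow> (\<exists>n. z = of_int n)"
proof -
  have "e_fun z = 1 \<longleftrightarrow> (\<exists>n :: int. 2 * of_real pi * \<i> * z = 2 * of_real pi * \<i> * of_int n)"
    unfolding e_fun_def exp_eq_1 by (auto simp: complex_eq_iff)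
  also have "\<dots> \<longleftrightarrow> (\<exists>n. z = of_int n)" by simp
  finally show ?thesis .
qed

lemma e_fun_of_int [simp]: "e_fun (of_int n) = 1"
  using e_fun_eq_1_iff by blast

lemma e_fun_numeral_values:
  "e_fun 1 = 1" "e_fun (1 / 2) = - 1" "e_fun (1 / 4) = \<i>"
  using e_fun_of_int[of 1] by (auto simp: e_fun_def complex_eq_iff Re_exp Im_exp)

lemma norm_e_fun: "norm (e_fun z) = exp (- (2 * pi * Im z))"
  by (simp add: e_fun_def)

lemma norm_e_fun_less_1: "Im z > 0 \<Longrightarrow> norm (e_fun z) < 1"
  by (simp add: norm_e_fun)

lemma holomorphic_on_e_fun [holomorphic_intros]:
  "f holomorphic_on A \<Longrightarrow> (\<lambda>z. e_fun (f z)) holomorphic_on A"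
  unfolding e_fun_def by (intro holomorphic_intros)

section \<open>The period lattice and Liouville's theorem for elliptic functions\<close>

abbreviation period_lattice :: "complex \<Rightarrow> complex set" where
  "period_lattice \<tau> \<equiv> range (lattice_point \<tau>)"

lemma lattice_pointI: "of_int m + of_int n * \<tau> \<in> period_lattice \<tau>"
  by (rule range_eqI[where x = "(m, n)"]) (simp add: lattice_point_def)

lemma lattice_add:
  assumes "z \<in> period_lattice \<tau>" "w \<in> period_lattice \<tau>"
  shows "z + w \<in> period_lattice \<tau>"
proof -
  obtain p p' where "z = lattice_point \<tau> p" "w = lattice_point \<tau> p'" using assms by auto
  then have "z + w = of_int (fst p + fst p') + of_int (snd p + snd p') * \<tau>"
    by (simp add: lattice_point_def algebra_simps)
  then show ?thesis using lattice_pointI by metis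
qed

lemma lattice_uminus: "- z \<in> period_lattice \<tau> \<longleftrightarrow> z \<in> period_lattice \<tau>"
proof -
  have "- z \<in> period_lattice \<tau>" if "z \<in> period_lattice \<tau>" for z
  proof -
    obtain p where "z = lattice_point \<tau> p" using \<open>z \<in> period_lattice \<tau>\<close> by auto
    then have "- z = of_int (- fst p) + of_int (- snd p) * \<tau>"
      by (simp add: lattice_point_def)
    then show ?thesis using lattice_pointI by metis
  qed
  from this[of z] this[of "- z"] show ?thesis by auto
qed

lemma lattice_generators: "0 \<in> period_lattice \<tau>" "1 \<in> period_lattice \<tau>" "\<tau> \<in> period_lattice \<tau>"
  using lattice_pointI[of 0 0 \<tau>] lattice_pointI[of 1 0 \<tau>] lattice_pointI[of 0 1 \<tau>] by auto

lemma lattice_add_cancel: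
  assumes "w \<in> period_lattice \<tau>"
  shows "z + w \<in> period_lattice \<tau> \<longleftrightarrow> z \<in> period_lattice \<tau>"
  using lattice_add[of "z + w" \<tau> "- w"] lattice_add[of z \<tau> w] assms by (auto simp: lattice_uminus)

lemma lattice_isolated:
  assumes "Im \<tau> > 0"
  obtains T where "open T" "z \<in> T" "T - {z} \<subseteq> - period_lattice \<tau>"
proof
  define F where "F = lattice_point \<tau> ` {p. norm (lattice_point \<tau> p) < norm z + 1} - {z}"
  have "finite F" unfolding F_def using finite_lattice_points[OF assms] by auto
  then show "open (ball 0 (norm z + 1) - F)" by (intro open_Diff finite_imp_closed) auto
  show "z \<in> ball 0 (norm z + 1) - F" by (simp add: F_def)
  show "ball 0 (norm z + 1) - F - {z} \<subseteq> - period_lattice \<tau>" by (auto simp: F_def)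
qed

lemma open_Compl_lattice:
  assumes "Im \<tau> > 0"
  shows "open (- period_lattice \<tau>)"
proof (subst open_subopen, safe)
  fix z assume "z \<notin> period_lattice \<tau>"
  moreover obtain T where "open T" "z \<in> T" "T - {z} \<subseteq> - period_lattice \<tau>"
    using lattice_isolated[OF assms] .
  ultimately show "\<exists>T. open T \<and> z \<in> T \<and> T \<subseteq> - period_lattice \<tau>" by (intro exI[of _ T]) auto
qed

lemma periodic_int_mult:
  fixes f :: "complex \<Rightarrow> 'a"
  assumes "\<And>z. f (z + w) = f z"
  shows "f (z + of_int n * w) = f z"
proof (induction n rule: int_induct[where k = 0])
  case (step1 i)
  then show ?case using assms[of "z + of_int i * w"] by (simp add: algebra_simps)
next
  case (step2 i)
  then show ?case using assms[of "z + of_int (i - 1) * w"] by (simp add: algebra_simps)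
qed simp

text \<open>The codomain is arbitrary so that predicates can be transported too, such as the
  vanishing of a function that is periodic only up to a nonzero factor.\<close>

lemma periodic_lattice:
  fixes f :: "complex \<Rightarrow> 'a"
  assumes "\<And>z. f (z + 1) = f z" "\<And>z. f (z + \<tau>) = f z" "w \<in> period_lattice \<tau>"
  shows "f (z + w) = f z"
proof -
  obtain p where "w = of_int (fst p) * 1 + of_int (snd p) * \<tau>"
    using assms(3) by (auto simp: lattice_point_def)
  then show ?thesis
    using periodic_int_mult[of f 1 z "fst p"] periodic_int_mult[of f \<tau> "z + of_int (fst p)" "snd p"] assms
    by (simp add: add.assoc)
qed

text \<open>Subtracting integral parts of the coordinates with respect to 1 and
  \<open>\<tau>\<close> moves every point into a compact parallelogram, so the function is bounded
  and Liouville's theorem applies.\<close>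

lemma elliptic_entire_constant:
  assumes \<tau>: "Im \<tau> > 0" and hol: "f holomorphic_on UNIV"
    and per: "\<And>z. f (z + 1) = f z" "\<And>z. f (z + \<tau>) = f z"
  shows "f z = f w"
proof -
  define K where "K = (\<lambda>(s, t). complex_of_real s + complex_of_real t * \<tau>) ` ({0..1} \<times> {0..1})"
  have "compact K"
    unfolding K_def case_prod_unfold
    by (intro compact_continuous_image compact_Times continuous_intros) auto
  moreover have "continuous_on K f"
    using hol by (auto intro: continuous_on_subset holomorphic_on_imp_continuous_on)
  ultimately have "bounded (f ` K)"
    by (intro compact_imp_bounded compact_continuous_image)
  moreover have "range f \<subseteq> f ` K"
  proof safe
    fix z
    define t where "t = Im z / Im \<tau>"
    define s where "s = Re z - t * Re \<tau>"
    have z: "z = of_real s + of_real t * \<tau>"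
      using \<tau> by (simp add: complex_eq_iff s_def t_def)
    define z' where "z' = of_real (frac s) + of_real (frac t) * \<tau>"
    have "z = z' + (of_int \<lfloor>s\<rfloor> + of_int \<lfloor>t\<rfloor> * \<tau>)"
      by (simp add: z z'_def frac_def algebra_simps)
    then have "f z = f z'"
      using periodic_lattice[of f \<tau>] per lattice_pointI by metis
    moreover have "z' \<in> K"
      unfolding K_def z'_def using frac_ge_0[of s] frac_lt_1[of s] frac_ge_0[of t] frac_lt_1[of t]
      by (intro image_eqI[where x = "(frac s, frac t)"]) auto
    ultimately show "f z \<in> f ` K" by auto
  qed
  ultimately have "bounded (range f)" by (rule bounded_subset)
  then have "f constant_on UNIV" using hol by (intro Liouville_theorem)
  then show ?thesis by (auto simp: constant_on_def)
qed

text \<open>The limit condition excludes even a simple pole at 0, so the singularity is removable.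
  Periodicity carries the extension to all other lattice points and reduces the claim to entire
  functions.\<close>

lemma elliptic_constant:
  assumes \<tau>: "Im \<tau> > 0" and hol: "f holomorphic_on - period_lattice \<tau>"
    and per: "\<And>z. z \<notin> period_lattice \<tau> \<Longrightarrow> f (z + 1) = f z" "\<And>z. z \<notin> period_lattice \<tau> \<Longrightarrow> f (z + \<tau>) = f z"
    and lim: "((\<lambda>z. z * f z) \<longlongrightarrow> 0) (at 0)"
    and zw: "z \<notin> period_lattice \<tau>" "w \<notin> period_lattice \<tau>"
  shows "f z = f w"
proof -
  obtain T where T: "open T" "0 \<in> T" "T - {0} \<subseteq> - period_lattice \<tau>"
    using lattice_isolated[OF \<tau>] .
  have "f holomorphic_on T - {0}" using hol T(3) by (rule holomorphic_on_subset)
  moreover have "0 \<in> interior T" using T by (simp add: interior_open)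
  ultimately obtain g where g: "g holomorphic_on T" "\<And>z. z \<in> T - {0} \<Longrightarrow> g z = f z"
    using holomorphic_on_extend_lim[of f T 0] lim by auto
  \<comment> \<open>All lattice points receive the extended value at 0, as the periods
    demand.\<close>
  define F where "F z = (if z \<in> period_lattice \<tau> then g 0 else f z)" for z
  have perF: "F (z + 1) = F z" "F (z + \<tau>) = F z" for z
    using per[of z] lattice_add_cancel[OF lattice_generators(2)[of \<tau>], of z]
      lattice_add_cancel[OF lattice_generators(3)[of \<tau>], of z]
    by (simp_all add: F_def)
  have "F field_differentiable at z0" for z0
  proof (cases "z0 \<in> period_lattice \<tau>")
    case False
    then have "f field_differentiable at z0"
      using hol open_Compl_lattice[OF \<tau>] by (auto intro: holomorphic_on_imp_differentiable_at)
    moreover have "eventually (\<lambda>z. F z = f z) (nhds z0)"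
      using False open_Compl_lattice[OF \<tau>] by (auto simp: eventually_nhds F_def)
    ultimately show ?thesis
      unfolding field_differentiable_def by (simp cong: DERIV_cong_ev)
  next
    case True
    have gF: "F z = g (z - z0)" if "z - z0 \<in> T" for z
    proof (cases "z = z0")
      case True
      then show ?thesis using \<open>z0 \<in> period_lattice \<tau>\<close> by (simp add: F_def)
    next
      case False
      then have "z - z0 \<notin> period_lattice \<tau>" using that T(3) by auto
      then have "F (z - z0) = g (z - z0)"
        using that False g(2)[of "z - z0"] by (simp add: F_def)
      moreover have "F (z - z0 + z0) = F (z - z0)"
        by (rule periodic_lattice[of F, OF perF True])
      ultimately show ?thesis by simp
    qed
    have "g field_differentiable at 0"
      using g(1) T by (auto intro: holomorphic_on_imp_differentiable_at)
    then obtain g' where "(g has_field_derivative g') (at (z0 - z0))"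
      by (auto simp: field_differentiable_def)
    then have "((\<lambda>z. g (z - z0)) has_field_derivative g' * 1) (at z0)"
      by (rule DERIV_chain2) (auto intro!: derivative_eq_intros)
    moreover have "eventually (\<lambda>z. F z = g (z - z0)) (nhds z0)"
    proof -
      have "open ((\<lambda>z. z - z0) -` T)"
        using T(1) by (intro open_vimage continuous_intros)
      then show ?thesis using gF T(2)
        by (auto simp: eventually_nhds intro!: exI[of _ "(\<lambda>z. z - z0) -` T"])
    qed
    ultimately show ?thesis
      unfolding field_differentiable_def by (simp cong: DERIV_cong_ev) blast
  qed
  then have "F holomorphic_on UNIV" by (simp add: holomorphic_on_def)
  then have "F z = F w" by (rule elliptic_entire_constant[OF \<tau> _ perF])
  then show ?thesis using zw by (simp add: F_def)
qed

text \<open>Up to a constant factor this is Jacobi's theta_1 divided by Dedekind's eta. It has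
  weight 0, so that inversion introduces a root of unity and no power of
  \<open>\<tau>\<close>.\<close>

definition theta :: "complex \<Rightarrow> complex \<Rightarrow> complex" where
  "theta \<tau> z = e_fun (\<tau> / 12 - z / 2) * euler_prod (e_fun \<tau>) (e_fun z) * euler_prod (e_fun \<tau>) (e_fun (\<tau> - z))"

section \<open>Zeros and quasi-periods of theta; factorisation of differences of Weierstrass
  values\<close>

context
  fixes \<tau> :: complex
  assumes \<tau>: "Im \<tau> > 0"
begin

lemma norm_nome: "norm (e_fun \<tau>) < 1"
  using \<tau> by (rule norm_e_fun_less_1)

lemma holomorphic_on_theta [holomorphic_intros]:
  assumes "f holomorphic_on A" "open A"
  shows "(\<lambda>z. theta \<tau> (f z)) holomorphic_on A"
  unfolding theta_def using norm_nome assms by (intro holomorphic_intros) auto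

lemma theta_plus_1: "theta \<tau> (z + 1) = - theta \<tau> z"
proof -
  have "e_fun (\<tau> / 12 - (z + 1) / 2) = - e_fun (\<tau> / 12 - z / 2)"
    by (simp add: diff_diff_eq[symmetric] add_divide_distrib e_fun_diff e_fun_numeral_values)
  moreover have "e_fun (z + 1) = e_fun z" "e_fun (\<tau> - (z + 1)) = e_fun (\<tau> - z)"
    by (simp_all add: e_fun_add e_fun_diff e_fun_numeral_values)
  ultimately show ?thesis by (simp add: theta_def)
qed

text \<open>Pulling out the first factor of one product makes the two products exchange under a sign
  change, so that oddness and the simple zero at 0 become visible.\<close>

lemma theta_product:
  "theta \<tau> z = e_fun (\<tau> / 12) * (e_fun (- z / 2) - e_fun (z / 2)) *
     euler_prod (e_fun \<tau>) (e_fun (\<tau> + z)) * euler_prod (e_fun \<tau>) (e_fun (\<tau> - z))"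
proof -
  have "euler_prod (e_fun \<tau>) (e_fun z) = (1 - e_fun z) * euler_prod (e_fun \<tau>) (e_fun (\<tau> + z))"
    using euler_prod_rec[OF norm_nome, of "e_fun z"] by (simp add: e_fun_add)
  then have "theta \<tau> z = (e_fun (\<tau> / 12 - z / 2) * (1 - e_fun z)) *
      euler_prod (e_fun \<tau>) (e_fun (\<tau> + z)) * euler_prod (e_fun \<tau>) (e_fun (\<tau> - z))"
    by (simp only: theta_def mult.assoc)
  also have "e_fun (\<tau> / 12 - z / 2) * (1 - e_fun z) = e_fun (\<tau> / 12) * (e_fun (- z / 2) - e_fun (z / 2))"
    by (simp add: right_diff_distrib e_fun_add[symmetric] add_ac)
  finally show ?thesis .
qed

lemma theta_uminus: "theta \<tau> (- z) = - theta \<tau> z"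
  by (simp add: theta_product[of z] theta_product[of "- z"] algebra_simps)

lemma theta_0: "theta \<tau> 0 = 0"
  by (simp add: theta_product)

text \<open>The shift removes \<open>1 - e_fun z\<close> from one product and adds
  \<open>1 - e_fun (- z)\<close> to the other; their quotient is
  \<open>- e_fun (- z)\<close>.\<close>

lemma theta_plus_tau: "theta \<tau> (z + \<tau>) = - e_fun (- \<tau> / 2 - z) * theta \<tau> z"
proof -
  let ?E = "euler_prod (e_fun \<tau>)"
  have 1: "?E (e_fun z) = (1 - e_fun z) * ?E (e_fun (z + \<tau>))"
    using euler_prod_rec[OF norm_nome, of "e_fun z"] by (simp add: e_fun_add mult.commute)
  have 2: "?E (e_fun (\<tau> - (z + \<tau>))) = (1 - e_fun (- z)) * ?E (e_fun (\<tau> - z))"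
    using euler_prod_rec[OF norm_nome, of "e_fun (- z)"] by (simp add: e_fun_diff e_fun_minus divide_inverse)
  have "e_fun (\<tau> / 12 - (z + \<tau>) / 2) = e_fun (- \<tau> / 2) * e_fun (\<tau> / 12 - z / 2)"
    unfolding e_fun_add[symmetric] by (rule arg_cong[where f = e_fun]) (simp add: field_simps)
  moreover have "e_fun (- \<tau> / 2 - z) = e_fun (- \<tau> / 2) * e_fun (- z)"
    by (simp add: e_fun_add[symmetric])
  moreover have "e_fun (- z) * e_fun z = 1"
    by (simp add: e_fun_add[symmetric])
  moreover have "A * B * (1 - m) = - (A * m) * B * (1 - t)" if "m * t = 1" for A B m t :: complex
  proof -
    have "- (A * m) * B * (1 - t) = A * B * (m * t) - A * B * m" by (simp add: algebra_simps)
    then show ?thesis using that by (simp add: algebra_simps)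
  qed
  ultimately have 3: "e_fun (\<tau> / 12 - (z + \<tau>) / 2) * (1 - e_fun (- z))
      = - e_fun (- \<tau> / 2 - z) * e_fun (\<tau> / 12 - z / 2) * (1 - e_fun z)"
    by presburger
  have "theta \<tau> (z + \<tau>)
      = (e_fun (\<tau> / 12 - (z + \<tau>) / 2) * (1 - e_fun (- z))) * (?E (e_fun (z + \<tau>)) * ?E (e_fun (\<tau> - z)))"
    unfolding theta_def 2 by (simp only: mult_ac)
  also have "\<dots> = - e_fun (- \<tau> / 2 - z) * theta \<tau> z"
    unfolding 3 unfolding theta_def 1 by (simp only: mult_ac mult_minus_left)
  finally show ?thesis .
qed

lemma theta_minus_tau: "theta \<tau> (z - \<tau>) = - e_fun (z - \<tau> / 2) * theta \<tau> z"
proof -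
  have "theta \<tau> z = - e_fun (- \<tau> / 2 - (z - \<tau>)) * theta \<tau> (z - \<tau>)"
    using theta_plus_tau[of "z - \<tau>"] by simp
  then have "- e_fun (z - \<tau> / 2) * theta \<tau> z
      = (e_fun (z - \<tau> / 2) * e_fun (- \<tau> / 2 - (z - \<tau>))) * theta \<tau> (z - \<tau>)" by simp
  also have "e_fun (z - \<tau> / 2) * e_fun (- \<tau> / 2 - (z - \<tau>)) = 1"
    by (simp add: e_fun_add[symmetric])
  finally show ?thesis by simp
qed

lemma theta_eq_0_iff: "theta \<tau> z = 0 \<longleftrightarrow> z \<in> period_lattice \<tau>"
proof
  assume "theta \<tau> z = 0"
  then consider n where "e_fun \<tau> ^ n * e_fun z = 1" | n where "e_fun \<tau> ^ n * e_fun (\<tau> - z) = 1"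
    by (auto simp: theta_def euler_prod_eq_0_iff[OF norm_nome])
  then show "z \<in> period_lattice \<tau>"
  proof cases
    case 1
    then obtain m where "of_nat n * \<tau> + z = of_int m"
      by (auto simp: e_fun_power e_fun_add[symmetric] e_fun_eq_1_iff)
    then have "z = of_int m + of_int (- int n) * \<tau>" by (simp add: algebra_simps)
    then show ?thesis using lattice_pointI by metis
  next
    case 2
    then obtain m where "of_nat n * \<tau> + (\<tau> - z) = of_int m"
      by (auto simp: e_fun_power e_fun_add[symmetric] e_fun_eq_1_iff)
    then have "z = of_int (- m) + of_int (int n + 1) * \<tau>" by (simp add: algebra_simps)
    then show ?thesis using lattice_pointI by metis
  qed
next
  assume "z \<in> period_lattice \<tau>"
  \<comment> \<open>Theta itself is not periodic, but its quasi-period factors are nonzero, so its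
    vanishing is.\<close>
  define Z where "Z w \<longleftrightarrow> theta \<tau> w = 0" for w
  have "Z (0 + z) = Z 0"
    by (rule periodic_lattice[of Z, OF _ _ \<open>z \<in> period_lattice \<tau>\<close>]) (simp_all add: Z_def theta_plus_1 theta_plus_tau)
  then show "theta \<tau> z = 0" by (simp add: Z_def theta_0)
qed

text \<open>The zero at 0 sits in the elementary factor of \<open>theta_product\<close>; the
  cofactor \<open>\<rho>\<close> does not vanish at 0, since no positive power of the nome equals
  1.\<close>

lemma deriv_theta_0_nonzero: "deriv (theta \<tau>) 0 \<noteq> 0"
proof -
  define \<rho> where "\<rho> z = e_fun (\<tau> / 12) * euler_prod (e_fun \<tau>) (e_fun (\<tau> + z)) * euler_prod (e_fun \<tau>) (e_fun (\<tau> - z))" for z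
  have "\<rho> holomorphic_on UNIV"
    unfolding \<rho>_def using norm_nome by (intro holomorphic_intros) auto
  then have \<rho>: "(\<rho> has_field_derivative deriv \<rho> 0) (at 0)"
    by (auto intro: holomorphic_derivI)
  have "((\<lambda>z. e_fun (- z / 2) - e_fun (z / 2)) has_field_derivative - (2 * of_real pi * \<i>)) (at 0)"
    unfolding e_fun_def by (auto intro!: derivative_eq_intros)
  then have "((\<lambda>z. (e_fun (- z / 2) - e_fun (z / 2)) * \<rho> z) has_field_derivative - (2 * of_real pi * \<i>) * \<rho> 0) (at 0)"
    by (rule derivative_eq_intros) (rule \<rho>, simp)
  moreover have "theta \<tau> = (\<lambda>z. (e_fun (- z / 2) - e_fun (z / 2)) * \<rho> z)"
    by (auto simp: fun_eq_iff theta_product \<rho>_def)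
  ultimately have "deriv (theta \<tau>) 0 = - (2 * of_real pi * \<i>) * \<rho> 0"
    using DERIV_imp_deriv by metis
  moreover have "\<rho> 0 \<noteq> 0"
  proof -
    have "e_fun \<tau> ^ n * e_fun \<tau> \<noteq> 1" for n
    proof
      assume "e_fun \<tau> ^ n * e_fun \<tau> = 1"
      then have "norm (e_fun \<tau>) ^ Suc n = 1" by (metis norm_mult norm_one norm_power power_Suc2)
      then show False using norm_nome power_eq_1_iff by fastforce
    qed
    then show ?thesis by (simp add: \<rho>_def euler_prod_eq_0_iff[OF norm_nome])
  qed
  ultimately show ?thesis by simp
qed

definition theta_quotient :: "complex \<Rightarrow> complex" where
  "theta_quotient z = (if z = 0 then deriv (theta \<tau>) 0 else theta \<tau> z / z)"

lemma theta_quotient: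
  "theta_quotient holomorphic_on UNIV" "theta \<tau> z = z * theta_quotient z"
  "theta_quotient 0 \<noteq> 0" "theta_quotient z \<noteq> 0 \<longleftrightarrow> z = 0 \<or> z \<notin> period_lattice \<tau>"
proof -
  have "theta \<tau> holomorphic_on UNIV" by (rule holomorphic_intros) auto
  from pole_lemma[OF this, of 0] show "theta_quotient holomorphic_on UNIV"
    unfolding theta_quotient_def[abs_def] theta_0 diff_zero by simp
  show "theta \<tau> z = z * theta_quotient z" "theta_quotient 0 \<noteq> 0" "theta_quotient z \<noteq> 0 \<longleftrightarrow> z = 0 \<or> z \<notin> period_lattice \<tau>"
    using deriv_theta_0_nonzero by (cases "z = 0"; simp add: theta_quotient_def theta_0 theta_eq_0_iff)+
qed

lemma weierstrass_p_holomorphic: "weierstrass_p \<tau> holomorphic_on - period_lattice \<tau>"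
proof -
  have "(\<lambda>z. 1 / z\<^sup>2 + (\<Sum>\<^sub>\<infinity>p\<in>UNIV - {(0, 0)}. wp_term \<tau> z p)) holomorphic_on - period_lattice \<tau>"
    using lattice_generators(1)[of \<tau>]
    by (intro holomorphic_intros holomorphic_on_subset[OF wp_sum_holomorphic[OF \<tau>]]) auto
  then show ?thesis by (simp add: weierstrass_p_altdef[abs_def])
qed

text \<open>The difference of both sides is elliptic and even with at most a simple pole at \<open>0\<close>, hence it
  has no pole at all and is constant; it vanishes at \<open>z = w\<close>.\<close>

lemma weierstrass_p_diff_theta:
  assumes z: "z \<notin> period_lattice \<tau>" and w: "w \<notin> period_lattice \<tau>"
  shows "weierstrass_p \<tau> z - weierstrass_p \<tau> w
    = - (deriv (theta \<tau>) 0)\<^sup>2 * (theta \<tau> (z + w) * theta \<tau> (z - w)) / ((theta \<tau> z)\<^sup>2 * (theta \<tau> w)\<^sup>2)"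
proof -
  define D where "D = deriv (theta \<tau>) 0"
  have D: "D \<noteq> 0" using deriv_theta_0_nonzero by (simp add: D_def)
  \<comment> \<open>At 0 the numerator of \<open>G\<close> below is
    \<open>- (theta \<tau> w)\<^sup>2\<close> and its denominator behaves like
    \<open>D\<^sup>2 * z\<^sup>2\<close>, so this multiple of the Weierstrass function cancels the
    double pole.\<close>
  define A where "A = - (theta \<tau> w)\<^sup>2 / D\<^sup>2"
  have \<theta>w: "theta \<tau> w \<noteq> 0" and \<theta>z: "theta \<tau> z \<noteq> 0" using z w theta_eq_0_iff by auto
  define P where "P z = theta \<tau> (z + w) * theta \<tau> (z - w)" for z
  define G where "G z = P z / (theta \<tau> z)\<^sup>2 - A * weierstrass_p \<tau> z" for z
  obtain T where T: "open T" "0 \<in> T" "T - {0} \<subseteq> - period_lattice \<tau>"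
    using lattice_isolated[OF \<tau>] .
  define s where "s z = (\<Sum>\<^sub>\<infinity>p\<in>UNIV - {(0, 0)}. wp_term \<tau> z p)" for z
  \<comment> \<open>This is \<open>z\<^sup>2 * G z\<close>, continued to 0. It vanishes there, so
    \<open>z * G z\<close> tends to its derivative at 0.\<close>
  define H where "H z = P z / (theta_quotient z)\<^sup>2 - A * (1 + z\<^sup>2 * s z)" for z
  have sub: "T \<subseteq> - lattice_point \<tau> ` (UNIV - {(0, 0)})"
  proof
    fix x assume x: "x \<in> T"
    have "x \<noteq> lattice_point \<tau> p" if "p \<noteq> (0, 0)" for p
      using that T(3) x lattice_point_eq_0_iff[OF \<tau>, of p] by auto
    then show "x \<in> - lattice_point \<tau> ` (UNIV - {(0, 0)})" by auto
  qed
  have "P holomorphic_on UNIV" unfolding P_def by (intro holomorphic_intros) auto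
  then have "H holomorphic_on T"
    unfolding H_def s_def using theta_quotient(4) T(3)
    by (intro holomorphic_intros holomorphic_on_subset[OF theta_quotient(1)]
        holomorphic_on_subset[OF wp_sum_holomorphic[OF \<tau>] sub]) (auto intro: holomorphic_on_subset)
  then have "(H has_field_derivative deriv H 0) (at 0)"
    using T by (auto intro: holomorphic_derivI)
  moreover have "H 0 = 0"
    using D by (simp add: H_def P_def A_def theta_quotient_def D_def theta_uminus power2_eq_square)
  ultimately have "((\<lambda>z. H z / z) \<longlongrightarrow> deriv H 0) (at 0)"
    by (simp add: has_field_derivative_iff)
  moreover have "eventually (\<lambda>z. H z / z = z * G z) (at 0)"
  proof -
    have "H z / z = z * G z" if "z \<in> T" "z \<noteq> 0" for z
    proof -
      have "theta_quotient z \<noteq> 0" using theta_quotient(4) that T(3) by auto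
      moreover have "(p / k\<^sup>2 - A * (1 + z\<^sup>2 * x)) / z = z * (p / (z * k)\<^sup>2 - A * (1 / z\<^sup>2 + x))"
        if "k \<noteq> 0" for p k x :: complex
        using that \<open>z \<noteq> 0\<close>
        by (simp add: power2_eq_square right_diff_distrib diff_divide_distrib distrib_left add_divide_distrib)
      ultimately show ?thesis
        unfolding H_def G_def weierstrass_p_altdef theta_quotient(2)[of z] s_def[symmetric] by blast
    qed
    then show ?thesis using T eventually_at_topological by blast
  qed
  ultimately have lim: "((\<lambda>z. z * G z) \<longlongrightarrow> deriv H 0) (at 0)"
    by (rule Lim_transform_eventually)
  have even: "G (- z) = G z" for z
  proof -
    have "- z + w = - (z - w)" "- z - w = - (z + w)" by simp_all
    then show ?thesis unfolding G_def P_def by (simp only: theta_uminus weierstrass_p_uminus) simp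
  qed
  \<comment> \<open>As \<open>z * G z\<close> is odd, its limit at 0 equals its own
    negative.\<close>
  have "filterlim uminus (at 0) (at (0 :: complex))"
    by (auto simp: filterlim_at eventually_at_filter intro!: tendsto_eq_intros)
  from filterlim_compose[OF lim this] have "((\<lambda>z. - (z * G z)) \<longlongrightarrow> deriv H 0) (at 0)"
    by (simp add: even)
  moreover have "((\<lambda>z. - (z * G z)) \<longlongrightarrow> - deriv H 0) (at 0)"
    by (intro tendsto_minus lim)
  ultimately have "deriv H 0 = - deriv H 0"
    using tendsto_unique trivial_limit_at by blast
  then have "deriv H 0 = 0" by simp
  then have lim0: "((\<lambda>z. z * G z) \<longlongrightarrow> 0) (at 0)" using lim by simp
  have "G z = G w"
  proof (rule elliptic_constant[OF \<tau> _ _ _ lim0 z w])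
    show "G holomorphic_on - period_lattice \<tau>"
      unfolding G_def P_def using theta_eq_0_iff open_Compl_lattice[OF \<tau>]
      by (intro holomorphic_intros weierstrass_p_holomorphic) auto
    have shift: "x + 1 + w = x + w + 1" "x + 1 - w = x - w + 1" "x + \<tau> + w = x + w + \<tau>" "x + \<tau> - w = x - w + \<tau>" for x
      by simp_all
    show "G (x + 1) = G x" for x
      by (simp add: G_def P_def weierstrass_p_plus_1[OF \<tau>] shift(1,2) theta_plus_1)
    have "e_fun (- \<tau> / 2 - (x + w)) * e_fun (- \<tau> / 2 - (x - w)) = (e_fun (- \<tau> / 2 - x))\<^sup>2" for x
      by (simp add: power2_eq_square e_fun_add[symmetric])
    then have "P (x + \<tau>) = (e_fun (- \<tau> / 2 - x))\<^sup>2 * P x" for x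
      unfolding P_def shift theta_plus_tau by (simp add: mult_ac)
    then show "G (x + \<tau>) = G x" for x
      by (simp add: G_def weierstrass_p_plus_tau[OF \<tau>] theta_plus_tau power_mult_distrib)
  qed
  moreover have "P w = 0" by (simp add: P_def theta_0)
  ultimately have "P z / (theta \<tau> z)\<^sup>2 = A * (weierstrass_p \<tau> z - weierstrass_p \<tau> w)"
    by (simp add: G_def algebra_simps)
  then show ?thesis
    using D \<theta>w \<theta>z unfolding P_def[symmetric] D_def[symmetric] by (simp add: A_def field_simps)
qed

text \<open>The exponential factors multiply to an elementary function, and the remaining infinite
  products cancel by Euler's identity. This normalisation determines the multiplier in
  \<open>theta_inversion\<close>.\<close>

lemma theta_half_product:
  "theta \<tau> (\<tau> / 2) * theta \<tau> (1 / 2) * theta \<tau> ((1 + \<tau>) / 2) = - 2 * e_fun (- \<tau> / 4)"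
proof -
  let ?q = "e_fun \<tau>" and ?r = "e_fun (\<tau> / 2)" and ?E = "euler_prod (e_fun \<tau>)"
  have r: "?r\<^sup>2 = ?q" by (simp add: e_fun_power)
  have half: "e_fun ((1 + \<tau>) / 2) = - ?r"
    by (simp add: add_divide_distrib e_fun_add e_fun_numeral_values)
  have "theta \<tau> (\<tau> / 2) = e_fun (\<tau> / 12 - \<tau> / 4) * (?E ?r)\<^sup>2"
    by (simp add: theta_def power2_eq_square)
  moreover have "theta \<tau> (1 / 2) = e_fun (\<tau> / 12 - 1 / 4) * (2 * (?E (- ?q))\<^sup>2)"
    using euler_prod_rec[OF norm_nome, of "- 1"]
    by (simp add: theta_def power2_eq_square e_fun_diff[of \<tau>] e_fun_numeral_values)
  moreover have "theta \<tau> ((1 + \<tau>) / 2) = e_fun (\<tau> / 12 - (1 + \<tau>) / 4) * (?E (- ?r))\<^sup>2"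
  proof -
    have "\<tau> - (1 + \<tau>) / 2 = (1 + \<tau>) / 2 - 1" by (simp add: field_simps)
    moreover have "e_fun ((1 + \<tau>) / 2 - 1) = - ?r" by (simp only: e_fun_diff half) (simp add: e_fun_numeral_values)
    ultimately have "e_fun (\<tau> - (1 + \<tau>) / 2) = - ?r"
      by (simp only:)
    then show ?thesis by (simp add: theta_def power2_eq_square half)
  qed
  ultimately have "theta \<tau> (\<tau> / 2) * theta \<tau> (1 / 2) * theta \<tau> ((1 + \<tau>) / 2)
      = 2 * (e_fun (\<tau> / 12 - \<tau> / 4) * e_fun (\<tau> / 12 - 1 / 4) * e_fun (\<tau> / 12 - (1 + \<tau>) / 4))
        * (?E ?r * ?E (- ?r) * ?E (- ?q))\<^sup>2"
    by (simp add: power_mult_distrib mult_ac)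
  also have "e_fun (\<tau> / 12 - \<tau> / 4) * e_fun (\<tau> / 12 - 1 / 4) * e_fun (\<tau> / 12 - (1 + \<tau>) / 4)
      = e_fun (- \<tau> / 4 - 1 / 2)"
    unfolding e_fun_add[symmetric] by (rule arg_cong[where f = e_fun]) (simp add: field_simps)
  also have "\<dots> = - e_fun (- \<tau> / 4)"
    by (simp add: e_fun_diff e_fun_numeral_values)
  \<comment> \<open>After multiplication by the nonzero \<open>?E ?q\<close>, pairing opposite signs
    leaves two products with nome \<open>?q\<^sup>2\<close>, and these reassemble
    \<open>?E ?q\<close> by even and odd indices.\<close>
  also have "?E ?r * ?E (- ?r) * ?E (- ?q) = 1"
  proof -
    have nz: "?E ?q \<noteq> 0"
    proof -
      have "\<tau> \<noteq> of_int m + of_int (- int n) * \<tau>" for m n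
      proof -
        have "real n * Im \<tau> \<ge> 0" using \<tau> by simp
        then have "Im \<tau> \<noteq> - (real n * Im \<tau>)" using \<tau> by linarith
        then show ?thesis by (simp add: complex_eq_iff)
      qed
      then have "e_fun \<tau> ^ n * e_fun \<tau> \<noteq> 1" for n
        by (auto simp: e_fun_power e_fun_add[symmetric] e_fun_eq_1_iff algebra_simps)
      then show ?thesis by (simp add: euler_prod_eq_0_iff[OF norm_nome])
    qed
    have "?E ?r * ?E (- ?r) = euler_prod (?q\<^sup>2) ?q"
      using euler_prod_mult_uminus[OF norm_nome, of ?r] by (simp add: r)
    moreover have "?E ?q * ?E (- ?q) = euler_prod (?q\<^sup>2) (?q\<^sup>2)"
      by (rule euler_prod_mult_uminus[OF norm_nome])
    moreover have "?E ?q = euler_prod (?q\<^sup>2) ?q * euler_prod (?q\<^sup>2) (?q\<^sup>2)"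
      using euler_prod_even_odd[OF norm_nome, of ?q] by (simp add: power2_eq_square)
    moreover have "?E ?q * (?E ?r * ?E (- ?r) * ?E (- ?q)) = (?E ?r * ?E (- ?r)) * (?E ?q * ?E (- ?q))"
      by (simp only: mult_ac)
    ultimately have "?E ?q * (?E ?r * ?E (- ?r) * ?E (- ?q)) = ?E ?q * 1"
      by simp
    then show ?thesis by (rule mult_left_cancel[OF nz, THEN iffD1])
  qed
  finally show ?thesis by simp
qed

lemma theta_plus_1_modulus: "theta (\<tau> + 1) z = e_fun (1 / 12) * theta \<tau> z"
proof -
  have "e_fun (\<tau> + 1) = e_fun \<tau>" "e_fun (\<tau> + 1 - z) = e_fun (\<tau> - z)"
    by (simp_all add: e_fun_add e_fun_diff e_fun_numeral_values)
  moreover have "e_fun ((\<tau> + 1) / 12 - z / 2) = e_fun (1 / 12) * e_fun (\<tau> / 12 - z / 2)"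
    unfolding e_fun_add[symmetric] by (rule arg_cong[where f = e_fun]) (simp add: field_simps)
  ultimately show ?thesis by (simp add: theta_def)
qed

end

text \<open>The Gaussian \<open>e_fun (- (z\<^sup>2) / (2 * \<tau>))\<close> balances the
  quasi-periods of both theta functions, so the quotient is elliptic. At 0 the numerator vanishes
  and cancels the simple zero of the denominator.\<close>

lemma theta_inversion_ex:
  assumes \<tau>: "Im \<tau> > 0"
  shows "\<exists>c. \<forall>z. theta (- 1 / \<tau>) (z / \<tau>) = c * e_fun (z\<^sup>2 / (2 * \<tau>)) * theta \<tau> z"
proof -
  have nz: "\<tau> \<noteq> 0" using \<tau> by auto
  define \<sigma> where "\<sigma> = - 1 / \<tau>"
  have \<sigma>: "Im \<sigma> > 0" using \<tau> by (simp add: \<sigma>_def Im_divide power2_eq_square add_nonneg_pos)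
  define f where "f z = theta \<sigma> (z / \<tau>) * e_fun (- (z\<^sup>2) / (2 * \<tau>)) / theta \<tau> z" for z
  have hol: "f holomorphic_on - period_lattice \<tau>"
    unfolding f_def using theta_eq_0_iff[OF \<tau>] open_Compl_lattice[OF \<tau>] \<sigma> \<tau> nz
    by (intro holomorphic_intros) auto
  have "((\<lambda>z. theta \<sigma> (z / \<tau>) * e_fun (- (z\<^sup>2) / (2 * \<tau>)) / theta_quotient \<tau> z) \<longlongrightarrow>
      theta \<sigma> (0 / \<tau>) * e_fun (- (0\<^sup>2) / (2 * \<tau>)) / theta_quotient \<tau> 0) (at 0)"
  proof -
    obtain T where T: "open T" "0 \<in> T" "T - {0} \<subseteq> - period_lattice \<tau>"
      using lattice_isolated[OF \<tau>] .
    have "(\<lambda>z. theta \<sigma> (z / \<tau>) * e_fun (- (z\<^sup>2) / (2 * \<tau>)) / theta_quotient \<tau> z) holomorphic_on T"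
      using theta_quotient(4)[OF \<tau>] T \<sigma> nz
      by (intro holomorphic_intros holomorphic_on_subset[OF theta_quotient(1)[OF \<tau>]]) auto
    then have "isCont (\<lambda>z. theta \<sigma> (z / \<tau>) * e_fun (- (z\<^sup>2) / (2 * \<tau>)) / theta_quotient \<tau> z) 0"
      using T(2) continuous_on_eq_continuous_at[OF T(1)] holomorphic_on_imp_continuous_on by blast
    then show ?thesis by (simp add: isCont_def)
  qed
  moreover have "eventually (\<lambda>z. theta \<sigma> (z / \<tau>) * e_fun (- (z\<^sup>2) / (2 * \<tau>)) / theta_quotient \<tau> z = z * f z) (at 0)"
    by (auto simp: eventually_at_filter f_def theta_quotient(2)[OF \<tau>])
  ultimately have "((\<lambda>z. z * f z) \<longlongrightarrow>
      theta \<sigma> (0 / \<tau>) * e_fun (- (0\<^sup>2) / (2 * \<tau>)) / theta_quotient \<tau> 0) (at 0)"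
    by (rule Lim_transform_eventually)
  then have lim: "((\<lambda>z. z * f z) \<longlongrightarrow> 0) (at 0)"
    using theta_0[OF \<sigma>] by simp
  have per1: "f (z + 1) = f z" for z
  proof -
    have "theta \<sigma> ((z + 1) / \<tau>) = - e_fun (z / \<tau> - \<sigma> / 2) * theta \<sigma> (z / \<tau>)"
      using theta_minus_tau[OF \<sigma>, of "z / \<tau>"] by (simp add: \<sigma>_def add_divide_distrib)
    moreover have "e_fun (z / \<tau> - \<sigma> / 2) * e_fun (- ((z + 1)\<^sup>2) / (2 * \<tau>)) = e_fun (- (z\<^sup>2) / (2 * \<tau>))"
      unfolding e_fun_add[symmetric] using nz
      by (intro arg_cong[where f = e_fun]) (simp add: \<sigma>_def field_simps power2_eq_square)
    ultimately show ?thesis by (simp add: f_def theta_plus_1[OF \<tau>] mult_ac)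
  qed
  have per2: "f (z + \<tau>) = f z" for z
  proof -
    have "theta \<sigma> ((z + \<tau>) / \<tau>) = - theta \<sigma> (z / \<tau>)"
      using theta_plus_1[OF \<sigma>, of "z / \<tau>"] nz by (simp add: add_divide_distrib)
    moreover have "e_fun (- ((z + \<tau>)\<^sup>2) / (2 * \<tau>)) = e_fun (- (z\<^sup>2) / (2 * \<tau>)) * e_fun (- \<tau> / 2 - z)"
      unfolding e_fun_add[symmetric] using nz
      by (intro arg_cong[where f = e_fun]) (simp add: field_simps power2_eq_square)
    ultimately show ?thesis by (simp add: f_def theta_plus_tau[OF \<tau>])
  qed
  have "\<exists>c. \<forall>z. z \<notin> period_lattice \<tau> \<longrightarrow> f z = c"
    using elliptic_constant[OF \<tau> hol per1 per2 lim] by metis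
  then obtain c where c: "\<And>z. z \<notin> period_lattice \<tau> \<Longrightarrow> f z = c" by auto
  have "theta \<sigma> (z / \<tau>) = c * e_fun (z\<^sup>2 / (2 * \<tau>)) * theta \<tau> z" for z
  proof (cases "z \<in> period_lattice \<tau>")
    case True
    then obtain m n where "z = of_int m + of_int n * \<tau>" by (auto simp: lattice_point_def)
    then have "z / \<tau> = of_int n + of_int (- m) * \<sigma>" using nz by (simp add: \<sigma>_def add_divide_distrib)
    then have "z / \<tau> \<in> period_lattice \<sigma>" using lattice_pointI by metis
    then show ?thesis using True theta_eq_0_iff[OF \<tau>, of z] theta_eq_0_iff[OF \<sigma>, of "z / \<tau>"] by simp
  next
    case False
    then have "theta \<tau> z \<noteq> 0" using theta_eq_0_iff[OF \<tau>, of z] by simp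
    then have 1: "theta \<sigma> (z / \<tau>) * e_fun (- (z\<^sup>2) / (2 * \<tau>)) = c * theta \<tau> z"
      using c[OF False] by (simp add: f_def divide_eq_eq)
    have 2: "e_fun (- (z\<^sup>2) / (2 * \<tau>)) * e_fun (z\<^sup>2 / (2 * \<tau>)) = 1"
      by (simp add: e_fun_add[symmetric])
    have "theta \<sigma> (z / \<tau>) = theta \<sigma> (z / \<tau>) * e_fun (- (z\<^sup>2) / (2 * \<tau>)) * e_fun (z\<^sup>2 / (2 * \<tau>))"
      by (simp only: mult.assoc 2 mult_1_right)
    then show ?thesis unfolding 1 by (simp only: mult_ac)
  qed
  then show ?thesis unfolding \<sigma>_def by blast
qed

text \<open>Inversion permutes the three nonzero half-periods up to sign and periods. Multiplying
  the three instances and evaluating both sides by \<open>theta_half_product\<close> leaves an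
  equation for \<open>c\<close> alone, namely \<open>c ^ 3 = \<i>\<close>.\<close>

lemma theta_inversion:
  assumes \<tau>: "Im \<tau> > 0"
  obtains c where "c ^ 12 = 1"
    "\<And>z. theta (- 1 / \<tau>) (z / \<tau>) = c * e_fun (z\<^sup>2 / (2 * \<tau>)) * theta \<tau> z"
proof -
  have nz: "\<tau> \<noteq> 0" using \<tau> by auto
  define \<sigma> where "\<sigma> = - 1 / \<tau>"
  have \<sigma>: "Im \<sigma> > 0" using \<tau> by (simp add: \<sigma>_def Im_divide power2_eq_square add_nonneg_pos)
  obtain c where c: "\<And>z. theta \<sigma> (z / \<tau>) = c * e_fun (z\<^sup>2 / (2 * \<tau>)) * theta \<tau> z"
    using theta_inversion_ex[OF \<tau>] unfolding \<sigma>_def by blast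
  have 1: "theta \<sigma> (1 / 2) = c * e_fun (\<tau> / 8) * theta \<tau> (\<tau> / 2)"
    using c[of "\<tau> / 2"] nz by (simp add: power2_eq_square)
  have "- theta \<sigma> (\<sigma> / 2) = c * e_fun (1 / (8 * \<tau>)) * theta \<tau> (1 / 2)"
    using c[of "1 / 2"] theta_uminus[OF \<sigma>, of "\<sigma> / 2"] by (simp add: \<sigma>_def power2_eq_square mult_ac)
  then have 2: "theta \<sigma> (\<sigma> / 2) = - (c * e_fun (1 / (8 * \<tau>)) * theta \<tau> (1 / 2))"
    by (simp only: minus_equation_iff[of "theta \<sigma> (\<sigma> / 2)"])
  have 3: "theta \<sigma> ((1 + \<sigma>) / 2) = c * e_fun ((1 + \<tau>)\<^sup>2 / (8 * \<tau>)) * theta \<tau> ((1 + \<tau>) / 2)"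
  proof -
    have "((1 + \<tau>) / 2) / \<tau> = (1 + \<sigma>) / 2 - \<sigma>"
      using nz by (simp add: \<sigma>_def field_simps)
    moreover have "theta \<sigma> ((1 + \<sigma>) / 2 - \<sigma>) = theta \<sigma> ((1 + \<sigma>) / 2)"
      unfolding theta_minus_tau[OF \<sigma>]
      by (simp add: add_divide_distrib e_fun_numeral_values)
    ultimately show ?thesis using c[of "(1 + \<tau>) / 2"] by (simp add: power_divide mult_ac)
  qed
  have "- (theta \<sigma> (\<sigma> / 2) * theta \<sigma> (1 / 2) * theta \<sigma> ((1 + \<sigma>) / 2))
      = c ^ 3 * (e_fun (\<tau> / 8) * e_fun (1 / (8 * \<tau>)) * e_fun ((1 + \<tau>)\<^sup>2 / (8 * \<tau>)))
        * (theta \<tau> (\<tau> / 2) * theta \<tau> (1 / 2) * theta \<tau> ((1 + \<tau>) / 2))"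
    unfolding 1 2 3 by (simp add: power3_eq_cube mult_ac)
  then have "2 * e_fun (- \<sigma> / 4)
      = - 2 * c ^ 3 * (e_fun (\<tau> / 8) * e_fun (1 / (8 * \<tau>)) * e_fun ((1 + \<tau>)\<^sup>2 / (8 * \<tau>)) * e_fun (- \<tau> / 4))"
    unfolding theta_half_product[OF \<tau>] theta_half_product[OF \<sigma>] by (simp only: mult_minus_left mult_minus_right minus_minus mult_ac)
  also have "e_fun (\<tau> / 8) * e_fun (1 / (8 * \<tau>)) * e_fun ((1 + \<tau>)\<^sup>2 / (8 * \<tau>)) * e_fun (- \<tau> / 4)
      = e_fun (- \<sigma> / 4 + 1 / 4)"
    unfolding e_fun_add[symmetric] using nz
    by (intro arg_cong[where f = e_fun]) (simp add: \<sigma>_def field_simps power2_eq_square)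
  also have "\<dots> = e_fun (- \<sigma> / 4) * \<i>" by (simp only: e_fun_add e_fun_numeral_values)
  finally have "e_fun (- \<sigma> / 4) * 1 = e_fun (- \<sigma> / 4) * (- (c ^ 3 * \<i>))" by (simp add: mult_ac)
  then have "- (c ^ 3 * \<i>) = 1" by (rule mult_left_cancel[OF e_fun_nonzero, THEN iffD1, symmetric])
  then have "c ^ 3 = \<i>" by (simp add: complex_eq_iff)
  then have "(c ^ 3) ^ 4 = 1" by (simp add: power4_eq_xxxx)
  then have "c ^ 12 = 1" by (simp add: power_mult[symmetric])
  with c that show thesis unfolding \<sigma>_def by blast
qed

section \<open>Modular units\<close>

lemma cyclotomic_field_facts:
  shows cyclotomic_field_1: "1 \<in> cyclotomic_field N"
    and cyclotomic_field_uminus: "x \<in> cyclotomic_field N \<Longrightarrow> - x \<in> cyclotomic_field N"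
    and cyclotomic_field_add: "x \<in> cyclotomic_field N \<Longrightarrow> y \<in> cyclotomic_field N \<Longrightarrow> x + y \<in> cyclotomic_field N"
    and cyclotomic_field_mult: "x \<in> cyclotomic_field N \<Longrightarrow> y \<in> cyclotomic_field N \<Longrightarrow> x * y \<in> cyclotomic_field N"
    and cyclotomic_field_inverse: "x \<in> cyclotomic_field N \<Longrightarrow> inverse x \<in> cyclotomic_field N"
    and cyclotomic_field_root: "e_fun (1 / of_nat N) \<in> cyclotomic_field N"
proof -
  let ?R = "ring_of_type_algebra :: complex ring"
  interpret R: field ?R by (rule field_from_type_algebra)
  have ops: "one ?R = 1" "ring.zero ?R = 0" "monoid.mult ?R x y = x * y" "add ?R x y = x + y" "x \<in> carrier ?R" for x y
    by (simp_all add: ring_of_type_algebra_def)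
  have uminus: "\<ominus>\<^bsub>?R\<^esub> x = - x" for x by (rule R.minus_equality) (simp_all add: ops)
  have inverse: "inv\<^bsub>?R\<^esub> x = inverse x" if "x \<noteq> 0" for x
    using that by (intro R.comm_inv_char) (simp_all add: ops)
  show 1: "1 \<in> cyclotomic_field N"
    using generate_field.one[of ?R] by (simp add: cyclotomic_field_def ops)
  show um: "- x \<in> cyclotomic_field N" if "x \<in> cyclotomic_field N" for x
    using generate_field.a_inv[of x ?R] that by (simp add: cyclotomic_field_def uminus)
  show ad: "x + y \<in> cyclotomic_field N" if "x \<in> cyclotomic_field N" "y \<in> cyclotomic_field N" for x y
    using generate_field.eng_add[of x ?R _ y] that by (simp add: cyclotomic_field_def ops)
  show "x * y \<in> cyclotomic_field N" if "x \<in> cyclotomic_field N" "y \<in> cyclotomic_field N"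
    using generate_field.eng_mult[of x ?R _ y] that by (simp add: cyclotomic_field_def ops)
  show "inverse x \<in> cyclotomic_field N" if "x \<in> cyclotomic_field N"
  \<comment> \<open>A generated field is closed under inverses of nonzero elements; for 0 the
    convention \<open>inverse 0 = 0\<close> only asks that 0 be a member.\<close>
  proof (cases "x = 0")
    case True
    then show ?thesis using ad[OF 1 um[OF 1]] by simp
  next
    case False
    then show ?thesis
      using generate_field.m_inv[of x ?R] that by (simp add: cyclotomic_field_def ops inverse)
  qed
  show "e_fun (1 / of_nat N) \<in> cyclotomic_field N"
    unfolding cyclotomic_field_def by (intro generate_field.incl) simp
qed

lemma cyclotomic_field_0: "0 \<in> cyclotomic_field N"
  using cyclotomic_field_add[OF cyclotomic_field_1 cyclotomic_field_uminus[OF cyclotomic_field_1], of N] by simp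

lemma cyclotomic_field_sum: "(\<And>i. i \<in> A \<Longrightarrow> f i \<in> cyclotomic_field N) \<Longrightarrow> sum f A \<in> cyclotomic_field N"
  by (induction A rule: infinite_finite_induct) (auto intro: cyclotomic_field_0 cyclotomic_field_add)

lemma cyclotomic_field_power: "x \<in> cyclotomic_field N \<Longrightarrow> x ^ n \<in> cyclotomic_field N"
  by (induction n) (auto intro: cyclotomic_field_1 cyclotomic_field_mult)

lemma cyclotomic_field_e_fun: "e_fun (of_int j / of_nat N) \<in> cyclotomic_field N"
proof (cases j rule: int_cases2)
  case (nonneg n)
  then show ?thesis
    using cyclotomic_field_power[OF cyclotomic_field_root[of N], of n] by (simp add: e_fun_power)
next
  case (nonpos n)
  then show ?thesis
    using cyclotomic_field_inverse[OF cyclotomic_field_power[OF cyclotomic_field_root[of N], of n]]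
    by (simp add: e_fun_power e_fun_minus)
qed

definition cyclotomic_coeffs :: "nat \<Rightarrow> (complex \<Rightarrow> complex) \<Rightarrow> bool" where
  "cyclotomic_coeffs N \<phi> \<longleftrightarrow> (\<exists>F. \<phi> has_fps_expansion F \<and> (\<forall>n. fps_nth F n \<in> cyclotomic_field N))"

lemma cyclotomic_coeffs_mult:
  assumes "cyclotomic_coeffs N \<phi>" "cyclotomic_coeffs N \<psi>"
  shows "cyclotomic_coeffs N (\<lambda>z. \<phi> z * \<psi> z)"
proof -
  obtain F G where FG: "\<phi> has_fps_expansion F" "\<forall>n. fps_nth F n \<in> cyclotomic_field N"
    "\<psi> has_fps_expansion G" "\<forall>n. fps_nth G n \<in> cyclotomic_field N"
    using assms unfolding cyclotomic_coeffs_def by auto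
  then have "\<forall>n. fps_nth (F * G) n \<in> cyclotomic_field N"
    by (auto simp: fps_mult_nth intro!: cyclotomic_field_sum cyclotomic_field_mult)
  then show ?thesis
    using has_fps_expansion_mult[OF FG(1,3)] unfolding cyclotomic_coeffs_def by blast
qed

text \<open>Comparing coefficients in \<open>F * inverse F = 1\<close> expresses each coefficient by
  earlier ones and the inverse of the constant term.\<close>

lemma cyclotomic_coeffs_inverse:
  assumes "cyclotomic_coeffs N \<phi>" "\<phi> 0 \<noteq> 0"
  shows "cyclotomic_coeffs N (\<lambda>z. inverse (\<phi> z))"
proof -
  obtain F where F: "\<phi> has_fps_expansion F" "\<And>n. fps_nth F n \<in> cyclotomic_field N"
    using assms unfolding cyclotomic_coeffs_def by auto
  have F0: "fps_nth F 0 \<noteq> 0"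
    using has_fps_expansion_imp_0_eq_fps_nth_0[OF F(1)] assms(2) by simp
  have "fps_nth (inverse F) n \<in> cyclotomic_field N" for n
  proof (induction n rule: less_induct)
    case (less n)
    show ?case
    proof (cases "n = 0")
      case True
      then show ?thesis using F(2)[of 0] by (simp add: cyclotomic_field_inverse)
    next
      case False
      have "fps_nth (F * inverse F) n = 0"
        using False inverse_mult_eq_1'[OF F0] by simp
      then have "fps_nth F 0 * fps_nth (inverse F) n + (\<Sum>i=1..n. fps_nth F i * fps_nth (inverse F) (n - i)) = 0"
        by (simp add: fps_mult_nth sum.atLeast_Suc_atMost)
      then have "fps_nth (inverse F) n
          = inverse (fps_nth F 0) * (- (\<Sum>i=1..n. fps_nth F i * fps_nth (inverse F) (n - i)))"
        using F0 by (simp add: eq_neg_iff_add_eq_0 divide_simps mult_ac)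
      also have "\<dots> \<in> cyclotomic_field N"
        using False F(2) less
        by (intro cyclotomic_field_mult cyclotomic_field_inverse cyclotomic_field_uminus cyclotomic_field_sum) auto
      finally show ?thesis .
    qed
  qed
  then show ?thesis
    using has_fps_expansion_inverse[OF F(1) F0] unfolding cyclotomic_coeffs_def by blast
qed

lemma cyclotomic_coeffs_linear:
  assumes "c \<in> cyclotomic_field N"
  shows "cyclotomic_coeffs N (\<lambda>z. 1 - c * z ^ k)"
proof -
  have "(\<lambda>z. 1 - c * z ^ k) has_fps_expansion (1 - fps_const c * fps_X ^ k)"
    by (intro fps_expansion_intros)
  moreover have "fps_nth (1 - fps_const c * fps_X ^ k) n \<in> cyclotomic_field N" for n
    using cyclotomic_field_add[OF cyclotomic_field_1 cyclotomic_field_uminus[OF assms]] assms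
    by (auto simp: fps_X_power_nth cyclotomic_field_1 cyclotomic_field_0 cyclotomic_field_uminus)
  ultimately show ?thesis unfolding cyclotomic_coeffs_def by blast
qed

text \<open>The field is not closed under limits, so convergence of the coefficients is not
  sufficient. However, factor n differs from 1 only in degree \<open>N * n + k\<close>, so
  coefficient m of the partial products is constant once more than m factors are present.\<close>

lemma cyclotomic_coeffs_euler_prod:
  assumes N: "N \<ge> 1" and c: "c \<in> cyclotomic_field N"
  shows "cyclotomic_coeffs N (\<lambda>z. euler_prod (z ^ N) (c * z ^ k))"
proof -
  define P where "P n z = (\<Prod>i<n. 1 - (z ^ N) ^ i * (c * z ^ k))" for n and z :: complex
  define \<phi> where "\<phi> z = euler_prod (z ^ N) (c * z ^ k)" for z
  have less: "norm (z ^ N) < 1" if "z \<in> cball 0 (1 / 2)" for z :: complex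
  proof -
    have "norm z < 1" using that by simp
    then show ?thesis using N by (simp add: norm_power power_less_one_iff)
  qed
  have "uniform_limit (cball 0 (1 / 2)) P \<phi> sequentially"
    unfolding P_def \<phi>_def using less by (intro euler_prod_uniform_limit continuous_intros) auto
  then have ul: "uniform_limit (ball 0 (1 / 2)) P \<phi> sequentially"
    by (rule uniform_limit_on_subset) auto
  have holP: "P n holomorphic_on A" for n A
    unfolding P_def by (intro holomorphic_intros)
  have hol: "\<phi> holomorphic_on ball 0 (1 / 2)"
    unfolding \<phi>_def using less by (intro holomorphic_intros) auto
  have factor: "1 - (z ^ N) ^ i * (c * z ^ k) = 1 - c * z ^ (N * i + k)" for i and z :: complex
    by (simp add: power_mult power_add mult_ac)
  have P: "P (Suc n) = (\<lambda>z. P n z * (1 - c * z ^ (N * n + k)))" for n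
    by (simp add: P_def factor fun_eq_iff)
  have coeffsP: "cyclotomic_coeffs N (P n)" for n
  proof (induction n)
    case 0
    then show ?case using cyclotomic_coeffs_linear[OF cyclotomic_field_0, of N 0] by (simp add: P_def)
  next
    case (Suc n)
    then show ?case unfolding P by (intro cyclotomic_coeffs_mult cyclotomic_coeffs_linear c)
  qed
  have nth: "fps_nth F m = (deriv ^^ m) f 0 / fact m" if "f has_fps_expansion F" for F and f :: "complex \<Rightarrow> complex" and m
    by (rule fps_nth_fps_expansion[OF that])
  have Pexp: "P n has_fps_expansion fps_expansion (P n) 0" for n
    by (intro analytic_at_imp_has_fps_expansion_0) (use holP in \<open>auto simp: analytic_on_open[of UNIV] analytic_on_subset[of _ UNIV]\<close>)
  have stable: "fps_nth (fps_expansion (P (Suc n)) 0) m = fps_nth (fps_expansion (P n) 0) m" if "m < n" for n m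
  proof -
    have "P (Suc n) has_fps_expansion (fps_expansion (P n) 0 * (1 - fps_const c * fps_X ^ (N * n + k)))"
      unfolding P by (intro fps_expansion_intros Pexp)
    then have "fps_expansion (P (Suc n)) 0 = fps_expansion (P n) 0 * (1 - fps_const c * fps_X ^ (N * n + k))"
      using Pexp fps_expansion_unique_complex by blast
    also have "\<dots> = fps_expansion (P n) 0 - fps_const c * fps_expansion (P n) 0 * fps_X ^ (N * n + k)"
      by (simp add: algebra_simps)
    also have "fps_nth \<dots> m = fps_nth (fps_expansion (P n) 0) m"
    proof -
      have "1 * n \<le> N * n" using N by (intro mult_right_mono) auto
      then have "m < N * n + k" using that by linarith
      then show ?thesis by (simp add: fps_X_power_mult_right_nth)
    qed
    finally show ?thesis .
  qed
  have "(deriv ^^ m) \<phi> 0 / fact m \<in> cyclotomic_field N" for m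
  proof -
    \<comment> \<open>The coefficient is frozen from \<open>Suc m\<close> factors on, because
      \<open>stable\<close> needs \<open>m < n\<close>.\<close>
    have const: "fps_nth (fps_expansion (P (Suc m + n)) 0) m = fps_nth (fps_expansion (P (Suc m)) 0) m" for n
      by (induction n) (use stable in auto)
    have "(\<lambda>n. (deriv ^^ m) (P n) 0) \<longlonglongrightarrow> (deriv ^^ m) \<phi> 0"
      by (rule higher_deriv_complex_uniform_limit[OF ul]) (simp_all add: holP)
    then have "(\<lambda>n. (deriv ^^ m) (P n) 0 / fact m) \<longlonglongrightarrow> (deriv ^^ m) \<phi> 0 / fact m"
      by (intro tendsto_divide tendsto_const) auto
    then have "(\<lambda>n. fps_nth (fps_expansion (P n) 0) m) \<longlonglongrightarrow> (deriv ^^ m) \<phi> 0 / fact m"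
      by (simp only: nth[OF Pexp])
    then have "(\<lambda>n. fps_nth (fps_expansion (P (n + Suc m)) 0) m) \<longlonglongrightarrow> (deriv ^^ m) \<phi> 0 / fact m"
      by (rule LIMSEQ_ignore_initial_segment)
    then have "(deriv ^^ m) \<phi> 0 / fact m = fps_nth (fps_expansion (P (Suc m)) 0) m"
      unfolding add.commute[of _ "Suc m"] const LIMSEQ_const_iff by (rule sym)
    moreover obtain F where "P (Suc m) has_fps_expansion F" "\<forall>n. fps_nth F n \<in> cyclotomic_field N"
      using coeffsP[of "Suc m"] unfolding cyclotomic_coeffs_def by blast
    ultimately show ?thesis using fps_expansion_unique_complex[OF Pexp] by simp
  qed
  moreover have \<phi>exp: "\<phi> has_fps_expansion fps_expansion \<phi> 0"
    using hol by (intro analytic_at_imp_has_fps_expansion_0) (auto simp: analytic_at intro!: exI[of _ "ball 0 (1 / 2)"])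
  ultimately have "cyclotomic_coeffs N \<phi>"
    unfolding cyclotomic_coeffs_def by (intro exI[of _ "fps_expansion \<phi> 0"]) (simp only: nth[OF \<phi>exp] simp_thms)
  then show ?thesis by (simp add: \<phi>_def[abs_def])
qed

text \<open>The expansion of a unit at \<open>\<infinity>\<close> in the parameter \<open>e(\<tau>/N)\<close>: a power of the parameter times a
  function that is holomorphic and nonvanishing on the whole disc, with coefficients in \<open>\<rat>(\<zeta>\<^sub>N)\<close>.\<close>

definition disc_unit :: "nat \<Rightarrow> (complex \<Rightarrow> complex) \<Rightarrow> bool" where
  "disc_unit N \<phi> \<longleftrightarrow> \<phi> holomorphic_on ball 0 1 \<and> (\<forall>z\<in>ball 0 1. \<phi> z \<noteq> 0) \<and> cyclotomic_coeffs N \<phi>"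

definition unit_expansion :: "nat \<Rightarrow> (complex \<Rightarrow> complex) \<Rightarrow> bool" where
  "unit_expansion N f \<longleftrightarrow> (\<exists>k \<phi>. disc_unit N \<phi> \<and>
     (\<forall>\<tau>. Im \<tau> > 0 \<longrightarrow> f \<tau> = e_fun (of_int k * \<tau> / of_nat N) * \<phi> (e_fun (\<tau> / of_nat N))))"

lemma disc_unit_mult: "disc_unit N \<phi> \<Longrightarrow> disc_unit N \<psi> \<Longrightarrow> disc_unit N (\<lambda>z. \<phi> z * \<psi> z)"
  unfolding disc_unit_def by (auto intro: holomorphic_intros cyclotomic_coeffs_mult)

lemma disc_unit_inverse: "disc_unit N \<phi> \<Longrightarrow> disc_unit N (\<lambda>z. inverse (\<phi> z))"
  unfolding disc_unit_def by (auto intro: holomorphic_intros cyclotomic_coeffs_inverse)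

lemma disc_unit_const: "c \<in> cyclotomic_field N \<Longrightarrow> c \<noteq> 0 \<Longrightarrow> disc_unit N (\<lambda>_. c)"
  unfolding disc_unit_def cyclotomic_coeffs_def
  by (auto intro!: exI[of _ "fps_const c"] simp: cyclotomic_field_0 fps_expansion_intros)

text \<open>Taking norms, a vanishing factor forces \<open>N * n + k = 0\<close>; the factor is then
  \<open>1 - c\<close>, and the last hypothesis rules this out.\<close>

lemma disc_unit_euler_prod:
  assumes N: "N \<ge> 1" and c: "c \<in> cyclotomic_field N" "norm c = 1" and k: "k > 0 \<or> c \<noteq> 1"
  shows "disc_unit N (\<lambda>z. euler_prod (z ^ N) (c * z ^ k))"
proof -
  have less: "norm (z ^ N) < 1" if "norm z < 1" for z :: complex
    using that N by (simp add: norm_power power_less_one_iff)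
  have "euler_prod (z ^ N) (c * z ^ k) \<noteq> 0" if z: "norm z < 1" for z
  proof
    assume "euler_prod (z ^ N) (c * z ^ k) = 0"
    then obtain n where n: "(z ^ N) ^ n * (c * z ^ k) = 1"
      using euler_prod_eq_0_iff[OF less[OF z]] by blast
    then have "norm ((z ^ N) ^ n * (c * z ^ k)) = 1" by simp
    then have "norm z ^ (N * n + k) = 1"
      by (simp add: norm_mult norm_power c power_mult power_add)
    then have "N * n + k = 0"
      using z power_less_one_iff[of "norm z" "N * n + k"] by force
    then show False using n N k by simp
  qed
  then show ?thesis
    unfolding disc_unit_def using cyclotomic_coeffs_euler_prod[OF N c(1)] less
    by (auto intro!: holomorphic_intros)
qed

section \<open>Calculus of expansions at the cusp\<close>

lemma unit_expansion_cong:
  assumes "unit_expansion N f" "\<And>\<tau>. Im \<tau> > 0 \<Longrightarrow> f \<tau> = g \<tau>"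
  shows "unit_expansion N g"
  using assms unfolding unit_expansion_def by metis

lemma unit_expansion_mult:
  assumes "unit_expansion N f" "unit_expansion N g"
  shows "unit_expansion N (\<lambda>\<tau>. f \<tau> * g \<tau>)"
proof -
  obtain k \<phi> l \<psi> where
    f: "disc_unit N \<phi>" "\<And>\<tau>. Im \<tau> > 0 \<Longrightarrow> f \<tau> = e_fun (of_int k * \<tau> / of_nat N) * \<phi> (e_fun (\<tau> / of_nat N))" and
    g: "disc_unit N \<psi>" "\<And>\<tau>. Im \<tau> > 0 \<Longrightarrow> g \<tau> = e_fun (of_int l * \<tau> / of_nat N) * \<psi> (e_fun (\<tau> / of_nat N))"
    using assms unfolding unit_expansion_def by blast
  have "f \<tau> * g \<tau> = e_fun (of_int (k + l) * \<tau> / of_nat N) * (\<phi> (e_fun (\<tau> / of_nat N)) * \<psi> (e_fun (\<tau> / of_nat N)))"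
    if "Im \<tau> > 0" for \<tau>
    unfolding f(2)[OF that] g(2)[OF that] of_int_add distrib_right add_divide_distrib e_fun_add
    by (simp only: mult_ac)
  then show ?thesis
    unfolding unit_expansion_def using disc_unit_mult[OF f(1) g(1)] by blast
qed

lemma unit_expansion_inverse:
  assumes "unit_expansion N f"
  shows "unit_expansion N (\<lambda>\<tau>. inverse (f \<tau>))"
proof -
  obtain k \<phi> where
    f: "disc_unit N \<phi>" "\<And>\<tau>. Im \<tau> > 0 \<Longrightarrow> f \<tau> = e_fun (of_int k * \<tau> / of_nat N) * \<phi> (e_fun (\<tau> / of_nat N))"
    using assms unfolding unit_expansion_def by blast
  have "inverse (f \<tau>) = e_fun (of_int (- k) * \<tau> / of_nat N) * inverse (\<phi> (e_fun (\<tau> / of_nat N)))"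
    if "Im \<tau> > 0" for \<tau>
    unfolding f(2)[OF that] by (simp add: e_fun_minus)
  then show ?thesis
    unfolding unit_expansion_def using disc_unit_inverse[OF f(1)] by blast
qed

lemma unit_expansion_divide:
  "unit_expansion N f \<Longrightarrow> unit_expansion N g \<Longrightarrow> unit_expansion N (\<lambda>\<tau>. f \<tau> / g \<tau>)"
  unfolding divide_inverse by (intro unit_expansion_mult unit_expansion_inverse)

lemma unit_expansion_const:
  assumes "c \<in> cyclotomic_field N" "c \<noteq> 0"
  shows "unit_expansion N (\<lambda>_. c)"
  unfolding unit_expansion_def using disc_unit_const[OF assms]
  by (intro exI[of _ 0] exI[of _ "\<lambda>_. c"]) simp

lemma unit_expansion_power: "unit_expansion N f \<Longrightarrow> unit_expansion N (\<lambda>\<tau>. f \<tau> ^ n)"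
  by (induction n) (auto intro: unit_expansion_mult unit_expansion_const cyclotomic_field_1)

lemma unit_expansion_e_fun: "unit_expansion N (\<lambda>\<tau>. e_fun ((of_int k * \<tau> + of_int j) / of_nat N))"
proof -
  have "unit_expansion N (\<lambda>\<tau>. e_fun (of_int k * \<tau> / of_nat N) * e_fun (of_int j / of_nat N))"
    unfolding unit_expansion_def
    by (intro exI[of _ k] exI[of _ "\<lambda>_. e_fun (of_int j / of_nat N)"])
       (simp add: disc_unit_const cyclotomic_field_e_fun)
  then show ?thesis by (simp add: e_fun_add add_divide_distrib)
qed

lemma unit_expansion_nonzero:
  assumes "unit_expansion N f" "N \<ge> 1" "Im \<tau> > 0"
  shows "f \<tau> \<noteq> 0"
proof -
  have "norm (e_fun (\<tau> / of_nat N)) < 1"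
    using assms by (intro norm_e_fun_less_1) simp
  then show ?thesis using assms unfolding unit_expansion_def disc_unit_def by auto
qed

lemma unit_expansion_holomorphic:
  assumes "unit_expansion N f" "N \<ge> 1"
  shows "f holomorphic_on {\<tau>. Im \<tau> > 0}"
proof -
  obtain k \<phi> where
    f: "disc_unit N \<phi>" "\<And>\<tau>. Im \<tau> > 0 \<Longrightarrow> f \<tau> = e_fun (of_int k * \<tau> / of_nat N) * \<phi> (e_fun (\<tau> / of_nat N))"
    using assms unfolding unit_expansion_def by blast
  have sub: "(\<lambda>\<tau>. e_fun (\<tau> / of_nat N)) ` {\<tau>. Im \<tau> > 0} \<subseteq> ball 0 1"
    using assms(2) by (auto intro!: norm_e_fun_less_1)
  have "(\<phi> \<circ> (\<lambda>\<tau>. e_fun (\<tau> / of_nat N))) holomorphic_on {\<tau>. Im \<tau> > 0}"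
    using f(1) assms(2) unfolding disc_unit_def
    by (intro holomorphic_on_compose_gen[OF _ _ sub] holomorphic_intros) auto
  then have "(\<lambda>\<tau>. e_fun (of_int k * \<tau> / of_nat N) * \<phi> (e_fun (\<tau> / of_nat N))) holomorphic_on {\<tau>. Im \<tau> > 0}"
    unfolding o_def using assms(2) by (intro holomorphic_on_mult holomorphic_intros) auto
  then show ?thesis by (rule holomorphic_transform) (simp add: f(2))
qed

lemma unit_expansion_fourier:
  assumes "unit_expansion N f"
  shows "\<exists>F. fourier_expansion N f F \<and> (\<forall>n. fls_nth F n \<in> cyclotomic_field N)"
proof -
  obtain k \<phi> where
    f: "disc_unit N \<phi>" "\<And>\<tau>. Im \<tau> > 0 \<Longrightarrow> f \<tau> = e_fun (of_int k * \<tau> / of_nat N) * \<phi> (e_fun (\<tau> / of_nat N))"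
    using assms unfolding unit_expansion_def by blast
  then obtain F where F: "\<phi> has_fps_expansion F" "\<And>n. fps_nth F n \<in> cyclotomic_field N"
    unfolding disc_unit_def cyclotomic_coeffs_def by blast
  have "(\<lambda>z. z powi k * \<phi> z) has_laurent_expansion (fls_X_intpow k * fps_to_fls F)"
    by (intro laurent_expansion_intros has_laurent_expansion_fps F)
  moreover have "f \<tau> = e_fun (\<tau> / of_nat N) powi k * \<phi> (e_fun (\<tau> / of_nat N))" if "Im \<tau> > 0" for \<tau>
  proof -
    have "e_fun (of_int k * \<tau> / of_nat N) = e_fun (\<tau> / of_nat N) powi k"
      by (cases k rule: int_cases2) (simp_all add: e_fun_power e_fun_minus power_int_minus)
    then show ?thesis using f(2)[OF that] by simp
  qed
  ultimately have "fourier_expansion N f (fls_X_intpow k * fps_to_fls F)"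
    unfolding fourier_expansion_def by blast
  moreover have "fls_nth (fls_X_intpow k * fps_to_fls F) n \<in> cyclotomic_field N" for n
    by (simp add: fls_X_intpow_times_conv_shift cyclotomic_field_0 F(2))
  ultimately show ?thesis by blast
qed

text \<open>The translates of the units considered here all have the same product shape. So one
  condition on translates supplies holomorphy, nonvanishing, meromorphy at all cusps and, for the
  identity matrix, the coefficient condition.\<close>

lemma is_modular_unitI:
  assumes N: "N \<ge> 1" and one: "\<And>\<tau>. \<not> Im \<tau> > 0 \<Longrightarrow> f \<tau> = 1"
    and inv: "\<And>a b c d \<tau>. a * d - b * c = 1 \<Longrightarrow> [a = 1] (mod int N) \<Longrightarrow> [b = 0] (mod int N) \<Longrightarrow>
      [c = 0] (mod int N) \<Longrightarrow> [d = 1] (mod int N) \<Longrightarrow> Im \<tau> > 0 \<Longrightarrow> f (moebius_int a b c d \<tau>) = f \<tau>"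
    and exp: "\<And>a b c d. a * d - b * c = 1 \<Longrightarrow> unit_expansion N (\<lambda>\<tau>. f (moebius_int a b c d \<tau>))"
  shows "is_modular_unit N f"
proof -
  \<comment> \<open>The identity matrix; the variables of \<open>exp\<close> occur in the order a,
    d, b, c.\<close>
  have f: "unit_expansion N f"
    using exp[of 1 1 0 0] by (simp add: moebius_int_def)
  show ?thesis
    unfolding is_modular_unit_def
  proof (intro conjI allI impI)
    show "f holomorphic_on {\<tau>. 0 < Im \<tau>}" by (rule unit_expansion_holomorphic[OF f N])
    show "f \<tau> \<noteq> 0" if "0 < Im \<tau>" for \<tau> by (rule unit_expansion_nonzero[OF f N that])
    show "f \<tau> = 1" if "\<not> 0 < Im \<tau>" for \<tau> by (rule one[OF that])
    show "\<exists>F. fourier_expansion N f F \<and> (\<forall>n. fls_nth F n \<in> cyclotomic_field N)"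
      by (rule unit_expansion_fourier[OF f])
    show "\<exists>F. fourier_expansion N (\<lambda>\<tau>. f (moebius_int a b c d \<tau>)) F" if "a * d - b * c = 1" for a b c d
      using unit_expansion_fourier[OF exp[OF that]] by blast
  qed (use inv in blast)
qed

section \<open>Siegel functions and cross-ratios\<close>

text \<open>Theta without its exponential prefactor: at a torsion point the prefactor need not be an
  integral power of \<open>e_fun (\<tau> / of_nat N)\<close>, while the products do expand in that
  parameter.\<close>

definition theta_prod :: "complex \<Rightarrow> complex \<Rightarrow> complex" where
  "theta_prod \<tau> z = euler_prod (e_fun \<tau>) (e_fun z) * euler_prod (e_fun \<tau>) (e_fun (\<tau> - z))"

lemma theta_theta_prod: "theta \<tau> z = e_fun (\<tau> / 12 - z / 2) * theta_prod \<tau> z"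
  by (simp add: theta_def theta_prod_def)

lemma theta_prod_theta: "theta_prod \<tau> z = e_fun (z / 2 - \<tau> / 12) * theta \<tau> z"
proof -
  have "e_fun (z / 2 - \<tau> / 12) * e_fun (\<tau> / 12 - z / 2) = 1"
    by (simp add: e_fun_add[symmetric])
  then show ?thesis by (simp add: theta_theta_prod mult.assoc[symmetric])
qed

lemma theta_prod_plus_tau:
  assumes "Im \<tau> > 0"
  shows "theta_prod \<tau> (z + \<tau>) = - e_fun (- z) * theta_prod \<tau> z"
proof -
  have "e_fun ((z + \<tau>) / 2 - \<tau> / 12) * e_fun (- \<tau> / 2 - z) = e_fun (- z) * e_fun (z / 2 - \<tau> / 12)"
    unfolding e_fun_add[symmetric] by (rule arg_cong[where f = e_fun]) (simp add: field_simps)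
  then show ?thesis
    unfolding theta_prod_theta theta_plus_tau[OF assms] by (simp add: mult.assoc[symmetric])
qed

abbreviation level_zero :: "nat \<Rightarrow> int \<times> int \<Rightarrow> bool" where
  "level_zero N x \<equiv> int N dvd fst x \<and> int N dvd snd x"

lemma torsion_point_add: "torsion_point N (x + y) \<tau> = torsion_point N x \<tau> + torsion_point N y \<tau>"
  by (simp add: torsion_point_def add_divide_distrib algebra_simps)

lemma torsion_point_diff: "torsion_point N (x - y) \<tau> = torsion_point N x \<tau> - torsion_point N y \<tau>"
  by (simp add: torsion_point_def add_divide_distrib diff_divide_distrib algebra_simps)

lemma torsion_point_in_lattice_iff:
  assumes N: "N \<ge> 1" and \<tau>: "Im \<tau> > 0"
  shows "torsion_point N x \<tau> \<in> period_lattice \<tau> \<longleftrightarrow> level_zero N x"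
proof
  assume "torsion_point N x \<tau> \<in> period_lattice \<tau>"
  then obtain p where "torsion_point N x \<tau> = of_int (fst p) + of_int (snd p) * \<tau>"
    by (auto simp: lattice_point_def)
  then have eq: "of_int (fst x) * \<tau> + of_int (snd x) = of_int (int N * snd p) * \<tau> + of_int (int N * fst p)"
    using N by (simp add: torsion_point_def divide_eq_eq algebra_simps)
  from arg_cong[OF eq, of Im] have "real_of_int (fst x) = of_int (int N * snd p)"
    using \<tau> by simp
  then have 1: "fst x = int N * snd p" by (simp only: of_int_eq_iff)
  from arg_cong[OF eq, of Re] 1 have "real_of_int (snd x) = of_int (int N * fst p)"
    by simp
  then have "snd x = int N * fst p" by (simp only: of_int_eq_iff)
  with 1 show "level_zero N x" by simp
next
  assume "level_zero N x"
  then obtain m n where "fst x = int N * n" "snd x = int N * m" by (auto elim!: dvdE)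
  then have "torsion_point N x \<tau> = of_int m + of_int n * \<tau>"
    using N by (simp add: torsion_point_def add_divide_distrib)
  then show "torsion_point N x \<tau> \<in> period_lattice \<tau>" using lattice_pointI by metis
qed

lemma int_periodic_mod:
  fixes P :: "int \<Rightarrow> 'a"
  assumes "\<And>k. P (k + n) = P k"
  shows "P (k mod n) = P k"
proof -
  have "P (k + m * n) = P k" for m
  proof (induction m rule: int_induct[where k = 0])
    case (step1 i)
    then show ?case using assms[of "k + i * n"] by (simp add: algebra_simps)
  next
    case (step2 i)
    then show ?case using assms[of "k + (i - 1) * n"] by (simp add: algebra_simps)
  qed simp
  from this[of "- (k div n)"] show ?thesis
    by (simp add: minus_div_mult_eq_mod[symmetric])
qed

text \<open>In the parameter z = e(\<tau>/N), the two products have arguments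
  \<open>c * z ^ k\<close> and \<open>c' * z ^ (N - k)\<close>. The bound on k makes the second
  exponent positive; if the first is 0, the assumption on the point gives that \<open>c\<close> is
  different from 1.\<close>

lemma unit_expansion_theta_prod_reduced:
  assumes N: "N \<ge> 1" and k: "k < N" and x: "\<not> level_zero N (int k, j)"
  shows "unit_expansion N (\<lambda>\<tau>. theta_prod \<tau> (torsion_point N (int k, j) \<tau>))"
proof -
  define c where "c = e_fun (of_int j / of_nat N)"
  define c' where "c' = e_fun (of_int (- j) / of_nat N)"
  define \<phi> where "\<phi> z = euler_prod (z ^ N) (c * z ^ k) * euler_prod (z ^ N) (c' * z ^ (N - k))" for z
  have "k > 0 \<or> c \<noteq> 1"
  proof (rule disjCI)
    assume "\<not> c \<noteq> 1"
    then obtain n where "of_int j / of_nat N = (of_int n :: complex)"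
      by (auto simp: c_def e_fun_eq_1_iff)
    then have "(of_int j :: complex) = of_int (n * int N)" using N by (simp add: divide_eq_eq)
    then have "j = n * int N" by (simp only: of_int_eq_iff)
    then show "k > 0" using x by (cases "k = 0") auto
  qed
  then have "disc_unit N \<phi>"
    unfolding \<phi>_def using N k
    by (intro disc_unit_mult disc_unit_euler_prod)
       (auto simp only: c_def c'_def cyclotomic_field_e_fun norm_e_fun, auto simp: norm_e_fun)
  moreover have "theta_prod \<tau> (torsion_point N (int k, j) \<tau>) = e_fun (of_int 0 * \<tau> / of_nat N) * \<phi> (e_fun (\<tau> / of_nat N))" for \<tau>
  proof -
    have "e_fun (\<tau> / of_nat N) ^ N = e_fun \<tau>" using N by (simp add: e_fun_power)
    moreover have "c * e_fun (\<tau> / of_nat N) ^ k = e_fun (torsion_point N (int k, j) \<tau>)"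
      by (simp add: c_def e_fun_power e_fun_add[symmetric] torsion_point_def add_divide_distrib add.commute)
    moreover have "c' * e_fun (\<tau> / of_nat N) ^ (N - k) = e_fun (\<tau> - torsion_point N (int k, j) \<tau>)"
    proof -
      have "of_int (- j) / of_nat N + of_nat (N - k) * (\<tau> / of_nat N) = \<tau> - torsion_point N (int k, j) \<tau>"
        using N k by (simp add: torsion_point_def of_nat_diff add_divide_distrib left_diff_distrib diff_divide_distrib)
      then show ?thesis unfolding c'_def e_fun_power e_fun_add[symmetric] by simp
    qed
    ultimately show ?thesis by (simp add: theta_prod_def \<phi>_def)
  qed
  ultimately show ?thesis unfolding unit_expansion_def by blast
qed

text \<open>Adding N to the first coordinate multiplies by \<open>- e_fun (- z)\<close>, which is
  itself a unit expansion. Membership is therefore periodic in that coordinate, and the reduced case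
  applies; the second coordinate enters only through a root of unity.\<close>

lemma unit_expansion_theta_prod:
  assumes N: "N \<ge> 1" and x: "\<not> level_zero N x"
  shows "unit_expansion N (\<lambda>\<tau>. theta_prod \<tau> (torsion_point N x \<tau>))"
proof -
  obtain k j where [simp]: "x = (k, j)" by fastforce
  define P where "P k = unit_expansion N (\<lambda>\<tau>. theta_prod \<tau> (torsion_point N (k, j) \<tau>))" for k
  have "P (k + int N) = P k" for k
  proof -
    define f where "f \<tau> = - 1 * e_fun ((of_int (- k) * \<tau> + of_int (- j)) / of_nat N)" for \<tau>
    have f: "unit_expansion N f"
      unfolding f_def by (intro unit_expansion_mult unit_expansion_e_fun unit_expansion_const cyclotomic_field_uminus cyclotomic_field_1) auto
    have eq: "theta_prod \<tau> (torsion_point N (k + int N, j) \<tau>) = f \<tau> * theta_prod \<tau> (torsion_point N (k, j) \<tau>)"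
      if "Im \<tau> > 0" for \<tau>
    proof -
      have "torsion_point N (k + int N, j) \<tau> = torsion_point N (k, j) \<tau> + \<tau>"
        using N by (simp add: torsion_point_def distrib_right add_divide_distrib)
      moreover have "- torsion_point N (k, j) \<tau> = (of_int (- k) * \<tau> + of_int (- j)) / of_nat N"
        by (simp add: torsion_point_def minus_divide_left)
      ultimately show ?thesis using theta_prod_plus_tau[OF that, of "torsion_point N (k, j) \<tau>"] by (simp add: f_def)
    qed
    show ?thesis
    proof
      assume *: "P k"
      show "P (k + int N)" unfolding P_def
        by (rule unit_expansion_cong[OF unit_expansion_mult[OF f *[unfolded P_def]]]) (simp only: eq)
    next
      assume *: "P (k + int N)"
      show "P k" unfolding P_def
        by (rule unit_expansion_cong[OF unit_expansion_divide[OF *[unfolded P_def] f]])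
           (simp add: eq, simp add: f_def)
    qed
  qed
  then have "P (k mod int N) = P k" by (rule int_periodic_mod)
  moreover have "P (k mod int N)"
  proof -
    have "k mod int N = int (nat (k mod int N))" "nat (k mod int N) < N"
      using N by (simp_all add: nat_less_iff)
    moreover have "\<not> level_zero N (k mod int N, j)" using x by (simp add: dvd_mod_iff)
    ultimately show ?thesis
      using unit_expansion_theta_prod_reduced[OF N, of "nat (k mod int N)" j] by (simp add: P_def)
  qed
  ultimately show ?thesis by (simp add: P_def)
qed

text \<open>The power \<open>12 N\<close> of the Klein form; unlike the Siegel function it is permuted by \<open>SL\<^sub>2(\<int>)\<close>
  without multipliers and depends on \<open>x\<close> modulo \<open>N\<close> only.\<close>

definition klein :: "nat \<Rightarrow> int \<times> int \<Rightarrow> complex \<Rightarrow> complex" where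
  "klein N x \<tau> = e_fun (of_int (fst x) * torsion_point N x \<tau> / (2 * of_nat N)) * theta \<tau> (torsion_point N x \<tau>)"

abbreviation klein_power :: "nat \<Rightarrow> int \<times> int \<Rightarrow> complex \<Rightarrow> complex" where
  "klein_power N x \<tau> \<equiv> klein N x \<tau> ^ (12 * N)"

lemma klein_power_uminus:
  assumes "Im \<tau> > 0"
  shows "klein_power N (- x) \<tau> = klein_power N x \<tau>"
proof -
  have "torsion_point N (- x) \<tau> = - torsion_point N x \<tau>"
    by (simp add: torsion_point_def minus_divide_left)
  then have "klein N (- x) \<tau> = - klein N x \<tau>"
    by (simp add: klein_def theta_uminus[OF assms])
  then show ?thesis by simp
qed

lemma e_fun_of_int_eq_1: "z = of_int n \<Longrightarrow> e_fun z = 1"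
  by simp

lemma power_12N_eq_1:
  assumes "c ^ 12 = (1 :: complex)"
  shows "c ^ (12 * N) = 1"
  using assms by (simp add: power_mult)

text \<open>The quadratic exponential in \<open>klein\<close> absorbs the dependence of the
  quasi-period factor on \<open>\<tau>\<close>. What remains is, up to sign, a power of e(1/(2N)),
  and raising to the power 12N removes it.\<close>

lemma klein_power_shift:
  assumes N: "N \<ge> 1" and \<tau>: "Im \<tau> > 0"
  shows "klein_power N (k + int N, j) \<tau> = klein_power N (k, j) \<tau>"
    and "klein_power N (k, j + int N) \<tau> = klein_power N (k, j) \<tau>"
proof -
  let ?z = "torsion_point N (k, j) \<tau>"
  have z: "?z = of_int k * \<tau> / of_nat N + of_int j / of_nat N"
    by (simp add: torsion_point_def add_divide_distrib)
  have "torsion_point N (k + int N, j) \<tau> = ?z + \<tau>"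
    using N by (simp add: torsion_point_def distrib_right add_divide_distrib)
  then have "klein N (k + int N, j) \<tau>
      = - (e_fun (of_int (k + int N) * (?z + \<tau>) / (2 * of_nat N)) * e_fun (- \<tau> / 2 - ?z)) * theta \<tau> ?z"
    by (simp add: klein_def theta_plus_tau[OF \<tau>])
  also have "e_fun (of_int (k + int N) * (?z + \<tau>) / (2 * of_nat N)) * e_fun (- \<tau> / 2 - ?z)
      = e_fun (- (of_int j / (2 * of_nat N))) * e_fun (of_int k * ?z / (2 * of_nat N))"
  proof -
    have "of_int (k + int N) * (?z + \<tau>) / (2 * of_nat N)
        = of_int k * ?z / (2 * of_nat N) + of_int k * \<tau> / (2 * of_nat N) + ?z / 2 + \<tau> / 2"
      using N by (simp add: distrib_left distrib_right add_divide_distrib)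
    moreover have "of_int k * \<tau> / (2 * of_nat N) - ?z / 2 = - (of_int j / (2 * of_nat N))"
      by (simp add: z add_divide_distrib)
    ultimately show ?thesis
      unfolding e_fun_add[symmetric] by (intro arg_cong[where f = e_fun]) (simp add: algebra_simps)
  qed
  finally have "klein N (k + int N, j) \<tau> = - e_fun (- (of_int j / (2 * of_nat N))) * klein N (k, j) \<tau>"
    by (simp add: klein_def)
  moreover have "(- e_fun (- (of_int j / (2 * of_nat N)))) ^ (12 * N) = 1"
    using N by (simp add: e_fun_power) (rule e_fun_of_int_eq_1[of _ "- 6 * j"], simp)
  ultimately show "klein_power N (k + int N, j) \<tau> = klein_power N (k, j) \<tau>"
    by (simp only: power_mult_distrib mult_1_left)
  have "torsion_point N (k, j + int N) \<tau> = ?z + 1"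
    using N by (simp add: torsion_point_def add_divide_distrib)
  then have "klein N (k, j + int N) \<tau> = - e_fun (of_int k / (2 * of_nat N)) * klein N (k, j) \<tau>"
    by (simp add: klein_def theta_plus_1[OF \<tau>] distrib_left add_divide_distrib e_fun_add)
  moreover have "(- e_fun (of_int k / (2 * of_nat N))) ^ (12 * N) = 1"
    using N by (simp add: e_fun_power) (rule e_fun_of_int_eq_1[of _ "6 * k"], simp)
  ultimately show "klein_power N (k, j + int N) \<tau> = klein_power N (k, j) \<tau>"
    by (simp only: power_mult_distrib mult_1_left)
qed

lemma klein_power_mod:
  assumes "N \<ge> 1" "Im \<tau> > 0"
  shows "klein_power N (k mod int N, j mod int N) \<tau> = klein_power N (k, j) \<tau>"
  using int_periodic_mod[of "\<lambda>k. klein_power N (k, j mod int N) \<tau>" "int N" k]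
    int_periodic_mod[of "\<lambda>j. klein_power N (k, j) \<tau>" "int N" j] klein_power_shift[OF assms]
  by simp

lemma klein_power_cong:
  assumes "N \<ge> 1" "Im \<tau> > 0" "level_zero N (x - y)"
  shows "klein_power N x \<tau> = klein_power N y \<tau>"
proof -
  have "fst x mod int N = fst y mod int N" "snd x mod int N = snd y mod int N"
    using assms(3) by (auto simp: mod_eq_dvd_iff)
  then show ?thesis
    using klein_power_mod[OF assms(1,2), of "fst x" "snd x"] klein_power_mod[OF assms(1,2), of "fst y" "snd y"] by simp
qed

lemma klein_power_translate_1:
  assumes \<tau>: "Im \<tau> > 0"
  shows "klein_power N x (\<tau> + 1) = klein_power N (fst x, fst x + snd x) \<tau>"
proof -
  have "torsion_point N x (\<tau> + 1) = torsion_point N (fst x, fst x + snd x) \<tau>"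
    by (simp add: torsion_point_def algebra_simps)
  then have "klein N x (\<tau> + 1) = e_fun (1 / 12) * klein N (fst x, fst x + snd x) \<tau>"
    by (simp add: klein_def theta_plus_1_modulus[OF \<tau>])
  moreover have "e_fun (1 / 12) ^ (12 * N) = 1"
    by (intro power_12N_eq_1) (simp add: e_fun_power e_fun_numeral_values)
  ultimately show ?thesis by (simp only: power_mult_distrib mult_1_left)
qed

lemma klein_power_translate:
  assumes \<tau>: "Im \<tau> > 0"
  shows "klein_power N x (\<tau> + of_int k) = klein_power N (fst x, fst x * k + snd x) \<tau>"
proof (induction k arbitrary: x rule: int_induct[where k = 0])
  case (step1 i)
  have "klein_power N x (\<tau> + of_int (i + 1)) = klein_power N x (\<tau> + of_int i + 1)"
    by (simp add: add.assoc)
  also have "\<dots> = klein_power N (fst x, fst x * (i + 1) + snd x) \<tau>"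
    using \<tau> by (simp add: klein_power_translate_1 step1) (simp add: algebra_simps)
  finally show ?case .
next
  case (step2 i)
  have "klein_power N (fst x, snd x - fst x) (\<tau> + of_int (i - 1) + 1) = klein_power N x (\<tau> + of_int (i - 1))"
    using \<tau> by (subst klein_power_translate_1) simp_all
  then have "klein_power N x (\<tau> + of_int (i - 1)) = klein_power N (fst x, snd x - fst x) (\<tau> + of_int i)"
    by simp
  also have "\<dots> = klein_power N (fst x, fst x * (i - 1) + snd x) \<tau>"
    unfolding step2 by (simp add: algebra_simps)
  finally show ?case .
qed simp

text \<open>The Gaussian of \<open>theta_inversion\<close> is exactly the difference between the
  exponentials in the two values of \<open>klein\<close>, and the multiplier has order dividing
  12.\<close>

lemma klein_power_inversion:
  assumes \<tau>: "Im \<tau> > 0"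
  shows "klein_power N x (- 1 / \<tau>) = klein_power N (snd x, - fst x) \<tau>"
proof -
  have nz: "\<tau> \<noteq> 0" using \<tau> by auto
  obtain c where c: "c ^ 12 = 1" "\<And>z. theta (- 1 / \<tau>) (z / \<tau>) = c * e_fun (z\<^sup>2 / (2 * \<tau>)) * theta \<tau> z"
    using theta_inversion[OF \<tau>] by blast
  define z where "z = torsion_point N (snd x, - fst x) \<tau>"
  have z: "torsion_point N x (- 1 / \<tau>) = z / \<tau>"
    using nz by (simp add: z_def torsion_point_def add_divide_distrib diff_divide_distrib)
  have "z * \<tau> * (of_int (snd x) / of_nat N) = z * (z + of_int (fst x) / of_nat N)"
    by (simp add: z_def torsion_point_def diff_divide_distrib)
  then have "(of_int (fst x) * (z / \<tau>) / (2 * of_nat N)) + z\<^sup>2 / (2 * \<tau>) = of_int (snd x) * z / (2 * of_nat N)"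
    using nz by (simp add: field_simps power2_eq_square)
  then have "e_fun (of_int (fst x) * (z / \<tau>) / (2 * of_nat N)) * e_fun (z\<^sup>2 / (2 * \<tau>)) = e_fun (of_int (snd x) * z / (2 * of_nat N))"
    by (simp add: e_fun_add[symmetric])
  then have "klein N x (- 1 / \<tau>) = c * klein N (snd x, - fst x) \<tau>"
    unfolding klein_def z z_def[symmetric] c(2) by (simp add: mult_ac)
  then show ?thesis by (simp only: power_mult_distrib power_12N_eq_1[OF c(1)] mult_1_left)
qed

section \<open>The action of SL2(Z) on torsion points\<close>

definition row_action :: "int \<Rightarrow> int \<Rightarrow> int \<Rightarrow> int \<Rightarrow> int \<times> int \<Rightarrow> int \<times> int" where
  "row_action a b c d x = (fst x * a + snd x * c, fst x * b + snd x * d)"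

lemma moebius_int_denominator_nonzero:
  assumes "a * d - b * c = 1" "Im \<tau> > 0"
  shows "of_int c * \<tau> + of_int d \<noteq> 0"
proof
  assume eq: "of_int c * \<tau> + of_int d = 0"
  from arg_cong[OF eq, of Im] have "c = 0" using assms(2) by simp
  with eq have "d = 0" by simp
  with \<open>c = 0\<close> assms(1) show False by simp
qed

lemma moebius_int_upper_half_plane:
  assumes det: "a * d - b * c = 1" and \<tau>: "Im \<tau> > 0"
  shows "Im (moebius_int a b c d \<tau>) > 0"
proof -
  define w where "w = of_int c * \<tau> + of_int d"
  have w: "w \<noteq> 0" using moebius_int_denominator_nonzero[OF assms] by (simp add: w_def)
  have "Im ((of_int a * \<tau> + of_int b) * cnj w) = of_int (a * d - b * c) * Im \<tau>"
    by (simp add: w_def algebra_simps)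
  then have "Im ((of_int a * \<tau> + of_int b) * cnj w) = Im \<tau>" unfolding det by simp
  then have "Im (moebius_int a b c d \<tau>) = Im \<tau> / (norm w)\<^sup>2"
    unfolding moebius_int_def w_def[symmetric] complex_div_cnj[of _ w] using Im_divide_of_real[of _ "(norm w)\<^sup>2"] by simp
  then show ?thesis using \<tau> w by simp
qed

lemma torsion_point_moebius:
  assumes "of_int c * \<tau> + of_int d \<noteq> 0"
  shows "torsion_point N x (moebius_int a b c d \<tau>) = torsion_point N (row_action a b c d x) \<tau> / (of_int c * \<tau> + of_int d)"
proof -
  define j where "j = of_int c * \<tau> + of_int d"
  have eq: "torsion_point N (row_action a b c d x) \<tau> = (of_int (fst x) * (of_int a * \<tau> + of_int b) + of_int (snd x) * j) / of_nat N"
    by (simp add: torsion_point_def row_action_def j_def algebra_simps)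
  have "v * (w / j) + y = (v * w + y * j) / j" for v w y
    using assms by (simp add: add_divide_distrib j_def)
  then show ?thesis
    unfolding j_def[symmetric] eq unfolding torsion_point_def moebius_int_def j_def[symmetric]
    by (simp add: mult.commute)
qed

text \<open>Euclid's algorithm on the lower row: passing to \<sigma> = -1/(\<tau> + k) replaces the
  row (c, d) by (d mod c, -c), so the lower left entry shrinks in absolute value. For
  \<open>c = 0\<close> the matrix is a translation up to sign.\<close>

lemma klein_power_modular:
  assumes "a * d - b * c = 1" "Im \<tau> > 0"
  shows "klein_power N x (moebius_int a b c d \<tau>) = klein_power N (row_action a b c d x) \<tau>"
  using assms
proof (induction "nat \<bar>c\<bar>" arbitrary: a b c d \<tau> x rule: less_induct)
  case less
  note det = less.prems(1) and \<tau> = less.prems(2)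
  show ?case
  proof (cases "c = 0")
    case True
    then have "a * d = 1" using det by simp
    then consider "a = 1" "d = 1" | "a = - 1" "d = - 1"
      using zmult_eq_1_iff by blast
    then show ?thesis
    proof cases
      case 1
      then show ?thesis using True klein_power_translate[OF \<tau>, of N x b]
        by (simp add: moebius_int_def row_action_def)
    next
      case 2
      then have "moebius_int a b c d \<tau> = \<tau> + of_int (- b)"
        using True by (simp add: moebius_int_def)
      moreover have "row_action a b c d x = - (fst x, fst x * (- b) + snd x)"
        using 2 True by (simp add: row_action_def)
      ultimately show ?thesis
        using klein_power_translate[OF \<tau>, of N x "- b"] klein_power_uminus[OF \<tau>, of N "(fst x, fst x * (- b) + snd x)"] by simp
    qed
  next
    case False
    define k where "k = d div c"
    define d' where "d' = d - k * c"
    define b' where "b' = b - k * a"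
    define \<sigma> where "\<sigma> = - 1 / (\<tau> + of_int k)"
    have \<tau>k: "Im (\<tau> + of_int k) > 0" using \<tau> by simp
    then have nz: "\<tau> + of_int k \<noteq> 0" by (metis less_irrefl zero_complex.simps(2))
    have \<sigma>: "Im \<sigma> > 0" using \<tau>k unfolding \<sigma>_def
      by (simp add: Im_divide power2_eq_square add_nonneg_pos)
    have "d' = d mod c" by (simp add: d'_def k_def minus_div_mult_eq_mod)
    then have "nat \<bar>d'\<bar> < nat \<bar>c\<bar>" using False abs_mod_less[of c d] by simp
    moreover have "b' * (- c) - (- a) * d' = 1" using det by (simp add: b'_def d'_def algebra_simps)
    ultimately have IH: "klein_power N x (moebius_int b' (- a) d' (- c) \<sigma>) = klein_power N (row_action b' (- a) d' (- c) x) \<sigma>"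
      using \<sigma> by (rule less.hyps)
    have "moebius_int b' (- a) d' (- c) \<sigma> = moebius_int a b c d \<tau>"
    proof -
      have "of_int b' * \<sigma> + of_int (- a) = (of_int a * \<tau> + of_int b) * \<sigma>"
        "of_int d' * \<sigma> + of_int (- c) = (of_int c * \<tau> + of_int d) * \<sigma>"
        using nz by (simp_all add: \<sigma>_def b'_def d'_def field_simps)
      moreover have "\<sigma> \<noteq> 0" using \<sigma> by auto
      ultimately show ?thesis unfolding moebius_int_def by simp
    qed
    moreover have "klein_power N (row_action b' (- a) d' (- c) x) \<sigma> = klein_power N (row_action a b c d x) \<tau>"
    proof -
      \<comment> \<open>Inversion acts on the vector as a quarter turn, so both ways of moving it
        agree only up to sign; evenness removes the sign.\<close>
      have eq: "row_action a b c d x = - (fst (snd (row_action b' (- a) d' (- c) x), - fst (row_action b' (- a) d' (- c) x)),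
          fst (snd (row_action b' (- a) d' (- c) x), - fst (row_action b' (- a) d' (- c) x)) * k
          + snd (snd (row_action b' (- a) d' (- c) x), - fst (row_action b' (- a) d' (- c) x)))"
        by (simp add: row_action_def b'_def d'_def algebra_simps)
      then show ?thesis
        unfolding \<sigma>_def klein_power_inversion[OF \<tau>k] klein_power_translate[OF \<tau>]
        by (simp only: eq klein_power_uminus[OF \<tau>])
    qed
    ultimately show ?thesis using IH by simp
  qed
qed

lemma row_action_level_zero_iff:
  assumes "a * d - b * c = 1"
  shows "level_zero N (row_action a b c d x) \<longleftrightarrow> level_zero N x"
proof
  assume *: "level_zero N (row_action a b c d x)"
  have "d * fst (row_action a b c d x) - c * snd (row_action a b c d x) = (a * d - b * c) * fst x"
    "a * snd (row_action a b c d x) - b * fst (row_action a b c d x) = (a * d - b * c) * snd x"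
    by (simp_all add: row_action_def algebra_simps)
  then have "fst x = d * fst (row_action a b c d x) - c * snd (row_action a b c d x)"
    "snd x = a * snd (row_action a b c d x) - b * fst (row_action a b c d x)"
    using assms by simp_all
  with * show "level_zero N x" by (metis dvd_diff dvd_mult)
qed (simp add: row_action_def)

lemma row_action_congruence:
  assumes "[a = 1] (mod int N)" "[b = 0] (mod int N)" "[c = 0] (mod int N)" "[d = 1] (mod int N)"
  shows "level_zero N (row_action a b c d x - x)"
proof -
  have "row_action a b c d x - x = (fst x * (a - 1) + snd x * c, fst x * b + snd x * (d - 1))"
    by (simp add: row_action_def algebra_simps prod_eq_iff)
  then show ?thesis using assms by (auto simp: cong_iff_dvd_diff)
qed

lemma row_action_linear:
  "row_action a b c d (x + y) = row_action a b c d x + row_action a b c d y"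
  "row_action a b c d (x - y) = row_action a b c d x - row_action a b c d y"
  by (simp_all add: row_action_def algebra_simps)

lemma unit_expansion_klein_power:
  assumes N: "N \<ge> 1" and x: "\<not> level_zero N x"
  shows "unit_expansion N (klein_power N x)"
proof -
  \<comment> \<open>Both are read off from 12N times the exponent of the prefactor; with x1 the
    first coordinate, \<open>?k\<close> is 6 N^2 B2(x1/N).\<close>
  let ?k = "6 * (fst x)\<^sup>2 + (int N)\<^sup>2 - 6 * int N * fst x" and ?j = "6 * fst x * snd x - 6 * int N * snd x"
  have "klein_power N x \<tau> = e_fun ((of_int ?k * \<tau> + of_int ?j) / of_nat N) * theta_prod \<tau> (torsion_point N x \<tau>) ^ (12 * N)" for \<tau>
  proof -
    let ?z = "torsion_point N x \<tau>"
    have "klein N x \<tau> = e_fun (of_int (fst x) * ?z / (2 * of_nat N) + (\<tau> / 12 - ?z / 2)) * theta_prod \<tau> ?z"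
      by (simp add: klein_def theta_theta_prod e_fun_add)
    moreover have "of_nat (12 * N) * (of_int (fst x) * ?z / (2 * of_nat N) + (\<tau> / 12 - ?z / 2)) = (of_int ?k * \<tau> + of_int ?j) / of_nat N"
    proof -
      have "of_nat (12 * N) * (of_int (fst x) * ?z / (2 * of_nat N) + (\<tau> / 12 - ?z / 2))
          = 6 * of_int (fst x) * ?z + of_nat N * \<tau> - 6 * of_nat N * ?z"
        using N by (simp add: distrib_left right_diff_distrib)
      also have "of_nat N * \<tau> = ((of_nat N)\<^sup>2 * \<tau>) / of_nat N" using N by (simp add: power2_eq_square)
      finally show ?thesis
        by (simp add: torsion_point_def add_divide_distrib diff_divide_distrib algebra_simps power2_eq_square)
    qed
    ultimately show ?thesis by (simp only: power_mult_distrib e_fun_power)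
  qed
  moreover have "unit_expansion N (\<lambda>\<tau>. e_fun ((of_int ?k * \<tau> + of_int ?j) / of_nat N) * theta_prod \<tau> (torsion_point N x \<tau>) ^ (12 * N))"
    by (intro unit_expansion_mult unit_expansion_e_fun unit_expansion_power unit_expansion_theta_prod N x)
  ultimately show ?thesis by simp
qed

text \<open>The constant by which the 12N-th powers of the Siegel and Klein functions differ. The
  exponent is 12N (1 - x1/N) x2/(2N) without its integral part 6 x2.\<close>

definition siegel_root :: "nat \<Rightarrow> int \<times> int \<Rightarrow> complex" where
  "siegel_root N x = e_fun (of_int (- 6 * fst x * snd x) / of_nat N)"

text \<open>The Bernoulli exponent is precisely the one for which all terms with
  \<open>\<tau>\<close> cancel against the prefactors of \<open>theta\<close> and
  \<open>klein\<close>; a constant exponent is left.\<close>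

lemma siegel_fun_power:
  assumes N: "N \<ge> 1" and \<tau>: "Im \<tau> > 0" and x: "x \<noteq> (0, 0)"
  shows "siegel_fun N x \<tau> ^ (12 * N) = siegel_root N x * klein_power N x \<tau>"
proof -
  let ?z = "torsion_point N x \<tau>" and ?t = "complex_of_real (of_int (fst x) / of_nat N)"
  let ?b = "of_real (B2 (of_int (fst x) / of_nat N) / 2) * \<tau>"
  have EP: "prodinf (\<lambda>n. 1 - e_fun (of_nat n * \<tau>) * e_fun ?z) = euler_prod (e_fun \<tau>) (e_fun ?z)"
    "prodinf (\<lambda>n. 1 - e_fun (of_nat (Suc n) * \<tau>) * e_fun (- ?z)) = euler_prod (e_fun \<tau>) (e_fun (\<tau> - ?z))"
  proof -
    have "e_fun (of_nat (Suc n) * \<tau>) * e_fun (- ?z) = e_fun (of_nat n * \<tau>) * e_fun (\<tau> - ?z)" for n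
      unfolding e_fun_add[symmetric] by (rule arg_cong[where f = e_fun]) (simp add: algebra_simps)
    then show "prodinf (\<lambda>n. 1 - e_fun (of_nat (Suc n) * \<tau>) * e_fun (- ?z)) = euler_prod (e_fun \<tau>) (e_fun (\<tau> - ?z))"
      by (simp only: euler_prod_def e_fun_power)
  qed (simp only: euler_prod_def e_fun_power)
  have "siegel_fun N x \<tau> = e_fun ?b * theta_prod \<tau> ?z"
    unfolding siegel_fun_def EP theta_prod_def using x \<tau> by (simp add: mult.assoc)
  also have "\<dots> = e_fun (?b + (?z / 2 - \<tau> / 12)) * theta \<tau> ?z"
    by (simp only: theta_prod_theta e_fun_add mult.assoc)
  also have "\<dots> = e_fun (?b + (?z / 2 - \<tau> / 12) - of_int (fst x) * ?z / (2 * of_nat N)) * klein N x \<tau>"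
    by (simp add: klein_def e_fun_diff)
  also have "?b + (?z / 2 - \<tau> / 12) - of_int (fst x) * ?z / (2 * of_nat N)
      = (1 - ?t) * (of_int (snd x) / of_nat N) / 2"
  proof -
    have "?z = ?t * \<tau> + of_int (snd x) / of_nat N" by (simp add: torsion_point_def add_divide_distrib)
    moreover have "of_int (fst x) * ?z / (2 * of_nat N) = ?t * ?z / 2" by simp
    moreover have "?b = (?t\<^sup>2 - ?t + 1 / 6) / 2 * \<tau>" by (simp add: B2_def)
    ultimately show ?thesis
      by (simp add: power2_eq_square add_divide_distrib diff_divide_distrib distrib_left distrib_right left_diff_distrib right_diff_distrib mult_ac)
  qed
  finally have "siegel_fun N x \<tau> ^ (12 * N) = e_fun ((1 - ?t) * (of_int (snd x) / of_nat N) / 2) ^ (12 * N) * klein_power N x \<tau>"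
    by (simp only: power_mult_distrib)
  also have "e_fun ((1 - ?t) * (of_int (snd x) / of_nat N) / 2) ^ (12 * N) = e_fun (of_int (6 * snd x)) * siegel_root N x"
    unfolding e_fun_power siegel_root_def e_fun_add[symmetric] using N
    by (intro arg_cong[where f = e_fun]) (simp add: left_diff_distrib right_diff_distrib diff_divide_distrib)
  finally show ?thesis by (simp only: e_fun_of_int mult_1_left)
qed

text \<open>Each translate is a fixed root of unity in the cyclotomic field times the Klein power at
  the moved point, whose class is again nonzero. At \<open>(0, 0)\<close> the function is 1 by
  convention.\<close>

lemma siegel_power_modular_unit:
  assumes N: "N \<ge> 1" and x: "level_zero N x \<longrightarrow> x = (0, 0)"
  shows "is_modular_unit N (\<lambda>\<tau>. siegel_fun N x \<tau> ^ (12 * N))"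
proof (cases "x = (0, 0)")
  case True
  then have "(\<lambda>\<tau>. siegel_fun N x \<tau> ^ (12 * N)) = (\<lambda>_. 1)" by (simp add: siegel_fun_def)
  then show ?thesis
    using N by (auto intro!: is_modular_unitI unit_expansion_const cyclotomic_field_1)
next
  case False
  then have x: "\<not> level_zero N x" using x by simp
  note eq = siegel_fun_power[OF N _ False]
  show ?thesis
  proof (rule is_modular_unitI[OF N])
    show "siegel_fun N x \<tau> ^ (12 * N) = 1" if "\<not> 0 < Im \<tau>" for \<tau>
      using that by (simp add: siegel_fun_def)
  next
    fix a b c d \<tau>
    assume *: "a * d - b * c = 1" "[a = 1] (mod int N)" "[b = 0] (mod int N)" "[c = 0] (mod int N)" "[d = 1] (mod int N)" "Im \<tau> > 0"
    then show "siegel_fun N x (moebius_int a b c d \<tau>) ^ (12 * N) = siegel_fun N x \<tau> ^ (12 * N)"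
      using klein_power_cong[OF N *(6) row_action_congruence[OF *(2-5), of x]]
      by (simp only: eq moebius_int_upper_half_plane klein_power_modular)
  next
    fix a b c d :: int assume *: "a * d - b * c = 1"
    have "unit_expansion N (\<lambda>\<tau>. siegel_root N x * klein_power N (row_action a b c d x) \<tau>)"
      using row_action_level_zero_iff[OF *] x unfolding siegel_root_def
      by (intro unit_expansion_mult unit_expansion_const cyclotomic_field_e_fun unit_expansion_klein_power N) auto
    then show "unit_expansion N (\<lambda>\<tau>. siegel_fun N x (moebius_int a b c d \<tau>) ^ (12 * N))"
      by (rule unit_expansion_cong)
         (simp only: eq moebius_int_upper_half_plane[OF *] klein_power_modular[OF *])
  qed
qed

section \<open>Cross-ratios of Weierstrass values at torsion points\<close>

definition wp_torsion :: "nat \<Rightarrow> int \<times> int \<Rightarrow> complex \<Rightarrow> complex" where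
  "wp_torsion N x \<tau> = weierstrass_p \<tau> (torsion_point N x \<tau>)"

lemma wp_torsion_cong:
  assumes N: "N \<ge> 1" and \<tau>: "Im \<tau> > 0" and "level_zero N (x - y)"
  shows "wp_torsion N x \<tau> = wp_torsion N y \<tau>"
proof -
  have "torsion_point N x \<tau> = torsion_point N y \<tau> + torsion_point N (x - y) \<tau>"
    by (simp add: torsion_point_diff)
  moreover have "torsion_point N (x - y) \<tau> \<in> period_lattice \<tau>"
    using assms by (simp add: torsion_point_in_lattice_iff)
  ultimately show ?thesis
    unfolding wp_torsion_def
    using periodic_lattice[of "weierstrass_p \<tau>" \<tau>, OF weierstrass_p_plus_1[OF \<tau>] weierstrass_p_plus_tau[OF \<tau>]] by simp
qed

lemma wp_torsion_modular:
  assumes "a * d - b * c = 1" "Im \<tau> > 0"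
  shows "wp_torsion N x (moebius_int a b c d \<tau>) = (of_int c * \<tau> + of_int d)\<^sup>2 * wp_torsion N (row_action a b c d x) \<tau>"
  unfolding wp_torsion_def torsion_point_moebius[OF moebius_int_denominator_nonzero[OF assms]]
  by (rule weierstrass_p_modular[OF assms(1) moebius_int_denominator_nonzero[OF assms]])

text \<open>The cross-ratio \<open>u(0, q, r, s)\<close>.\<close>

definition wp_ratio :: "nat \<Rightarrow> int \<times> int \<Rightarrow> int \<times> int \<Rightarrow> int \<times> int \<Rightarrow> complex \<Rightarrow> complex" where
  "wp_ratio N q r s \<tau> = (wp_torsion N s \<tau> - wp_torsion N q \<tau>) / (wp_torsion N r \<tau> - wp_torsion N q \<tau>)"

lemma u_fun_wp_ratio:
  assumes "q \<noteq> (0, 0)" "r \<noteq> (0, 0)" "s \<noteq> (0, 0)"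
  shows "u_fun N (0, 0) q r s \<tau> = (if Im \<tau> > 0 then wp_ratio N q r s \<tau> else 1)"
  using assms by (simp add: u_fun_def wp_def cross_ratio_def wp_ratio_def wp_torsion_def)

text \<open>These are the points whose theta values occur when both differences in
  \<open>wp_ratio\<close> are factored. The sums and differences express that q differs from r and s
  up to sign.\<close>

definition distinct_torsion :: "nat \<Rightarrow> int \<times> int \<Rightarrow> int \<times> int \<Rightarrow> int \<times> int \<Rightarrow> bool" where
  "distinct_torsion N q r s \<longleftrightarrow> (\<forall>x \<in> {q, r, s, r + q, r - q, s + q, s - q}. \<not> level_zero N x)"

text \<open>The derivative of theta at 0 and the theta value at q occur in both differences and
  cancel in the quotient.\<close>

lemma wp_ratio_theta:
  assumes N: "N \<ge> 1" and \<tau>: "Im \<tau> > 0" and dist: "distinct_torsion N q r s"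
  defines "\<theta> \<equiv> \<lambda>x. theta \<tau> (torsion_point N x \<tau>)"
  shows "wp_ratio N q r s \<tau> = (\<theta> (s + q) * \<theta> (s - q) * (\<theta> r)\<^sup>2) / (\<theta> (r + q) * \<theta> (r - q) * (\<theta> s)\<^sup>2)"
proof -
  have nz: "\<theta> x \<noteq> 0" if "\<not> level_zero N x" for x
    using that unfolding \<theta>_def theta_eq_0_iff[OF \<tau>] by (simp add: torsion_point_in_lattice_iff[OF N \<tau>])
  define D where "D = deriv (theta \<tau>) 0"
  have D: "D \<noteq> 0" using deriv_theta_0_nonzero[OF \<tau>] by (simp add: D_def)
  have diff: "wp_torsion N x \<tau> - wp_torsion N y \<tau> = - D\<^sup>2 * (\<theta> (x + y) * \<theta> (x - y)) / ((\<theta> x)\<^sup>2 * (\<theta> y)\<^sup>2)"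
    if "\<not> level_zero N x" "\<not> level_zero N y" for x y
    using that weierstrass_p_diff_theta[OF \<tau>, of "torsion_point N x \<tau>" "torsion_point N y \<tau>"]
    unfolding torsion_point_in_lattice_iff[OF N \<tau>] wp_torsion_def \<theta>_def D_def torsion_point_add torsion_point_diff by blast
  have q: "\<theta> q \<noteq> 0" and level: "\<not> level_zero N q" "\<not> level_zero N r" "\<not> level_zero N s"
    using dist unfolding distinct_torsion_def by (auto intro!: nz)
  have cancel: "(- D\<^sup>2 * (a * b) / (s' * q')) / (- D\<^sup>2 * (e * f) / (r' * q')) = (a * b * r') / (e * f * s')"
    if "q' \<noteq> 0" for a b s' q' e f r' :: complex
    using that D by (simp add: mult_ac)
  show ?thesis
    unfolding wp_ratio_def diff[OF level(3,1)] diff[OF level(2,1)] by (rule cancel) (simp add: q)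
qed

text \<open>The prefactors of theta have exponents affine in the point, hence
  \<open>E (x + y) * E (x - y) = (E x)\<^sup>2\<close>, and they cancel completely. The cross-ratio
  is thus a quotient of the products treated before.\<close>

lemma unit_expansion_wp_ratio:
  assumes N: "N \<ge> 1" and dist: "distinct_torsion N q r s"
  shows "unit_expansion N (wp_ratio N q r s)"
proof -
  define P where "P x \<tau> = theta_prod \<tau> (torsion_point N x \<tau>)" for x \<tau>
  have P: "unit_expansion N (P x)" if "x \<in> {q, r, s, r + q, r - q, s + q, s - q}" for x
    unfolding P_def using dist that by (intro unit_expansion_theta_prod N) (auto simp: distinct_torsion_def)
  have "unit_expansion N (\<lambda>\<tau>. (P (s + q) \<tau> * P (s - q) \<tau> * (P r \<tau>)\<^sup>2) / (P (r + q) \<tau> * P (r - q) \<tau> * (P s \<tau>)\<^sup>2))"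
    by (intro unit_expansion_divide unit_expansion_mult unit_expansion_power P) auto
  then show ?thesis
  proof (rule unit_expansion_cong)
    fix \<tau> :: complex assume \<tau>: "Im \<tau> > 0"
    define E where "E x = e_fun (\<tau> / 12 - torsion_point N x \<tau> / 2)" for x
    have E: "E (x + y) * E (x - y) = (E x)\<^sup>2" for x y
      unfolding E_def e_fun_power e_fun_add[symmetric] torsion_point_add torsion_point_diff
      by (rule arg_cong[where f = e_fun]) (simp add: add_divide_distrib diff_divide_distrib right_diff_distrib)
    have \<theta>: "theta \<tau> (torsion_point N x \<tau>) = E x * P x \<tau>" for x
      by (simp add: theta_theta_prod E_def P_def)
    have nz: "E x \<noteq> 0" for x by (simp add: E_def)
    have "wp_ratio N q r s \<tau> = ((E (s + q) * E (s - q)) * (P (s + q) \<tau> * P (s - q) \<tau>) * ((E r)\<^sup>2 * (P r \<tau>)\<^sup>2))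
        / ((E (r + q) * E (r - q)) * (P (r + q) \<tau> * P (r - q) \<tau>) * ((E s)\<^sup>2 * (P s \<tau>)\<^sup>2))"
      unfolding wp_ratio_theta[OF N \<tau> dist] \<theta> power_mult_distrib by (simp only: mult_ac)
    also have "\<dots> = (P (s + q) \<tau> * P (s - q) \<tau> * (P r \<tau>)\<^sup>2) / (P (r + q) \<tau> * P (r - q) \<tau> * (P s \<tau>)\<^sup>2)"
    proof -
      have "(u * v * (u' * v')) / (u' * w * (u * w')) = (v * v') / (w * w')"
        if "u \<noteq> 0" "u' \<noteq> 0" for u v w u' v' w' :: complex
        using that by (simp add: mult_ac)
      from this[OF power_not_zero[OF nz] power_not_zero[OF nz]] show ?thesis unfolding E .
    qed
    finally show "(P (s + q) \<tau> * P (s - q) \<tau> * (P r \<tau>)\<^sup>2) / (P (r + q) \<tau> * P (r - q) \<tau> * (P s \<tau>)\<^sup>2) = wp_ratio N q r s \<tau>"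
      by simp
  qed
qed

text \<open>Numerator and denominator have the same weight 2, so a translate of the ratio is the
  ratio at the moved points, and distinctness is preserved by the action.\<close>

lemma wp_ratio_modular_unit:
  assumes N: "N \<ge> 1" and dist: "distinct_torsion N q r s"
  shows "is_modular_unit N (\<lambda>\<tau>. if Im \<tau> > 0 then wp_ratio N q r s \<tau> else 1)"
proof (rule is_modular_unitI[OF N])
  have modular: "wp_ratio N q r s (moebius_int a b c d \<tau>)
      = wp_ratio N (row_action a b c d q) (row_action a b c d r) (row_action a b c d s) \<tau>"
    if "a * d - b * c = 1" "Im \<tau> > 0" for a b c d \<tau>
    using moebius_int_denominator_nonzero[OF that]
    by (simp add: wp_ratio_def wp_torsion_modular[OF that] right_diff_distrib[symmetric])
  show "(if 0 < Im (moebius_int a b c d \<tau>) then wp_ratio N q r s (moebius_int a b c d \<tau>) else 1)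
      = (if 0 < Im \<tau> then wp_ratio N q r s \<tau> else 1)"
    if *: "a * d - b * c = 1" "[a = 1] (mod int N)" "[b = 0] (mod int N)" "[c = 0] (mod int N)" "[d = 1] (mod int N)" "Im \<tau> > 0"
    for a b c d \<tau>
  proof -
    have "wp_torsion N (row_action a b c d x) \<tau> = wp_torsion N x \<tau>" for x
      by (rule wp_torsion_cong[OF N *(6) row_action_congruence[OF *(2-5)]])
    then show ?thesis
      using *(6) moebius_int_upper_half_plane[OF *(1,6)] modular[OF *(1,6)] by (simp add: wp_ratio_def)
  qed
  fix a b c d :: int assume *: "a * d - b * c = 1"
  have "distinct_torsion N (row_action a b c d q) (row_action a b c d r) (row_action a b c d s)"
    using dist unfolding distinct_torsion_def
    by (simp only: ball_simps row_action_linear[symmetric] row_action_level_zero_iff[OF *] simp_thms)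
  from unit_expansion_wp_ratio[OF N this]
  show "unit_expansion N (\<lambda>\<tau>. if 0 < Im (moebius_int a b c d \<tau>) then wp_ratio N q r s (moebius_int a b c d \<tau>) else 1)"
    by (rule unit_expansion_cong) (simp add: modular[OF *] moebius_int_upper_half_plane[OF *])
qed auto

lemma siegel_root_cong:
  assumes N: "N \<ge> 1" and "level_zero N (x - y)"
  shows "siegel_root N x = siegel_root N y"
proof -
  have "int N dvd fst x - fst y" "int N dvd snd x - snd y" using assms by auto
  moreover have "fst x * snd x - fst y * snd y = (fst x - fst y) * snd x + fst y * (snd x - snd y)"
    by (simp add: algebra_simps)
  ultimately have "int N dvd fst x * snd x - fst y * snd y" by simp
  then obtain m where m: "fst x * snd x = fst y * snd y + int N * m" by (metis dvdE diff_eq_eq add.commute)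
  have "of_int (- 6 * fst x * snd x) / (of_nat N :: complex) = of_int (- 6 * (fst x * snd x)) / of_nat N"
    by simp
  also have "\<dots> = of_int (- 6 * fst y * snd y) / of_nat N + of_int (- 6 * m)"
    unfolding m using N by (simp add: distrib_left add_divide_distrib diff_divide_distrib mult.assoc)
  finally show ?thesis unfolding siegel_root_def e_fun_add by (simp only: e_fun_of_int e_fun_add mult_1_right)
qed

lemma siegel_power_cong_uminus:
  assumes N: "N \<ge> 1" and x: "x \<noteq> (0, 0)" "y \<noteq> (0, 0)" "level_zero N (x + y)"
  shows "siegel_fun N x \<tau> ^ (12 * N) = siegel_fun N y \<tau> ^ (12 * N)"
proof (cases "Im \<tau> > 0")
  case True
  have "level_zero N (x - (- y))" using x by simp
  then have "siegel_root N x = siegel_root N (- y)" "klein_power N x \<tau> = klein_power N (- y) \<tau>"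
    using N True by (auto intro: siegel_root_cong klein_power_cong)
  moreover have "siegel_root N (- y) = siegel_root N y" by (simp add: siegel_root_def)
  ultimately show ?thesis
    by (simp only: siegel_fun_power[OF N True x(1)] siegel_fun_power[OF N True x(2)] klein_power_uminus[OF True])
qed (simp add: siegel_fun_def)

lemma siegel_power_cong:
  assumes N: "N \<ge> 1" and \<tau>: "Im \<tau> > 0" and x: "x \<noteq> (0, 0)" "level_zero N (x - y)"
  shows "siegel_fun N x \<tau> ^ (12 * N) = siegel_root N y * klein_power N y \<tau>"
  using siegel_fun_power[OF N \<tau> x(1)] siegel_root_cong[OF N x(2)] klein_power_cong[OF N \<tau> x(2)] by simp

text \<open>The exponential in \<open>klein\<close> and the root of unity are both quadratic in the
  point, hence satisfy the parallelogram law. So the relation between theta values passes to Klein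
  functions and then to Siegel powers, the contributions of q cancelling. The map \<open>g\<close>
  chooses representatives modulo N.\<close>

lemma wp_ratio_siegel:
  assumes N: "N \<ge> 1" and \<tau>: "Im \<tau> > 0" and dist: "distinct_torsion N q r s"
    and g: "\<And>x. \<not> level_zero N x \<Longrightarrow> g x \<noteq> (0, 0) \<and> level_zero N (g x - x)"
  defines "S \<equiv> \<lambda>x. siegel_fun N (g x) \<tau> ^ (12 * N)"
  shows "wp_ratio N q r s \<tau> ^ (12 * N) * (S (r + q) * S (r - q) * (S s * S s)) = S (s + q) * S (s - q) * (S r * S r)"
proof -
  define \<theta> where "\<theta> x = theta \<tau> (torsion_point N x \<tau>)" for x
  define e where "e x = e_fun (of_int (fst x) * torsion_point N x \<tau> / (2 * of_nat N))" for x
  define \<epsilon> where "\<epsilon> = siegel_root N"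
  define K where "K x = klein_power N x \<tau>" for x
  have S: "S x = \<epsilon> x * K x" if "x \<in> {q, r, s, r + q, r - q, s + q, s - q}" for x
    using siegel_power_cong[OF N \<tau>, of "g x" x] g[of x] that dist
    unfolding S_def \<epsilon>_def K_def distinct_torsion_def by blast
  have klein: "klein N x \<tau> = e x * \<theta> x" for x by (simp add: klein_def e_def \<theta>_def)
  have e: "e (x + y) * e (x - y) = (e x)\<^sup>2 * (e y)\<^sup>2" for x y
    unfolding e_def e_fun_power e_fun_add[symmetric] torsion_point_add torsion_point_diff
    by (rule arg_cong[where f = e_fun]) (simp add: distrib_left right_diff_distrib add_divide_distrib diff_divide_distrib left_diff_distrib distrib_right)
  have \<epsilon>: "\<epsilon> (x + y) * \<epsilon> (x - y) = (\<epsilon> x)\<^sup>2 * (\<epsilon> y)\<^sup>2" for x y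
    unfolding \<epsilon>_def siegel_root_def e_fun_power e_fun_add[symmetric]
    by (rule arg_cong[where f = e_fun]) (simp add: distrib_left right_diff_distrib add_divide_distrib diff_divide_distrib left_diff_distrib distrib_right)
  have \<theta>nz: "\<theta> x \<noteq> 0" if "x \<in> {r + q, r - q, s}" for x
    using that dist unfolding \<theta>_def theta_eq_0_iff[OF \<tau>] torsion_point_in_lattice_iff[OF N \<tau>]
    by (auto simp: distinct_torsion_def)
  have "wp_ratio N q r s \<tau> * ((e (r + q) * e (r - q)) * (e s)\<^sup>2 * (\<theta> (r + q) * \<theta> (r - q) * (\<theta> s)\<^sup>2))
      = ((e (s + q) * e (s - q)) * (e r)\<^sup>2) * (\<theta> (s + q) * \<theta> (s - q) * (\<theta> r)\<^sup>2)"
  proof -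
    have "wp_ratio N q r s \<tau> * (\<theta> (r + q) * \<theta> (r - q) * (\<theta> s)\<^sup>2) = \<theta> (s + q) * \<theta> (s - q) * (\<theta> r)\<^sup>2"
      unfolding wp_ratio_theta[OF N \<tau> dist] \<theta>_def[symmetric] using \<theta>nz by simp
    then show ?thesis unfolding e by (simp add: mult_ac)
  qed
  then have "wp_ratio N q r s \<tau> * (klein N (r + q) \<tau> * klein N (r - q) \<tau> * (klein N s \<tau> * klein N s \<tau>))
      = klein N (s + q) \<tau> * klein N (s - q) \<tau> * (klein N r \<tau> * klein N r \<tau>)"
    unfolding klein by (simp only: power2_eq_square mult_ac)
  from arg_cong[OF this, of "\<lambda>z. z ^ (12 * N)"]
  have "wp_ratio N q r s \<tau> ^ (12 * N) * (K (r + q) * K (r - q) * (K s * K s)) = K (s + q) * K (s - q) * (K r * K r)"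
    unfolding K_def by (simp only: power_mult_distrib)
  moreover have "\<epsilon> (r + q) * \<epsilon> (r - q) * (\<epsilon> s * \<epsilon> s) = \<epsilon> (s + q) * \<epsilon> (s - q) * (\<epsilon> r * \<epsilon> r)"
    unfolding \<epsilon> by (simp only: power2_eq_square mult_ac)
  ultimately have "(\<epsilon> (r + q) * \<epsilon> (r - q) * (\<epsilon> s * \<epsilon> s)) * (wp_ratio N q r s \<tau> ^ (12 * N) * (K (r + q) * K (r - q) * (K s * K s)))
      = (\<epsilon> (s + q) * \<epsilon> (s - q) * (\<epsilon> r * \<epsilon> r)) * (K (s + q) * K (s - q) * (K r * K r))"
    by simp
  then show ?thesis
    by (simp only: S insertI1 insertI2 mult_ac)
qed

section \<open>Quotients of free modules\<close>

lemma free_module_simps [simp]: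
  "\<zero>\<^bsub>free_module R S\<^esub> = (\<lambda>_. \<zero>\<^bsub>R\<^esub>)"
  "c \<oplus>\<^bsub>free_module R S\<^esub> d = (\<lambda>k. c k \<oplus>\<^bsub>R\<^esub> d k)"
  "r \<odot>\<^bsub>free_module R S\<^esub> c = (\<lambda>k. r \<otimes>\<^bsub>R\<^esub> c k)"
  by (simp_all add: free_module_def)

lemma free_module_carrier:
  "c \<in> carrier (free_module R S) \<longleftrightarrow>
     (\<forall>k. c k \<in> carrier R) \<and> finite {k. c k \<noteq> \<zero>\<^bsub>R\<^esub>} \<and> {k. c k \<noteq> \<zero>\<^bsub>R\<^esub>} \<subseteq> S"
  by (auto simp: free_module_def)

lemma (in cring) module_free_module: "module R (free_module R S)"
proof -
  let ?F = "free_module R S"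
  have add: "(\<lambda>k. c k \<oplus> d k) \<in> carrier ?F" if "c \<in> carrier ?F" "d \<in> carrier ?F" for c d
  proof -
    have "{k. c k \<oplus> d k \<noteq> \<zero>} \<subseteq> {k. c k \<noteq> \<zero>} \<union> {k. d k \<noteq> \<zero>}" by auto
    moreover have "finite ({k. c k \<noteq> \<zero>} \<union> {k. d k \<noteq> \<zero>})" "{k. c k \<noteq> \<zero>} \<union> {k. d k \<noteq> \<zero>} \<subseteq> S"
      using that by (auto simp: free_module_carrier)
    ultimately show ?thesis using that unfolding free_module_carrier by (meson a_closed finite_subset subset_trans)
  qed
  have smult: "(\<lambda>k. r \<otimes> c k) \<in> carrier ?F" if "r \<in> carrier R" "c \<in> carrier ?F" for r c
  proof -
    have "{k. r \<otimes> c k \<noteq> \<zero>} \<subseteq> {k. c k \<noteq> \<zero>}" using that by auto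
    then show ?thesis using that unfolding free_module_carrier by (meson m_closed finite_subset subset_trans)
  qed
  have cl: "c k \<in> carrier R" if "c \<in> carrier ?F" for c k
    using that by (simp add: free_module_carrier)
  have "abelian_group ?F"
  proof (rule abelian_groupI)
    show "\<exists>d\<in>carrier ?F. d \<oplus>\<^bsub>?F\<^esub> c = \<zero>\<^bsub>?F\<^esub>" if "c \<in> carrier ?F" for c
    proof
      show "(\<lambda>k. \<ominus> \<one> \<otimes> c k) \<in> carrier ?F" using that by (intro smult) auto
      show "(\<lambda>k. \<ominus> \<one> \<otimes> c k) \<oplus>\<^bsub>?F\<^esub> c = \<zero>\<^bsub>?F\<^esub>" using cl[OF that] by (simp add: l_minus l_neg)
    qed
    show "\<zero>\<^bsub>?F\<^esub> \<in> carrier ?F" by (simp add: free_module_carrier)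
  qed (use add cl in \<open>auto simp: a_ac\<close>)
  then show ?thesis
    using is_cring smult cl by (intro moduleI) (auto simp: l_distr r_distr m_assoc)
qed

lemma (in cring) basis_elt_carrier:
  assumes "k \<in> S" shows "basis_elt R k \<in> carrier (free_module R S)"
proof -
  have "{j. basis_elt R k j \<noteq> \<zero>} \<subseteq> {k}" by (auto simp: basis_elt_def)
  then show ?thesis using assms unfolding free_module_carrier
    by (auto simp: basis_elt_def intro: finite_subset)
qed

context module
begin

lemma submodule_carrier: "submodule (carrier M) R M"
  by (rule submoduleI) auto

lemma submodule_span:
  assumes "B \<subseteq> carrier M"
  shows "submodule (submodule_span R M B) R M" and "B \<subseteq> submodule_span R M B"
proof -
  note E = submoduleE
  show "submodule (submodule_span R M B) R M"
  proof (rule submoduleI)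
    show "submodule_span R M B \<subseteq> carrier M"
      using submodule_carrier assms by (auto simp: submodule_span_def)
    show "\<zero>\<^bsub>M\<^esub> \<in> submodule_span R M B"
      using subgroup.one_closed[OF submodule.axioms(1)] by (fastforce simp: submodule_span_def)
  qed (auto simp: submodule_span_def dest: E)
  show "B \<subseteq> submodule_span R M B" by (auto simp: submodule_span_def)
qed

context
  fixes H
  assumes H: "submodule H R M"
begin

lemma submodule_abelian_subgroup: "abelian_subgroup H M"
  by (intro abelian_subgroupI3 additive_subgroup.intro submodule.axioms(1)[OF H] abelian_group_axioms)

interpretation abelian_subgroup H M by (rule submodule_abelian_subgroup)

text \<open>Scalars act on a coset through a union over its members; since \<open>H\<close> is
  stable under scalars, all cosets in that union coincide.\<close>

lemma quotient_module_simps: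
  shows quotient_zero: "\<zero>\<^bsub>quotient_module M H\<^esub> = H +>\<^bsub>M\<^esub> \<zero>\<^bsub>M\<^esub>"
    and quotient_add: "x \<in> carrier M \<Longrightarrow> y \<in> carrier M \<Longrightarrow>
      (H +>\<^bsub>M\<^esub> x) \<oplus>\<^bsub>quotient_module M H\<^esub> (H +>\<^bsub>M\<^esub> y) = H +>\<^bsub>M\<^esub> (x \<oplus>\<^bsub>M\<^esub> y)"
    and quotient_smult: "r \<in> carrier R \<Longrightarrow> x \<in> carrier M \<Longrightarrow>
      r \<odot>\<^bsub>quotient_module M H\<^esub> (H +>\<^bsub>M\<^esub> x) = H +>\<^bsub>M\<^esub> (r \<odot>\<^bsub>M\<^esub> x)"
    and quotient_carrier: "carrier (quotient_module M H) = (\<lambda>x. H +>\<^bsub>M\<^esub> x) ` carrier M"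
proof -
  have sub: "H \<subseteq> carrier M" by (rule a_subset)
  show "\<zero>\<^bsub>quotient_module M H\<^esub> = H +>\<^bsub>M\<^esub> \<zero>\<^bsub>M\<^esub>"
    using sub by (simp add: quotient_module_def)
  show "(H +>\<^bsub>M\<^esub> x) \<oplus>\<^bsub>quotient_module M H\<^esub> (H +>\<^bsub>M\<^esub> y) = H +>\<^bsub>M\<^esub> (x \<oplus>\<^bsub>M\<^esub> y)" if "x \<in> carrier M" "y \<in> carrier M"
    using that by (simp add: quotient_module_def a_rcos_sum)
  show "carrier (quotient_module M H) = (\<lambda>x. H +>\<^bsub>M\<^esub> x) ` carrier M"
    by (auto simp: quotient_module_def A_RCOSETS_def')
  show "r \<odot>\<^bsub>quotient_module M H\<^esub> (H +>\<^bsub>M\<^esub> x) = H +>\<^bsub>M\<^esub> (r \<odot>\<^bsub>M\<^esub> x)" if r: "r \<in> carrier R" and x: "x \<in> carrier M"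
  proof -
    have "H +>\<^bsub>M\<^esub> (r \<odot>\<^bsub>M\<^esub> y) = H +>\<^bsub>M\<^esub> (r \<odot>\<^bsub>M\<^esub> x)" if "y \<in> H +>\<^bsub>M\<^esub> x" for y
    proof -
      obtain h where h: "h \<in> H" "y = h \<oplus>\<^bsub>M\<^esub> x" using \<open>y \<in> H +>\<^bsub>M\<^esub> x\<close> by (auto simp: a_r_coset_def')
      then have "r \<odot>\<^bsub>M\<^esub> y = r \<odot>\<^bsub>M\<^esub> h \<oplus>\<^bsub>M\<^esub> r \<odot>\<^bsub>M\<^esub> x" "r \<odot>\<^bsub>M\<^esub> h \<in> H"
        using r x sub submodule.smult_closed[OF H r h(1)] by (auto simp: smult_r_distr)
      then have "r \<odot>\<^bsub>M\<^esub> y \<in> H +>\<^bsub>M\<^esub> (r \<odot>\<^bsub>M\<^esub> x)" by (auto simp: a_r_coset_def')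
      then show ?thesis
        using r x a_repr_independence[of _ H "r \<odot>\<^bsub>M\<^esub> x"] a_subgroup by auto
    qed
    moreover have "x \<in> H +>\<^bsub>M\<^esub> x" using x by (rule a_rcos_self)
    ultimately have "(\<Union>y\<in>H +>\<^bsub>M\<^esub> x. H +>\<^bsub>M\<^esub> (r \<odot>\<^bsub>M\<^esub> y)) = H +>\<^bsub>M\<^esub> (r \<odot>\<^bsub>M\<^esub> x)"
      by blast
    then show ?thesis by (simp add: quotient_module_def)
  qed
qed

lemma quotient_eq:
  assumes "x \<in> carrier M" "y \<in> carrier M" "x \<ominus>\<^bsub>M\<^esub> y \<in> H"
  shows "H +>\<^bsub>M\<^esub> x = H +>\<^bsub>M\<^esub> y"
proof -
  have "x = (x \<ominus>\<^bsub>M\<^esub> y) \<oplus>\<^bsub>M\<^esub> y" using assms(1,2) by (simp add: a_minus_def a_assoc l_neg)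
  then have "x \<in> H +>\<^bsub>M\<^esub> y" using assms(3) by (auto simp: a_r_coset_def')
  then show ?thesis using a_repr_independence[of x H y] assms a_subgroup by auto
qed

text \<open>Turns a generator of the relation submodule, which is a difference in the free module,
  into an equation in the quotient. The additivity laws for pure tensors and wedges are obtained
  this way.\<close>

lemma quotient_relation_add:
  assumes "x \<in> carrier M" "y \<in> carrier M" "z \<in> carrier M" "z \<ominus>\<^bsub>M\<^esub> (x \<oplus>\<^bsub>M\<^esub> y) \<in> H"
  shows "H +>\<^bsub>M\<^esub> z = (H +>\<^bsub>M\<^esub> x) \<oplus>\<^bsub>quotient_module M H\<^esub> (H +>\<^bsub>M\<^esub> y)"
  unfolding quotient_add[OF assms(1,2)] using assms by (intro quotient_eq) auto

lemma quotient_relation_smult: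
  assumes "r \<in> carrier R" "x \<in> carrier M" "z \<in> carrier M" "z \<ominus>\<^bsub>M\<^esub> (r \<odot>\<^bsub>M\<^esub> x) \<in> H"
  shows "H +>\<^bsub>M\<^esub> z = r \<odot>\<^bsub>quotient_module M H\<^esub> (H +>\<^bsub>M\<^esub> x)"
  unfolding quotient_smult[OF assms(1,2)] using assms by (intro quotient_eq) auto

lemma module_quotient_module: "module R (quotient_module M H)"
proof -
  note [simp] = quotient_module_simps
  have "abelian_group (quotient_module M H)"
  proof (rule abelian_groupI)
    show "\<exists>D\<in>carrier (quotient_module M H). D \<oplus>\<^bsub>quotient_module M H\<^esub> C = \<zero>\<^bsub>quotient_module M H\<^esub>"
      if "C \<in> carrier (quotient_module M H)" for C
    proof -
      obtain x where x: "x \<in> carrier M" "C = H +>\<^bsub>M\<^esub> x" using \<open>C \<in> _\<close> by auto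
      then have "(H +>\<^bsub>M\<^esub> \<ominus>\<^bsub>M\<^esub> x) \<oplus>\<^bsub>quotient_module M H\<^esub> C = \<zero>\<^bsub>quotient_module M H\<^esub>" by (simp add: l_neg)
      then show ?thesis using x by auto
    qed
  qed (auto simp: M.a_ac)
  then show ?thesis
    by (intro moduleI is_cring) (auto simp: smult_l_distr smult_r_distr smult_assoc1)
qed

end

end

section \<open>Tensor products and exterior squares\<close>

text \<open>Closure under multiplication is what keeps the tensor relations inside the free module,
  so it stands in for the group axioms.\<close>

locale tensor_scalars_module = R: cring R for A :: "('a, 'm) monoid_scheme" and R :: "('s, 'n) ring_scheme" +
  assumes A_closed: "\<And>a b. a \<in> carrier A \<Longrightarrow> b \<in> carrier A \<Longrightarrow> a \<otimes>\<^bsub>A\<^esub> b \<in> carrier A"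
begin

interpretation F: module R "free_module R (carrier A \<times> carrier R)"
  by (rule R.module_free_module)

lemma tensor_relations_carrier: "tensor_relations A R \<subseteq> carrier (free_module R (carrier A \<times> carrier R))"
  unfolding tensor_relations_def Let_def
  by (intro Un_least subsetI; elim CollectE exE conjE; hypsubst;
      intro F.minus_closed F.add.m_closed F.smult_closed R.basis_elt_carrier SigmaI A_closed R.a_closed R.m_closed)

lemmas tensor_null_submodule = F.submodule_span[OF tensor_relations_carrier, folded tensor_null_def]

lemma module_tensor_scalars: "module R (tensor_scalars A R)"
  unfolding tensor_scalars_def by (rule F.module_quotient_module[OF tensor_null_submodule(1)])

lemma pure_tensor_closed: "a \<in> carrier A \<Longrightarrow> s \<in> carrier R \<Longrightarrow> pure_tensor A R a s \<in> carrier (tensor_scalars A R)"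
  unfolding tensor_scalars_def pure_tensor_def F.quotient_carrier[OF tensor_null_submodule(1)]
  by (intro imageI R.basis_elt_carrier) simp

lemma pure_tensor_mult:
  assumes "a \<in> carrier A" "b \<in> carrier A" "s \<in> carrier R"
  shows "pure_tensor A R (a \<otimes>\<^bsub>A\<^esub> b) s = pure_tensor A R a s \<oplus>\<^bsub>tensor_scalars A R\<^esub> pure_tensor A R b s"
proof -
  have "basis_elt R (a \<otimes>\<^bsub>A\<^esub> b, s) \<ominus>\<^bsub>free_module R (carrier A \<times> carrier R)\<^esub>
      (basis_elt R (a, s) \<oplus>\<^bsub>free_module R (carrier A \<times> carrier R)\<^esub> basis_elt R (b, s)) \<in> tensor_null A R"
    using assms by (intro subsetD[OF tensor_null_submodule(2)]) (unfold tensor_relations_def Let_def, rule UnI1, rule UnI1, rule CollectI, intro exI conjI, rule refl, simp_all)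
  then show ?thesis
    using assms unfolding pure_tensor_def tensor_scalars_def
    by (intro F.quotient_relation_add[OF tensor_null_submodule(1)] R.basis_elt_carrier SigmaI A_closed R.m_closed)
qed

lemma pure_tensor_smult:
  assumes "a \<in> carrier A" "s \<in> carrier R" "t \<in> carrier R"
  shows "pure_tensor A R a (s \<otimes>\<^bsub>R\<^esub> t) = s \<odot>\<^bsub>tensor_scalars A R\<^esub> pure_tensor A R a t"
proof -
  have "basis_elt R (a, s \<otimes>\<^bsub>R\<^esub> t) \<ominus>\<^bsub>free_module R (carrier A \<times> carrier R)\<^esub>
      (s \<odot>\<^bsub>free_module R (carrier A \<times> carrier R)\<^esub> basis_elt R (a, t)) \<in> tensor_null A R"
    using assms by (intro subsetD[OF tensor_null_submodule(2)]) (unfold tensor_relations_def Let_def, rule UnI2, rule CollectI, intro exI conjI, rule refl, simp_all)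
  then show ?thesis
    using assms unfolding pure_tensor_def tensor_scalars_def
    by (intro F.quotient_relation_smult[OF tensor_null_submodule(1)] R.basis_elt_carrier SigmaI A_closed R.m_closed)
qed

end

context module
begin

interpretation F: module R "free_module R (carrier M \<times> carrier M)"
  by (rule R.module_free_module)

lemma exterior_relations_carrier: "exterior_relations R M \<subseteq> carrier (free_module R (carrier M \<times> carrier M))"
  unfolding exterior_relations_def Let_def
  by (intro Un_least subsetI; elim CollectE exE conjE; hypsubst;
      intro F.minus_closed F.add.m_closed F.smult_closed R.basis_elt_carrier SigmaI M.add.m_closed smult_closed)

lemmas exterior_null_submodule = F.submodule_span[OF exterior_relations_carrier, folded exterior_null_def]

lemma module_exterior_square: "module R (exterior_square R M)"
  unfolding exterior_square_def by (rule F.module_quotient_module[OF exterior_null_submodule(1)])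

lemma wedge_closed: "x \<in> carrier M \<Longrightarrow> y \<in> carrier M \<Longrightarrow> wedge R M x y \<in> carrier (exterior_square R M)"
  unfolding exterior_square_def wedge_def F.quotient_carrier[OF exterior_null_submodule(1)]
  by (intro imageI R.basis_elt_carrier) simp

lemma wedge_add:
  assumes "x \<in> carrier M" "y \<in> carrier M" "z \<in> carrier M"
  shows "wedge R M (x \<oplus>\<^bsub>M\<^esub> y) z = wedge R M x z \<oplus>\<^bsub>exterior_square R M\<^esub> wedge R M y z"
    and "wedge R M z (x \<oplus>\<^bsub>M\<^esub> y) = wedge R M z x \<oplus>\<^bsub>exterior_square R M\<^esub> wedge R M z y"
proof -
  let ?F = "free_module R (carrier M \<times> carrier M)"
  have "basis_elt R (x \<oplus>\<^bsub>M\<^esub> y, z) \<ominus>\<^bsub>?F\<^esub> (basis_elt R (x, z) \<oplus>\<^bsub>?F\<^esub> basis_elt R (y, z)) \<in> exterior_null R M"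
    using assms by (intro subsetD[OF exterior_null_submodule(2)]) (unfold exterior_relations_def Let_def, rule UnI1, rule UnI1, rule UnI1, rule UnI1, rule CollectI, intro exI conjI, rule refl, simp_all)
  then show "wedge R M (x \<oplus>\<^bsub>M\<^esub> y) z = wedge R M x z \<oplus>\<^bsub>exterior_square R M\<^esub> wedge R M y z"
    using assms unfolding wedge_def exterior_square_def
    by (intro F.quotient_relation_add[OF exterior_null_submodule(1)] R.basis_elt_carrier SigmaI M.add.m_closed smult_closed)
  have "basis_elt R (z, x \<oplus>\<^bsub>M\<^esub> y) \<ominus>\<^bsub>?F\<^esub> (basis_elt R (z, x) \<oplus>\<^bsub>?F\<^esub> basis_elt R (z, y)) \<in> exterior_null R M"
    using assms by (intro subsetD[OF exterior_null_submodule(2)]) (unfold exterior_relations_def Let_def, rule UnI1, rule UnI1, rule UnI1, rule UnI2, rule CollectI, intro exI conjI, rule refl, simp_all)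
  then show "wedge R M z (x \<oplus>\<^bsub>M\<^esub> y) = wedge R M z x \<oplus>\<^bsub>exterior_square R M\<^esub> wedge R M z y"
    using assms unfolding wedge_def exterior_square_def
    by (intro F.quotient_relation_add[OF exterior_null_submodule(1)] R.basis_elt_carrier SigmaI M.add.m_closed smult_closed)
qed

lemma wedge_smult:
  assumes "r \<in> carrier R" "x \<in> carrier M" "y \<in> carrier M"
  shows "wedge R M (r \<odot>\<^bsub>M\<^esub> x) y = r \<odot>\<^bsub>exterior_square R M\<^esub> wedge R M x y"
    and "wedge R M x (r \<odot>\<^bsub>M\<^esub> y) = r \<odot>\<^bsub>exterior_square R M\<^esub> wedge R M x y"
proof -
  let ?F = "free_module R (carrier M \<times> carrier M)"
  have "basis_elt R (r \<odot>\<^bsub>M\<^esub> x, y) \<ominus>\<^bsub>?F\<^esub> (r \<odot>\<^bsub>?F\<^esub> basis_elt R (x, y)) \<in> exterior_null R M"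
    using assms by (intro subsetD[OF exterior_null_submodule(2)]) (unfold exterior_relations_def Let_def, rule UnI1, rule UnI1, rule UnI2, rule CollectI, intro exI conjI, rule refl, simp_all)
  then show "wedge R M (r \<odot>\<^bsub>M\<^esub> x) y = r \<odot>\<^bsub>exterior_square R M\<^esub> wedge R M x y"
    using assms unfolding wedge_def exterior_square_def
    by (intro F.quotient_relation_smult[OF exterior_null_submodule(1)] R.basis_elt_carrier SigmaI M.add.m_closed smult_closed)
  have "basis_elt R (x, r \<odot>\<^bsub>M\<^esub> y) \<ominus>\<^bsub>?F\<^esub> (r \<odot>\<^bsub>?F\<^esub> basis_elt R (x, y)) \<in> exterior_null R M"
    using assms by (intro subsetD[OF exterior_null_submodule(2)]) (unfold exterior_relations_def Let_def, rule UnI1, rule UnI2, rule CollectI, intro exI conjI, rule refl, simp_all)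
  then show "wedge R M x (r \<odot>\<^bsub>M\<^esub> y) = r \<odot>\<^bsub>exterior_square R M\<^esub> wedge R M x y"
    using assms unfolding wedge_def exterior_square_def
    by (intro F.quotient_relation_smult[OF exterior_null_submodule(1)] R.basis_elt_carrier SigmaI M.add.m_closed smult_closed)
qed

lemma wedge_self:
  assumes "x \<in> carrier M"
  shows "wedge R M x x = \<zero>\<^bsub>exterior_square R M\<^esub>"
proof -
  have "basis_elt R (x, x) \<in> exterior_null R M"
    using assms by (intro subsetD[OF exterior_null_submodule(2)]) (unfold exterior_relations_def Let_def, rule UnI2, rule CollectI, intro exI conjI, rule refl, simp_all)
  then show ?thesis
    using assms abelian_group.a_coset_join2[OF F.abelian_group_axioms R.basis_elt_carrier[of "(x, x)"] submodule.axioms(1)[OF exterior_null_submodule(1)]]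
    by (simp add: wedge_def exterior_square_def quotient_module_def)
qed

lemma wedge_antisymmetric:
  assumes "x \<in> carrier M" "y \<in> carrier M"
  shows "wedge R M y x = \<ominus>\<^bsub>exterior_square R M\<^esub> wedge R M x y"
proof -
  interpret L: module R "exterior_square R M" by (rule module_exterior_square)
  have "\<zero>\<^bsub>exterior_square R M\<^esub> = wedge R M (x \<oplus>\<^bsub>M\<^esub> y) (x \<oplus>\<^bsub>M\<^esub> y)"
    using assms by (simp add: wedge_self)
  also have "\<dots> = (wedge R M x x \<oplus>\<^bsub>exterior_square R M\<^esub> wedge R M y x)
      \<oplus>\<^bsub>exterior_square R M\<^esub> (wedge R M x y \<oplus>\<^bsub>exterior_square R M\<^esub> wedge R M y y)"
    using assms by (simp add: wedge_add)
  also have "\<dots> = wedge R M y x \<oplus>\<^bsub>exterior_square R M\<^esub> wedge R M x y"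
    using assms by (simp add: wedge_self wedge_closed)
  finally have "wedge R M y x \<oplus>\<^bsub>exterior_square R M\<^esub> wedge R M x y = \<zero>\<^bsub>exterior_square R M\<^esub>"
    by (rule sym)
  then show ?thesis
    using assms by (intro L.minus_equality[symmetric]) (auto simp: wedge_closed)
qed

end

section \<open>The identity for alternating forms\<close>

definition reduce :: "nat \<Rightarrow> int \<times> int \<Rightarrow> int \<times> int" where
  "reduce N x = (fst x mod int N, snd x mod int N)"

lemma reduce_simps [simp]:
  "reduce N (reduce N x) = reduce N x"
  "reduce N (reduce N x + y) = reduce N (x + y)" "reduce N (y + reduce N x) = reduce N (y + x)"
  "reduce N (reduce N x - y) = reduce N (x - y)" "reduce N (y - reduce N x) = reduce N (y - x)"
  "reduce N (- reduce N x) = reduce N (- x)"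
  by (simp_all add: reduce_def mod_simps)

lemma reduce_cong:
  assumes "reduce N x = reduce N x'" "reduce N y = reduce N y'"
  shows "reduce N (x + y) = reduce N (x' + y')" and "reduce N (x - y) = reduce N (x' - y')"
proof -
  have "reduce N (reduce N x + reduce N y) = reduce N (reduce N x' + reduce N y')"
    "reduce N (reduce N x - reduce N y) = reduce N (reduce N x' - reduce N y')"
    by (simp_all only: assms)
  then show "reduce N (x + y) = reduce N (x' + y')" "reduce N (x - y) = reduce N (x' - y')"
    by (simp_all only: reduce_simps)
qed

lemma reduce_double: "reduce N (reduce N x + reduce N x + p) = reduce N (x + x + p)"
  by (rule reduce_cong(1), rule reduce_cong(1)) simp_all

text \<open>\<open>\<Gamma>\<close> is a subgroup of \<open>(\<int>/N\<int>)\<^sup>2\<close>, given by reduced representatives; functions on it are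
  functions on \<open>\<int>\<^sup>2\<close> that are invariant under reduction, so that arguments can be computed in \<open>\<int>\<^sup>2\<close>.\<close>

locale torsion_subgroup =
  fixes N :: nat and \<Gamma> :: "(int \<times> int) set"
  assumes finite_\<Gamma> [simp]: "finite \<Gamma>"
    and zero_\<Gamma>: "0 \<in> \<Gamma>"
    and reduced: "\<And>x. x \<in> \<Gamma> \<Longrightarrow> reduce N x = x"
    and diff_\<Gamma>: "\<And>x y. x \<in> \<Gamma> \<Longrightarrow> y \<in> \<Gamma> \<Longrightarrow> reduce N (x - y) \<in> \<Gamma>"
begin

definition points :: "(int \<times> int) set" where
  "points = {x. reduce N x \<in> \<Gamma>}"

definition periodic :: "(int \<times> int \<Rightarrow> 'a) \<Rightarrow> bool" where
  "periodic h \<longleftrightarrow> (\<forall>x. h (reduce N x) = h x)"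

lemma periodicD: "periodic h \<Longrightarrow> reduce N x = reduce N y \<Longrightarrow> h x = h y"
  unfolding periodic_def by metis

lemma points_diff: "x \<in> points \<Longrightarrow> y \<in> points \<Longrightarrow> x - y \<in> points"
  using diff_\<Gamma>[of "reduce N x" "reduce N y"] by (simp add: points_def)

lemma points_0: "0 \<in> points"
  using zero_\<Gamma> reduced[OF zero_\<Gamma>] by (simp add: points_def)

lemma points_uminus: "x \<in> points \<Longrightarrow> - x \<in> points"
  using points_diff[OF points_0, of x] by simp

lemma points_add: "x \<in> points \<Longrightarrow> y \<in> points \<Longrightarrow> x + y \<in> points"
  using points_diff[of x "- y"] points_uminus[of y] by simp

lemma \<Gamma>_points: "x \<in> \<Gamma> \<Longrightarrow> x \<in> points"
  using reduced by (simp add: points_def)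

lemma sum_reflect:
  fixes h :: "int \<times> int \<Rightarrow> rat"
  assumes "periodic h" "d \<in> points"
  shows "(\<Sum>x\<in>\<Gamma>. h (d - x)) = (\<Sum>x\<in>\<Gamma>. h x)"
proof (rule sum.reindex_bij_witness[where i = "\<lambda>x. reduce N (d - x)" and j = "\<lambda>x. reduce N (d - x)"])
  fix x assume x: "x \<in> \<Gamma>"
  show "reduce N (d - reduce N (d - x)) = x" using reduced[OF x] by simp
  show "reduce N (d - x) \<in> \<Gamma>" using points_diff[OF assms(2) \<Gamma>_points[OF x]] by (simp add: points_def)
  show "h (reduce N (d - x)) = h (d - x)" by (rule periodicD[OF assms(1)]) simp
  show "reduce N (d - reduce N (d - x)) = x" using reduced[OF x] by simp
  show "reduce N (d - x) \<in> \<Gamma>" using points_diff[OF assms(2) \<Gamma>_points[OF x]] by (simp add: points_def)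
qed

lemma sum_antisymmetric:
  fixes h :: "int \<times> int \<Rightarrow> rat"
  assumes "periodic h" "d \<in> points" "\<And>x. h (d - x) = - h x"
  shows "(\<Sum>x\<in>\<Gamma>. h x) = 0"
proof -
  have "(\<Sum>x\<in>\<Gamma>. h x) = (\<Sum>x\<in>\<Gamma>. - h x)"
    using sum_reflect[OF assms(1,2)] by (simp only: assms(3))
  then show ?thesis by (simp add: sum_negf)
qed

end

text \<open>The determinant of two vectors. Two coordinate functionals turn elements into vectors
  and wedges into determinants, which makes the identity a matter of plane linear algebra.\<close>

definition cross :: "rat \<times> rat \<Rightarrow> rat \<times> rat \<Rightarrow> rat" where
  "cross p q = fst p * snd q - snd p * fst q"

lemma cross_add: "cross (p + r) q = cross p q + cross r q" "cross q (p + r) = cross q p + cross q r"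
  and cross_diff: "cross (p - r) q = cross p q - cross r q" "cross q (p - r) = cross q p - cross q r"
  and cross_swap: "cross p q = - cross q p" and cross_self: "cross p p = 0"
  by (simp_all add: cross_def algebra_simps)

lemma cross_cycle_diff:
  "cross (p - u) (q - v) + cross (q - v) (r - t) + cross (r - t) (p - u)
    = (cross p q + cross q r + cross r p) - (cross p (v - t) + cross q (t - u) + cross r (u - v))
      + (cross u v + cross v t + cross t u)"
  using cross_swap[of p t] cross_swap[of q u] cross_swap[of r v] unfolding cross_diff by linarith

lemma cross_cycle_add:
  "cross (p + u) (q + v) + cross (q + v) (r + t) + cross (r + t) (p + u)
    = (cross p q + cross q r + cross r p) + (cross u v + cross v t + cross t u)
      + (cross p v - cross q u + cross q t - cross r v + cross r u - cross p t)"
  using cross_swap[of u q] cross_swap[of v r] cross_swap[of t p] unfolding cross_add by linarith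

lemma cross_cycle_pairs:
  "cross (x + y) (z + x) + cross (z + x) (y + z) + cross (y + z) (x + y) = - (cross x y + cross y z + cross z x)"
  using cross_swap[of x z] cross_swap[of y x] cross_swap[of z y] unfolding cross_add cross_self by linarith

text \<open>Adapted to the first sum: x, y, z stand for the vectors at x, a - x, b + x, and the
  capital letters for those at their variable sums and differences. Each of the last three lines
  involves only two of x, y, z, and its antisymmetry under a reflection makes it sum to
  zero.\<close>

lemma cross_expansion:
  "cross (a + P - (x + y) - (x + y)) (b + Q - (z + x) - (z + x))
     + cross (b + Q - (z + x) - (z + x)) (c + R - (y + z) - (y + z))
     + cross (c + R - (y + z) - (y + z)) (a + P - (x + y) - (x + y))
   = (cross a b + cross b c + cross c a)
     + (cross Q R - cross Q P - cross P R)
     + (cross a Q - cross b P + cross b R - cross c Q + cross c P - cross a R)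
     + ((- 2 * (cross a x - cross a y + cross P x - cross P y) - 4 * cross x y)
      + (- 2 * (cross b z - cross b x + cross Q z - cross Q x) - 4 * cross z x)
      + (- 2 * (cross c y - cross c z + cross R y - cross R z) - 4 * cross y z))"
proof -
  have u: "(z + x) - (y + z) = x - y" "(y + z) - (x + y) = z - x" "(x + y) - (z + x) = y - z"
    by simp_all
  show ?thesis
    unfolding cross_cycle_diff u cross_cycle_add cross_cycle_pairs
    unfolding cross_add cross_diff cross_self
    using cross_swap[of y x] cross_swap[of z y] cross_swap[of x z] cross_swap[of P Q] cross_swap[of R P]
    by (simp add: algebra_simps)
qed

text \<open>Separates the vectors E and F, which vary with the summation point of the inner sum,
  from a constant; the next identity evaluates that constant.\<close>

lemma cross_expansion_constant:
  "cross V (E - (q + q)) + cross (E - (q + q)) (F - (r + r)) + cross (F - (r + r)) V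
    = cross V E - cross V F + cross E F - 2 * cross E r - 2 * cross q F + (4 * cross q r + 2 * cross q V - 2 * cross r V)"
  unfolding cross_add cross_diff using cross_swap[of V q] cross_swap[of r V] cross_swap[of F V]
  by linarith

lemma cross_expansion_difference:
  "4 * cross q r + 2 * cross q (s + d - (q + q) - (r + r)) - 2 * cross r (s + d - (q + q) - (r + r))
    = 2 * (cross q s + cross q d - cross r s - cross r d - 2 * cross q r)"
  unfolding cross_add cross_diff cross_self using cross_swap[of r q]
  by (simp add: right_diff_distrib distrib_left)

locale alternating_form = torsion_subgroup +
  fixes \<alpha> \<beta> :: "int \<times> int \<Rightarrow> rat"
  assumes per: "periodic \<alpha>" "periodic \<beta>"
    and even: "\<And>x. \<alpha> (- x) = \<alpha> x" "\<And>x. \<beta> (- x) = \<beta> x"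
    and zero: "\<alpha> 0 = 0" "\<beta> 0 = 0"
begin

definition w :: "int \<times> int \<Rightarrow> int \<times> int \<Rightarrow> rat" where
  "w p q = \<alpha> p * \<beta> q - \<beta> p * \<alpha> q"

definition vec :: "int \<times> int \<Rightarrow> rat \<times> rat" where
  "vec p = (\<alpha> p, \<beta> p)"

lemma w_cross: "w p q = cross (vec p) (vec q)"
  by (simp add: w_def cross_def vec_def)

definition v :: "(int \<times> int \<Rightarrow> rat) \<Rightarrow> int \<times> int \<Rightarrow> int \<times> int \<Rightarrow> rat" where
  "v f p q = f (p + q) + f (p - q) - 2 * f p - 2 * f q"

text \<open>Doubling is written as subtracting the same vector twice, so that only the additive
  structure of pairs is involved.\<close>

definition v_vec :: "int \<times> int \<Rightarrow> int \<times> int \<Rightarrow> rat \<times> rat" where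
  "v_vec p q = vec (p + q) + vec (p - q) - (vec p + vec q) - (vec p + vec q)"

lemma v_vec: "v_vec p q = (v \<alpha> p q, v \<beta> p q)"
  by (simp add: v_vec_def v_def vec_def)

text \<open>The value of the wedge of u(0, q, r, s) and u(0, r, q, s) on the two functionals, with
  each cross-ratio replaced by its difference of two values of v.\<close>

definition \<delta> :: "int \<times> int \<Rightarrow> int \<times> int \<Rightarrow> int \<times> int \<Rightarrow> rat" where
  "\<delta> q r s = (v \<alpha> s q - v \<alpha> r q) * (v \<beta> s r - v \<beta> q r) - (v \<beta> s q - v \<beta> r q) * (v \<alpha> s r - v \<alpha> q r)"

lemma even': "\<alpha> (x - y) = \<alpha> (y - x)" "\<beta> (x - y) = \<beta> (y - x)"
  using even[of "x - y"] by simp_all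

lemma v_commute: "v \<alpha> p q = v \<alpha> q p" "v \<beta> p q = v \<beta> q p"
  using even'[of p q] by (simp_all add: v_def add.commute)

lemma v_vec_commute: "v_vec p q = v_vec q p"
  by (simp only: v_vec v_commute[of p q])

text \<open>By symmetry of v both differences share the vector at (q, r), and the determinant of B -
  A and C - A is the cyclic sum over A, B, C.\<close>

lemma \<delta>_cyclic:
  "\<delta> q r s = cross (v_vec q r) (v_vec s q) + cross (v_vec s q) (v_vec r s) + cross (v_vec r s) (v_vec q r)"
proof -
  have "\<delta> q r s = cross (v_vec s q - v_vec q r) (v_vec r s - v_vec q r)"
    unfolding \<delta>_def v_vec cross_def v_commute[of r q] v_commute[of s r] by simp
  then show ?thesis
    unfolding cross_diff cross_self
    using cross_swap[of "v_vec q r" "v_vec s q"] cross_swap[of "v_vec q r" "v_vec r s"] by linarith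
qed

lemma v_vec_cong:
  assumes "reduce N p = reduce N p'" "reduce N q = reduce N q'"
  shows "v_vec p q = v_vec p' q'"
proof -
  have vec: "vec x = vec y" if "reduce N x = reduce N y" for x y
    unfolding vec_def periodicD[OF per(1) that] periodicD[OF per(2) that] by (rule refl)
  show ?thesis
    unfolding v_vec_def vec[OF assms(1)] vec[OF assms(2)] vec[OF reduce_cong(1)[OF assms]] vec[OF reduce_cong(2)[OF assms]]
    by (rule refl)
qed

lemma v_vec_uminus: "v_vec p (- q) = v_vec p q"
  by (simp add: v_vec_def vec_def even)

lemma v_vec_0: "v_vec p 0 = 0"
  unfolding v_vec_def vec_def zero add_0_right diff_0_right by (simp add: prod_eq_iff)

lemma \<delta>_reduce: "\<delta> (reduce N q) (reduce N r) (reduce N s) = \<delta> q r s"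
  unfolding \<delta>_cyclic v_vec_cong[OF reduce_simps(1) reduce_simps(1)] by (rule refl)

text \<open>If one of q, r, s vanishes, two of the three vectors in the cyclic sum are zero; if two
  of them agree up to sign, two of the vectors coincide. This matches the convention for classes
  that are not distinct, so the sums may range over the whole group.\<close>

lemma \<delta>_degenerate:
  assumes "reduce N q = 0 \<or> reduce N r = 0 \<or> reduce N s = 0 \<or> reduce N q = reduce N r \<or> reduce N q = reduce N (- r)
    \<or> reduce N q = reduce N s \<or> reduce N q = reduce N (- s) \<or> reduce N r = reduce N s \<or> reduce N r = reduce N (- s)"
  shows "\<delta> q r s = 0"
proof -
  have null: "v_vec p q = 0" "v_vec q p = 0" if "reduce N q = 0" for p q
  proof -
    show "v_vec p q = 0"
      using v_vec_cong[OF refl, of q 0 p] that v_vec_0 by (simp add: reduce_def zero_prod_def)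
    then show "v_vec q p = 0" by (simp only: v_vec_commute)
  qed
  have pm: "v_vec p q = v_vec p r" if "reduce N q = reduce N r \<or> reduce N q = reduce N (- r)" for p q r
    using that v_vec_cong[OF refl, of q _ p] v_vec_uminus by metis
  have cross_0: "cross 0 p = 0" "cross p 0 = 0" for p by (simp_all add: cross_def)
  have eq: "cross x y + cross y z + cross z x = 0" if "x = y \<or> y = z \<or> z = x" for x y z
    using that cross_swap[of x y] cross_swap[of y z] cross_swap[of z x] cross_self by auto
  consider "reduce N q = 0" | "reduce N r = 0" | "reduce N s = 0"
    | "v_vec s q = v_vec s r" | "v_vec r q = v_vec r s" | "v_vec q r = v_vec q s"
    using assms pm by blast
  then show ?thesis
  proof cases
    case 1
    then show ?thesis unfolding \<delta>_cyclic by (simp only: null cross_0 add_0_right)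
  next
    case 2
    then show ?thesis unfolding \<delta>_cyclic by (simp only: null cross_0 add_0_right)
  next
    case 3
    then show ?thesis unfolding \<delta>_cyclic by (simp only: null cross_0 add_0_right)
  next
    case 4
    then show ?thesis unfolding \<delta>_cyclic by (intro eq) (simp add: v_vec_commute[of r s])
  next
    case 5
    then show ?thesis unfolding \<delta>_cyclic by (intro eq) (simp add: v_vec_commute[of q r])
  next
    case 6
    then show ?thesis unfolding \<delta>_cyclic by (intro eq) (simp add: v_vec_commute[of s q])
  qed
qed

lemma periodic_w:
  assumes "\<And>x. reduce N (g (reduce N x)) = reduce N (g x)" "\<And>x. reduce N (h (reduce N x)) = reduce N (h x)"
  shows "periodic (\<lambda>x. w (g x) (h x))"
proof -
  have "w (g (reduce N x)) (h (reduce N x)) = w (g x) (h x)" for x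
    unfolding w_def periodicD[OF per(1) assms(1)] periodicD[OF per(2) assms(1)]
      periodicD[OF per(1) assms(2)] periodicD[OF per(2) assms(2)] by (rule refl)
  then show ?thesis unfolding periodic_def by blast
qed

lemma w_cong: "p = p' \<or> p = - p' \<Longrightarrow> q = q' \<or> q = - q' \<Longrightarrow> w p q = w p' q'"
  by (elim disjE; hypsubst; simp only: w_def even)

lemma w_commute: "w p q = - w q p"
  by (simp add: w_def)

lemma w_uminus: "w (- p) q = w p q" "w p (- q) = w p q"
  by (simp_all add: w_def even)

text \<open>The reflection of y to - s - t - y exchanges y + s and y + t up to sign, hence negates
  the summand.\<close>

lemma w_sum_0:
  assumes "s \<in> points" "t \<in> points"
  shows "(\<Sum>y\<in>\<Gamma>. w (y + s) (y + t)) = 0"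
proof (rule sum_antisymmetric[where d = "- s - t"])
  show "periodic (\<lambda>y. w (y + s) (y + t))" by (rule periodic_w) simp_all
  show "- s - t \<in> points" using points_diff[OF points_uminus[OF assms(1)] assms(2)] .
  show "w (- s - t - x + s) (- s - t - x + t) = - w (x + s) (x + t)" for x
    unfolding w_commute[of "x + s"] minus_minus by (rule w_cong; rule disjI2; simp)
qed

text \<open>By evenness the translation has the same effect as the reflection with centre -
  s.\<close>

lemma sum_shift:
  assumes f: "f = \<alpha> \<or> f = \<beta>" and s: "s \<in> points"
  shows "(\<Sum>y\<in>\<Gamma>. f (y + s)) = (\<Sum>y\<in>\<Gamma>. f y)"
proof -
  have "f (y + s) = f (- s - y)" for y
  proof -
    have "- s - y = - (y + s)" by simp
    then show ?thesis using f even by metis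
  qed
  then have "(\<Sum>y\<in>\<Gamma>. f (y + s)) = (\<Sum>y\<in>\<Gamma>. f (- s - y))" by simp
  also have "\<dots> = (\<Sum>y\<in>\<Gamma>. f y)"
    using f per points_uminus[OF s] by (intro sum_reflect) auto
  finally show ?thesis .
qed

text \<open>Up to a constant, v(y, p) is the second difference \<open>E p y\<close>. Its sum over
  the group vanishes, and so does the sum of the determinants of two of them by
  \<open>w_sum_0\<close>; only the constant part survives, once per y.\<close>

lemma sum_\<delta>_inner:
  assumes q: "q \<in> points" and r: "r \<in> points"
  shows "(\<Sum>y\<in>\<Gamma>. \<delta> q r y)
    = 2 * of_nat (card \<Gamma>) * (w q (q + r) + w q (q - r) - w r (q + r) - w r (q - r) - 2 * w q r)"
proof -
  define n where "n = (of_nat (card \<Gamma>) :: rat)"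
  define E where "E p y = vec (y + p) + vec (y - p) - vec y - vec y" for p y
  \<comment> \<open>All arguments are brought to the form y + s, with 0 as a shift, so that
    \<open>w_sum_0\<close> applies to each product.\<close>
  have E_split: "E p y = vec (y + p) + vec (y + - p) - vec (y + 0) - vec (y + 0)" for p y by (simp add: E_def)
  have vE: "v_vec y p = E p y - (vec p + vec p)" for p y by (simp add: v_vec_def E_def)
  have sum_cross: "(\<Sum>y\<in>\<Gamma>. cross p (f y)) = cross p (\<Sum>y\<in>\<Gamma>. f y)"
    "(\<Sum>y\<in>\<Gamma>. cross (f y) p) = cross (\<Sum>y\<in>\<Gamma>. f y) p" for p f
    by (simp_all add: cross_def sum_subtractf sum_distrib_left sum_distrib_right fst_sum snd_sum)
  have E0: "(\<Sum>y\<in>\<Gamma>. E p y) = 0" if "p \<in> points" for p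
  proof -
    have "(\<Sum>y\<in>\<Gamma>. vec (y + s)) = (\<Sum>y\<in>\<Gamma>. vec y)" if "s \<in> points" for s
      using sum_shift[of \<alpha>, OF _ that] sum_shift[of \<beta>, OF _ that] by (simp add: vec_def prod_eq_iff fst_sum snd_sum)
    from this[OF that] this[OF points_uminus[OF that]] show ?thesis
      unfolding E_def sum.distrib sum_subtractf by simp
  qed
  have EE: "(\<Sum>y\<in>\<Gamma>. cross (E q y) (E r y)) = 0"
    unfolding E_split cross_add cross_diff w_cross[symmetric] sum.distrib sum_subtractf
    using q r points_uminus[OF q] points_uminus[OF r] points_0 by (simp only: w_sum_0)
  have cross0: "cross p 0 = 0" "cross 0 p = 0" for p by (simp_all add: cross_def)
  have "\<delta> q r y = cross (v_vec q r) (E q y) - cross (v_vec q r) (E r y) + cross (E q y) (E r y)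
      - 2 * cross (E q y) (vec r) - 2 * cross (vec q) (E r y)
      + 2 * (w q (q + r) + w q (q - r) - w r (q + r) - w r (q - r) - 2 * w q r)" for y
  proof -
    have V: "v_vec q r = vec (q + r) + vec (q - r) - (vec q + vec q) - (vec r + vec r)"
      by (simp add: v_vec_def algebra_simps)
    show ?thesis
      unfolding \<delta>_cyclic v_vec_commute[of r y] vE[of y] cross_expansion_constant w_cross
      unfolding cross_expansion_difference[symmetric] V[symmetric] by (rule refl)
  qed
  then have "(\<Sum>y\<in>\<Gamma>. \<delta> q r y) = (\<Sum>y\<in>\<Gamma>. 2 * (w q (q + r) + w q (q - r) - w r (q + r) - w r (q - r) - 2 * w q r))"
    by (simp only: sum.distrib sum_subtractf sum_distrib_left[symmetric] sum_cross EE E0[OF q] E0[OF r] cross0)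
  then show ?thesis by simp
qed

text \<open>As x runs through the group, x + x + p runs through a coset of the doubled group, with
  multiplicity. \<open>S\<close>, \<open>T\<close> and \<open>wS\<close> collect the remainders of
  this kind.\<close>

definition S :: "(int \<times> int \<Rightarrow> rat) \<Rightarrow> int \<times> int \<Rightarrow> rat" where
  "S f p = (\<Sum>x\<in>\<Gamma>. f (x + x + p))"

definition T :: "int \<times> int \<Rightarrow> int \<times> int \<Rightarrow> rat" where
  "T p d = (\<Sum>x\<in>\<Gamma>. w (x + x + p) (x + x + p + d))"

definition wS :: "int \<times> int \<Rightarrow> int \<times> int \<Rightarrow> rat" where
  "wS p q = \<alpha> p * S \<beta> q - \<beta> p * S \<alpha> q"

lemma sum_w_wS: "(\<Sum>x\<in>\<Gamma>. w q (x + x + p)) = wS q p"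
  by (simp add: w_def wS_def S_def sum_subtractf sum_distrib_left)

text \<open>Reflecting x to d - x permutes the group, and \<open>w\<close> ignores signs; the
  disjunction absorbs such a sign in the argument.\<close>

lemma sum_w_reflect:
  assumes d: "d \<in> points" and u: "\<And>x. u x = d + d - (x + x) + p \<or> u x = - (d + d - (x + x) + p)"
  shows "(\<Sum>x\<in>\<Gamma>. w q (u x)) = wS q p"
proof -
  have "periodic (\<lambda>x. w q (x + x + p))"
    by (rule periodic_w) (rule refl, rule reduce_double)
  from sum_reflect[OF this d] have "(\<Sum>x\<in>\<Gamma>. w q ((d - x) + (d - x) + p)) = wS q p"
    by (simp only: sum_w_wS)
  moreover have "w q (u x) = w q ((d - x) + (d - x) + p)" for x
    using u[of x] by (intro w_cong) (auto simp: algebra_simps)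
  ultimately show ?thesis by simp
qed

lemma sum_w_T:
  assumes "\<And>x. u x = x + x + p \<or> u x = - (x + x + p)"
    and "\<And>x. u' x = x + x + p + e \<or> u' x = - (x + x + p + e)"
  shows "(\<Sum>x\<in>\<Gamma>. w (u x) (u' x)) = T p e"
  unfolding T_def by (intro sum.cong refl w_cong assms)

lemma sum_w_T_reflect:
  assumes d: "d \<in> points" and u: "\<And>x. u x = d + d - (x + x) + p \<or> u x = - (d + d - (x + x) + p)"
    and u': "\<And>x. u' x = d + d - (x + x) + p + e \<or> u' x = - (d + d - (x + x) + p + e)"
  shows "(\<Sum>x\<in>\<Gamma>. w (u x) (u' x)) = T p e"
proof -
  have "periodic (\<lambda>x. w (x + x + p) (x + x + p + e))"
    by (rule periodic_w) (rule reduce_double, simp only: add.assoc reduce_double[unfolded add.assoc])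
  from sum_reflect[OF this d]
  have "(\<Sum>x\<in>\<Gamma>. w ((d - x) + (d - x) + p) ((d - x) + (d - x) + p + e)) = T p e"
    by (simp only: T_def)
  moreover have "w (u x) (u' x) = w ((d - x) + (d - x) + p) ((d - x) + (d - x) + p + e)" for x
    using u[of x] u'[of x] by (intro w_cong) (auto simp: algebra_simps)
  ultimately show ?thesis by simp
qed

text \<open>Reflecting x to - p - x negates x + x + p and turns x + x + p - e into the negative of x
  + x + p + e.\<close>

lemma T_uminus:
  assumes "p \<in> points"
  shows "T p (- e) = T p e"
  unfolding T_def[of p "- e"]
  by (rule sum_w_T_reflect[OF points_uminus[OF assms]]; rule disjI2; simp add: algebra_simps)

context
  fixes a b :: "int \<times> int"
  assumes a: "a \<in> points" and b: "b \<in> points"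
begin

text \<open>Up to terms that are antisymmetric under one of the reflections \<open>a - x\<close>, \<open>- b - x\<close>,
  \<open>a - b - x\<close>, which exchange two of \<open>x\<close>, \<open>a - x\<close>, \<open>b + x\<close> up to sign, only the values at \<open>a\<close>,
  \<open>b\<close>, \<open>a + b\<close> and at the differences of \<open>x\<close>, \<open>a - x\<close>, \<open>b + x\<close> contribute.\<close>

lemma sum_\<delta>_first:
  "(\<Sum>x\<in>\<Gamma>. \<delta> x (a - x) (b + x))
    = of_nat (card \<Gamma>) * (w a b + w b (a + b) + w (a + b) a)
      + (T b a - T b (a + b) - T a b)
      + (wS a b - wS b a + wS b (a + b) - wS (a + b) b + wS (a + b) a - wS a (a + b))"
proof -
  \<comment> \<open>The variable ones among the sums and differences of pairs from x, a - x, b + x;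
    the others are the constants a, b and a + b.\<close>
  define P Q R where "P x = x + x - a" and "Q x = x + x + b" and "R x = a - b - (x + x)" for x
  define Y Z where "Y x = a - x" and "Z x = b + x" for x
  define T1 where "T1 x = - 2 * (w a x - w a (Y x) + w (P x) x - w (P x) (Y x)) - 4 * w x (Y x)" for x
  define T2 where "T2 x = - 2 * (w b (Z x) - w b x + w (Q x) (Z x) - w (Q x) x) - 4 * w (Z x) x" for x
  define T3 where "T3 x = - 2 * (w (a + b) (Y x) - w (a + b) (Z x) + w (R x) (Y x) - w (R x) (Z x)) - 4 * w (Y x) (Z x)" for x
  have red: "reduce N (P (reduce N x)) = reduce N (P x)" "reduce N (Q (reduce N x)) = reduce N (Q x)"
    "reduce N (R (reduce N x)) = reduce N (R x)" "reduce N (Y (reduce N x)) = reduce N (Y x)"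
    "reduce N (Z (reduce N x)) = reduce N (Z x)" for x
  proof -
    show "reduce N (P (reduce N x)) = reduce N (P x)" unfolding P_def by (intro reduce_cong) simp_all
    show "reduce N (Q (reduce N x)) = reduce N (Q x)" unfolding Q_def by (rule reduce_double)
    show "reduce N (R (reduce N x)) = reduce N (R x)" unfolding R_def by (intro reduce_cong) simp_all
  qed (simp_all add: Y_def Z_def)
  have per': "periodic (\<lambda>x. f x + g x)" "periodic (\<lambda>x. f x - g x)"
    if "periodic f" "periodic g" for f g :: "int \<times> int \<Rightarrow> rat"
    using that unfolding periodic_def by simp_all
  have per'': "periodic (\<lambda>x. k * f x)" if "periodic f" for f :: "int \<times> int \<Rightarrow> rat" and k
    using that unfolding periodic_def by simp
  have perT: "periodic T1" "periodic T2" "periodic T3"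
    unfolding T1_def T2_def T3_def by (intro per' per'' periodic_w red reduce_simps refl)+
  have sumT1: "(\<Sum>x\<in>\<Gamma>. T1 x) = 0"
  proof (rule sum_antisymmetric[OF perT(1) a])
    fix x
    have "Y (a - x) = x" "a - x = Y x" "P (a - x) = - P x" by (simp_all add: Y_def P_def)
    then show "T1 (a - x) = - T1 x" by (simp add: T1_def w_uminus w_commute[of "Y x" x])
  qed
  have sumT2: "(\<Sum>x\<in>\<Gamma>. T2 x) = 0"
  proof (rule sum_antisymmetric[OF perT(2) points_uminus[OF b]])
    fix x
    have "Z (- b - x) = - x" "- b - x = - Z x" "Q (- b - x) = - Q x" by (simp_all add: Z_def Q_def)
    then show "T2 (- b - x) = - T2 x" by (simp add: T2_def w_uminus w_commute[of x "Z x"])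
  qed
  have sumT3: "(\<Sum>x\<in>\<Gamma>. T3 x) = 0"
  proof (rule sum_antisymmetric[OF perT(3) points_diff[OF a b]])
    fix x
    have "Y (a - b - x) = Z x" "Z (a - b - x) = Y x" "R (a - b - x) = - R x" by (simp_all add: Y_def Z_def R_def)
    then show "T3 (a - b - x) = - T3 x" by (simp add: T3_def w_uminus w_commute[of "Z x" "Y x"])
  qed
  have "\<delta> x (a - x) (b + x) = (w a b + w b (a + b) + w (a + b) a)
      + (w (Q x) (R x) - w (Q x) (P x) - w (P x) (R x))
      + (w a (Q x) - w b (P x) + w b (R x) - w (a + b) (Q x) + w (a + b) (P x) - w a (R x))
      + (T1 x + T2 x + T3 x)" for x
  proof -
    have args: "x + (a - x) = a" "x - (a - x) = P x" "b + x + x = Q x" "b + x - x = b"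
      "a - x + (b + x) = a + b" "a - x - (b + x) = R x"
      by (simp_all add: P_def Q_def R_def algebra_simps)
    have V: "v_vec x (a - x) = vec a + vec (P x) - (vec x + vec (Y x)) - (vec x + vec (Y x))"
      "v_vec (b + x) x = vec b + vec (Q x) - (vec (Z x) + vec x) - (vec (Z x) + vec x)"
      "v_vec (a - x) (b + x) = vec (a + b) + vec (R x) - (vec (Y x) + vec (Z x)) - (vec (Y x) + vec (Z x))"
      unfolding v_vec_def args Y_def Z_def by (simp_all add: add.commute)
    show ?thesis
      unfolding \<delta>_cyclic V T1_def T2_def T3_def w_cross by (rule cross_expansion)
  qed
  then have "(\<Sum>x\<in>\<Gamma>. \<delta> x (a - x) (b + x)) = (\<Sum>x\<in>\<Gamma>. (w a b + w b (a + b) + w (a + b) a)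
      + (w (Q x) (R x) - w (Q x) (P x) - w (P x) (R x))
      + (w a (Q x) - w b (P x) + w b (R x) - w (a + b) (Q x) + w (a + b) (P x) - w a (R x)))"
    by (simp only: sum.distrib sumT1 sumT2 sumT3 add_0_right)
  also have "\<dots> = of_nat (card \<Gamma>) * (w a b + w b (a + b) + w (a + b) a)
      + ((\<Sum>x\<in>\<Gamma>. w (Q x) (R x)) - (\<Sum>x\<in>\<Gamma>. w (Q x) (P x)) - (\<Sum>x\<in>\<Gamma>. w (P x) (R x)))
      + ((\<Sum>x\<in>\<Gamma>. w a (Q x)) - (\<Sum>x\<in>\<Gamma>. w b (P x)) + (\<Sum>x\<in>\<Gamma>. w b (R x)) - (\<Sum>x\<in>\<Gamma>. w (a + b) (Q x))
        + (\<Sum>x\<in>\<Gamma>. w (a + b) (P x)) - (\<Sum>x\<in>\<Gamma>. w a (R x)))"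
    by (simp only: sum.distrib sum_subtractf sum_constant distrib_left)
  finally have total: "(\<Sum>x\<in>\<Gamma>. \<delta> x (a - x) (b + x)) = of_nat (card \<Gamma>) * (w a b + w b (a + b) + w (a + b) a)
      + ((\<Sum>x\<in>\<Gamma>. w (Q x) (R x)) - (\<Sum>x\<in>\<Gamma>. w (Q x) (P x)) - (\<Sum>x\<in>\<Gamma>. w (P x) (R x)))
      + ((\<Sum>x\<in>\<Gamma>. w a (Q x)) - (\<Sum>x\<in>\<Gamma>. w b (P x)) + (\<Sum>x\<in>\<Gamma>. w b (R x)) - (\<Sum>x\<in>\<Gamma>. w (a + b) (Q x))
        + (\<Sum>x\<in>\<Gamma>. w (a + b) (P x)) - (\<Sum>x\<in>\<Gamma>. w a (R x)))" .
  \<comment> \<open>The centre d is read off from the arguments: with d = - b, the element d + d -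
    (x + x) + b is \<open>- Q x\<close>.\<close>
  have S1: "(\<Sum>x\<in>\<Gamma>. w (Q x) (R x)) = T b a"
    unfolding Q_def R_def
    by (rule sum_w_T_reflect[OF points_uminus[OF b]]) (rule disjI2 disjI1, simp)+
  have S2: "(\<Sum>x\<in>\<Gamma>. w (Q x) (P x)) = T b (a + b)"
    unfolding Q_def P_def
    by (rule sum_w_T_reflect[OF points_uminus[OF b]]) (rule disjI2, simp)+
  have S3: "(\<Sum>x\<in>\<Gamma>. w (P x) (R x)) = T a (- b)"
    unfolding P_def R_def
    by (rule sum_w_T_reflect[OF points_0]) ((rule disjI2, simp; fail) | (rule disjI1, simp add: algebra_simps; fail))+
  have S4: "(\<Sum>x\<in>\<Gamma>. w q (Q x)) = wS q b" for q
    unfolding Q_def by (rule sum_w_wS)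
  have S5: "(\<Sum>x\<in>\<Gamma>. w q (P x)) = wS q a" for q
    unfolding P_def by (rule sum_w_reflect[OF points_0]) (rule disjI2, simp)
  have S6: "(\<Sum>x\<in>\<Gamma>. w q (R x)) = wS q (a + b)" for q
    unfolding R_def by (rule sum_w_reflect[OF points_uminus[OF b]]) (rule disjI1, simp add: algebra_simps)
  show ?thesis unfolding total S1 S2 S3 S4 S5 S6 T_uminus[OF a] by (rule refl)
qed

text \<open>Summation over y leaves \<open>2 * of_nat (card \<Gamma>)\<close> times values of
  \<open>w\<close> at r + 2x and q + (r + 2x) or q - (r + 2x). Under a reflection of x the plus and
  minus terms contribute equally, which doubles the factor again.\<close>

lemma sum_\<delta>_second:
  "(\<Sum>x\<in>\<Gamma>. \<Sum>y\<in>\<Gamma>. \<delta> a (b + (x + x)) y - \<delta> b (a + (x + x)) y - \<delta> (a + b) (b + (x + x)) y)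
   = 4 * of_nat (card \<Gamma>) *
      (wS a (a + b) - T b a - wS a b - wS b (a + b) + T a b + wS b a - wS (a + b) a + T b (a + b) + wS (a + b) b)"
proof -
  have pts: "a + b \<in> points" "- (a + b) \<in> points" "- a \<in> points" "- b \<in> points"
    using a b points_add points_uminus by blast+
  have inner: "(\<Sum>x\<in>\<Gamma>. \<Sum>y\<in>\<Gamma>. \<delta> q (r + (x + x)) y)
      = 2 * of_nat (card \<Gamma>) * ((\<Sum>x\<in>\<Gamma>. w q (q + (r + (x + x)))) + (\<Sum>x\<in>\<Gamma>. w q (q - (r + (x + x))))
        - (\<Sum>x\<in>\<Gamma>. w (r + (x + x)) (q + (r + (x + x)))) - (\<Sum>x\<in>\<Gamma>. w (r + (x + x)) (q - (r + (x + x))))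
        - 2 * (\<Sum>x\<in>\<Gamma>. w q (r + (x + x))))"
    if "q \<in> points" "r \<in> points" for q r
  proof -
    have "r + (x + x) \<in> points" if "x \<in> \<Gamma>" for x
      using \<open>r \<in> points\<close> \<Gamma>_points[OF that] points_add by blast
    then have "(\<Sum>x\<in>\<Gamma>. \<Sum>y\<in>\<Gamma>. \<delta> q (r + (x + x)) y)
      = (\<Sum>x\<in>\<Gamma>. 2 * of_nat (card \<Gamma>) * (w q (q + (r + (x + x))) + w q (q - (r + (x + x)))
          - w (r + (x + x)) (q + (r + (x + x))) - w (r + (x + x)) (q - (r + (x + x))) - 2 * w q (r + (x + x))))"
      using \<open>q \<in> points\<close> by (intro sum.cong refl sum_\<delta>_inner)
    then show ?thesis by (simp only: sum.distrib sum_subtractf sum_distrib_left[symmetric])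
  qed
  have lin: "(\<Sum>x\<in>\<Gamma>. w q (r + (x + x))) = wS q r" for q r
    using sum_w_wS[of q r] by (simp add: add.commute)
  have direct: "(\<Sum>x\<in>\<Gamma>. w (r + (x + x)) (q + (r + (x + x)))) = T r q" for q r
    by (rule sum_w_T) (rule disjI1, simp add: algebra_simps)+
  have "(\<Sum>x\<in>\<Gamma>. \<Sum>y\<in>\<Gamma>. \<delta> a (b + (x + x)) y) = 2 * of_nat (card \<Gamma>) * (wS a (a + b) + wS a (a + b) - T b a - T b a - 2 * wS a b)"
  proof -
    have "(\<Sum>x\<in>\<Gamma>. w a (a + (b + (x + x)))) = wS a (a + b)"
      using sum_w_wS[of a "a + b"] by (simp add: algebra_simps)
    moreover have "(\<Sum>x\<in>\<Gamma>. w a (a - (b + (x + x)))) = wS a (a + b)"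
      by (rule sum_w_reflect[OF pts(4)]) (rule disjI1, simp add: algebra_simps)
    moreover have "(\<Sum>x\<in>\<Gamma>. w (b + (x + x)) (a - (b + (x + x)))) = T b a"
      by (rule sum_w_T_reflect[OF pts(4)]) ((rule disjI2, simp add: algebra_simps; fail) | (rule disjI1, simp add: algebra_simps; fail))+
    ultimately show ?thesis by (simp only: inner[OF a b] lin direct)
  qed
  moreover have "(\<Sum>x\<in>\<Gamma>. \<Sum>y\<in>\<Gamma>. \<delta> b (a + (x + x)) y) = 2 * of_nat (card \<Gamma>) * (wS b (a + b) + wS b (a + b) - T a b - T a b - 2 * wS b a)"
  proof -
    have "(\<Sum>x\<in>\<Gamma>. w b (b + (a + (x + x)))) = wS b (a + b)"
      using sum_w_wS[of b "a + b"] by (simp add: algebra_simps)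
    moreover have "(\<Sum>x\<in>\<Gamma>. w b (b - (a + (x + x)))) = wS b (a + b)"
      by (rule sum_w_reflect[OF pts(3)]) (rule disjI1, simp add: algebra_simps)
    moreover have "(\<Sum>x\<in>\<Gamma>. w (a + (x + x)) (b - (a + (x + x)))) = T a b"
      by (rule sum_w_T_reflect[OF pts(3)]) ((rule disjI2, simp add: algebra_simps; fail) | (rule disjI1, simp add: algebra_simps; fail))+
    ultimately show ?thesis by (simp only: inner[OF b a] lin direct)
  qed
  moreover have "(\<Sum>x\<in>\<Gamma>. \<Sum>y\<in>\<Gamma>. \<delta> (a + b) (b + (x + x)) y)
      = 2 * of_nat (card \<Gamma>) * (wS (a + b) a + wS (a + b) a - T b (a + b) - T b (a + b) - 2 * wS (a + b) b)"
  proof -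
    have "(\<Sum>x\<in>\<Gamma>. w (a + b) (a + b + (b + (x + x)))) = wS (a + b) a"
      by (rule sum_w_reflect[OF pts(2)]) (rule disjI2, simp add: algebra_simps)
    moreover have "(\<Sum>x\<in>\<Gamma>. w (a + b) (a + b - (b + (x + x)))) = wS (a + b) a"
      by (rule sum_w_reflect[OF points_0]) (rule disjI1, simp add: algebra_simps)
    moreover have "(\<Sum>x\<in>\<Gamma>. w (b + (x + x)) (a + b - (b + (x + x)))) = T b (a + b)"
      by (rule sum_w_T_reflect[OF pts(4)]) ((rule disjI2, simp add: algebra_simps; fail) | (rule disjI1, simp add: algebra_simps; fail))+
    ultimately show ?thesis by (simp only: inner[OF pts(1) b] lin direct)
  qed
  ultimately show ?thesis by (simp only: sum_subtractf) (simp add: algebra_simps)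
qed

lemma three_term_identity:
  "w a b + w b (a + b) + w (a + b) a
    = 1 / of_nat (card \<Gamma>) * (\<Sum>x\<in>\<Gamma>. \<delta> x (a - x) (b + x))
      + 1 / (4 * of_nat (card \<Gamma>) ^ 2) *
        (\<Sum>x\<in>\<Gamma>. \<Sum>y\<in>\<Gamma>. \<delta> a (b + (x + x)) y - \<delta> b (a + (x + x)) y - \<delta> (a + b) (b + (x + x)) y)"
proof -
  define n where "n = (of_nat (card \<Gamma>) :: rat)"
  have n: "n \<noteq> 0" using zero_\<Gamma> by (auto simp: n_def)
  \<comment> \<open>\<open>A\<close> and \<open>B\<close> are the \<open>T\<close> and
    \<open>wS\<close> remainders of the first sum, \<open>C\<close> is the bracket of the second one
    after its factor \<open>4 * n\<close> is split off; they cancel term by term.\<close>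
  have cancel: "k = 1 / n * (n * k + A + B) + 1 / (4 * n ^ 2) * (4 * n * C)" if "A + B + C = 0" for k A B C :: rat
  proof -
    have "1 / n * (n * k + A + B) + 1 / (4 * n ^ 2) * (4 * n * C) = k + (A + B + C) / n"
      using n by (simp add: power2_eq_square add_divide_distrib)
    then show ?thesis using that by simp
  qed
  show ?thesis
    unfolding sum_\<delta>_first sum_\<delta>_second n_def[symmetric] by (rule cancel) simp
qed

text \<open>Without 2-torsion, doubling permutes the group, so coset sums become sums over the whole
  group. Then \<open>T\<close> vanishes by reflection, and \<open>wS q p\<close> no longer depends
  on p, so that its six occurrences cancel in pairs.\<close>

lemma three_term_identity_odd:
  assumes inj: "\<And>x. x \<in> \<Gamma> \<Longrightarrow> reduce N (x + x) = 0 \<Longrightarrow> x = 0"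
  shows "w a b + w b (a + b) + w (a + b) a = 1 / of_nat (card \<Gamma>) * (\<Sum>x\<in>\<Gamma>. \<delta> x (a - x) (b + x))"
proof -
  have "inj_on (\<lambda>x. reduce N (x + x)) \<Gamma>"
  proof (rule inj_onI)
    fix x y assume xy: "x \<in> \<Gamma>" "y \<in> \<Gamma>" "reduce N (x + x) = reduce N (y + y)"
    have "reduce N (reduce N (x - y) + reduce N (x - y)) = reduce N ((x - y) + (x - y))"
      by (simp only: reduce_simps)
    also have "(x - y) + (x - y) = (x + x) - (y + y)" by simp
    also have "reduce N ((x + x) - (y + y)) = reduce N ((x + x) - (x + x))"
      by (rule reduce_cong) (simp_all only: xy(3))
    finally have "reduce N (reduce N (x - y) + reduce N (x - y)) = 0" by (simp add: reduce_def prod_eq_iff)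
    then have 0: "reduce N (x - y) = 0" using inj[OF diff_\<Gamma>[OF xy(1,2)]] by blast
    have "x = reduce N (x - y + y)" using reduced[OF xy(1)] by simp
    also have "\<dots> = reduce N (reduce N (x - y) + y)" by simp
    also have "\<dots> = y" unfolding 0 using reduced[OF xy(2)] by simp
    finally show "x = y" .
  qed
  moreover have "(\<lambda>x. reduce N (x + x)) ` \<Gamma> \<subseteq> \<Gamma>"
  proof (rule image_subsetI)
    fix x assume "x \<in> \<Gamma>"
    then have "x + x \<in> points" using \<Gamma>_points points_add by blast
    then show "reduce N (x + x) \<in> \<Gamma>" by (simp add: points_def)
  qed
  ultimately have bij: "bij_betw (\<lambda>x. reduce N (x + x)) \<Gamma> \<Gamma>"
    using endo_inj_surj[OF finite_\<Gamma>] by (auto simp: bij_betw_def)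
  have double: "(\<Sum>x\<in>\<Gamma>. h (x + x)) = (\<Sum>x\<in>\<Gamma>. h x)" if "periodic h" for h :: "int \<times> int \<Rightarrow> rat"
    using sum.reindex_bij_betw[OF bij, of h] that by (simp add: periodic_def del: split_paired_All)
  have perS: "periodic (\<lambda>x. f (x + p))" if "f = \<alpha> \<or> f = \<beta>" for f p
  proof -
    have "f (reduce N x + p) = f (x + p)" for x
      using that per by (intro periodicD[of f]) auto
    then show ?thesis unfolding periodic_def by blast
  qed
  have S0: "S f p = (\<Sum>x\<in>\<Gamma>. f x)" if "f = \<alpha> \<or> f = \<beta>" "p \<in> points" for f p
    unfolding S_def double[OF perS[OF that(1)], of p] by (rule sum_shift[OF that])
  have T0: "T p e = 0" if "p \<in> points" "e \<in> points" for p e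
  proof -
    have "periodic (\<lambda>x. w (x + p) (x + p + e))"
      by (rule periodic_w) (simp_all add: add.assoc)
    from double[OF this] have "T p e = (\<Sum>x\<in>\<Gamma>. w (x + p) (x + (p + e)))"
      by (simp add: T_def add.assoc)
    also have "\<dots> = 0" by (rule w_sum_0[OF that(1) points_add[OF that]])
    finally show ?thesis .
  qed
  have ab: "a + b \<in> points" using a b by (rule points_add)
  have wS0: "wS q p = wS q 0" if "p \<in> points" for p q
    using S0 that points_0 by (simp add: wS_def)
  have "card \<Gamma> \<noteq> 0" using zero_\<Gamma> by auto
  then show ?thesis
    unfolding sum_\<delta>_first T0[OF b a] T0[OF b ab] T0[OF a b] wS0[OF a] wS0[OF b] wS0[OF ab] by simp
qed

end

end

section \<open>Exterior squares over \<open>\<int>[1/m]\<close>\<close>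

lemma Z_inv_simps [simp]:
  "x \<otimes>\<^bsub>Z_inv m\<^esub> y = x * y" "\<one>\<^bsub>Z_inv m\<^esub> = 1" "\<zero>\<^bsub>Z_inv m\<^esub> = 0" "x \<oplus>\<^bsub>Z_inv m\<^esub> y = x + y"
  by (simp_all add: Z_inv_def)

lemma Z_inv_carrier: "x \<in> carrier (Z_inv m) \<longleftrightarrow> (\<exists>k n. x = of_int k / of_nat m ^ n)"
  by (simp add: Z_inv_def)

lemma Z_inv_memI: "x = of_int k / of_nat m ^ n \<Longrightarrow> x \<in> carrier (Z_inv m)"
  unfolding Z_inv_carrier by blast

lemma Z_inv_of_int: "of_int k \<in> carrier (Z_inv m)"
  by (rule Z_inv_memI[where n = 0]) simp

lemma Z_inv_constants: "0 \<in> carrier (Z_inv m)" "1 \<in> carrier (Z_inv m)" "numeral k \<in> carrier (Z_inv m)"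
  using Z_inv_of_int[of 0 m] Z_inv_of_int[of 1 m] Z_inv_of_int[of "numeral k" m] by simp_all

lemma Z_inv_mult: "x \<in> carrier (Z_inv m) \<Longrightarrow> y \<in> carrier (Z_inv m) \<Longrightarrow> x * y \<in> carrier (Z_inv m)"
proof -
  assume "x \<in> carrier (Z_inv m)" "y \<in> carrier (Z_inv m)"
  then obtain k n l j where "x = of_int k / of_nat m ^ n" "y = of_int l / of_nat m ^ j"
    unfolding Z_inv_carrier by blast
  then show ?thesis by (intro Z_inv_memI[where k = "k * l" and n = "n + j"]) (simp add: power_add)
qed

lemma Z_inv_add:
  assumes "m > 0" "x \<in> carrier (Z_inv m)" "y \<in> carrier (Z_inv m)"
  shows "x + y \<in> carrier (Z_inv m)"
proof -
  obtain k n l j where "x = of_int k / of_nat m ^ n" "y = of_int l / of_nat m ^ j"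
    using assms unfolding Z_inv_carrier by blast
  then show ?thesis
    using assms(1)
    by (intro Z_inv_memI[where k = "k * int m ^ j + l * int m ^ n" and n = "n + j"])
       (simp add: power_add add_frac_eq mult_ac)
qed

lemma Z_inv_uminus: "x \<in> carrier (Z_inv m) \<Longrightarrow> - x \<in> carrier (Z_inv m)"
  using Z_inv_mult[OF Z_inv_of_int[of "- 1"]] by simp

lemma Z_inv_diff:
  "m > 0 \<Longrightarrow> x \<in> carrier (Z_inv m) \<Longrightarrow> y \<in> carrier (Z_inv m) \<Longrightarrow> x - y \<in> carrier (Z_inv m)"
  using Z_inv_add[of m x "- y"] Z_inv_uminus[of y m] by simp

lemma Z_inv_inverse_of_nat:
  assumes "m > 0" "d dvd m ^ n"
  shows "1 / of_nat d \<in> carrier (Z_inv m)"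
proof -
  obtain e where e: "m ^ n = d * e" using assms(2) by (auto elim: dvdE)
  then have "(of_nat m ^ n :: rat) = of_nat d * of_nat e" by (metis of_nat_mult of_nat_power)
  moreover have "d > 0" "e > 0" using e assms(1) by (auto intro!: Nat.gr0I)
  ultimately show ?thesis
    by (intro Z_inv_memI[where k = "int e" and n = n]) simp
qed

lemma cring_Z_inv:
  assumes "m > 0"
  shows "cring (Z_inv m)"
proof (rule cringI)
  show "abelian_group (Z_inv m)"
  proof (rule abelian_groupI)
    show "\<exists>y\<in>carrier (Z_inv m). y \<oplus>\<^bsub>Z_inv m\<^esub> x = \<zero>\<^bsub>Z_inv m\<^esub>" if "x \<in> carrier (Z_inv m)" for x
      using Z_inv_uminus[OF that] by (intro bexI[of _ "- x"]) auto
  qed (auto intro: Z_inv_add Z_inv_constants assms)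
  show "Group.comm_monoid (Z_inv m)"
    by (rule comm_monoidI) (auto intro: Z_inv_mult Z_inv_constants)
qed (auto simp: distrib_right)

locale Z_inv_module = module "Z_inv m" M for m and M :: "(rat, 'b, 'c) module_scheme" (structure) +
  assumes m_pos: "m > 0"
begin

abbreviation coeffs :: "('i \<Rightarrow> rat) \<Rightarrow> bool" where
  "coeffs f \<equiv> range f \<subseteq> carrier (Z_inv m)"

lemma Z_inv_a_inv: "x \<in> carrier (Z_inv m) \<Longrightarrow> \<ominus>\<^bsub>Z_inv m\<^esub> x = - x"
  by (intro R.minus_equality) (auto intro: Z_inv_uminus)

lemma smult_1 [simp]: "x \<in> carrier M \<Longrightarrow> 1 \<odot> x = x"
  using smult_one[of x] by simp

lemma smult_of_nat:
  assumes "x \<in> carrier M"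
  shows "of_nat (Suc n) \<odot> x = of_nat n \<odot> x \<oplus> x"
  using smult_l_distr[of "of_nat n" 1 x] assms Z_inv_of_int[of "int n" m] Z_inv_constants(2)[of m]
  by (simp add: add.commute[of 1])

lemma smult_zero: "x \<in> carrier M \<Longrightarrow> 0 \<odot> x = \<zero>"
  using smult_l_null by simp

text \<open>A divisor of a power of m is invertible among the scalars. The two applications are to
  12N, for passing from functions back to Siegel units, and to 2, for antisymmetry.\<close>

lemma smult_cancel:
  assumes "d dvd m ^ n" "x \<in> carrier M" "y \<in> carrier M" "of_nat d \<odot> x = of_nat d \<odot> y"
  shows "x = y"
proof -
  have d: "d \<noteq> 0" using assms(1) m_pos by (cases "d = 0") auto
  have "(1 / of_nat d) \<odot> (of_nat d \<odot> z) = z" if "z \<in> carrier M" for z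
    using smult_assoc1[OF Z_inv_inverse_of_nat[OF m_pos assms(1)] _ that, of "of_nat d"]
      Z_inv_of_int[of "int d" m] smult_one[OF that] d by simp
  then show ?thesis using assms by metis
qed

definition lincomb :: "'i set \<Rightarrow> ('i \<Rightarrow> 'b) \<Rightarrow> ('i \<Rightarrow> rat) \<Rightarrow> 'b" where
  "lincomb I g k = (\<Oplus>i\<in>I. k i \<odot> g i)"

lemma lincomb_closed: "coeffs k \<Longrightarrow> g \<in> I \<rightarrow> carrier M \<Longrightarrow> lincomb I g k \<in> carrier M"
  unfolding lincomb_def by (intro M.finsum_closed Pi_I smult_closed) auto

lemma lincomb_add:
  assumes "coeffs k" "coeffs l" "g \<in> I \<rightarrow> carrier M"
  shows "lincomb I g (\<lambda>i. k i + l i) = lincomb I g k \<oplus> lincomb I g l"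
proof -
  have "lincomb I g (\<lambda>i. k i + l i) = (\<Oplus>i\<in>I. k i \<odot> g i \<oplus> l i \<odot> g i)"
    unfolding lincomb_def using assms smult_l_distr[of "k _" "l _" "g _"]
    by (intro M.finsum_cong' refl) (auto simp: Pi_def image_subset_iff intro!: M.add.m_closed smult_closed)
  also have "\<dots> = lincomb I g k \<oplus> lincomb I g l"
    unfolding lincomb_def using assms by (intro M.finsum_addf) (auto simp: Pi_def image_subset_iff)
  finally show ?thesis .
qed

lemma lincomb_smult:
  assumes "finite I" "r \<in> carrier (Z_inv m)" "coeffs k" "g \<in> I \<rightarrow> carrier M"
  shows "lincomb I g (\<lambda>i. r * k i) = r \<odot> lincomb I g k"
proof -
  have "lincomb I g (\<lambda>i. r * k i) = (\<Oplus>i\<in>I. r \<odot> (k i \<odot> g i))"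
    unfolding lincomb_def using assms smult_assoc1[of r "k _" "g _"]
    by (intro M.finsum_cong' refl) (auto simp: Pi_def image_subset_iff)
  also have "\<dots> = r \<odot> lincomb I g k"
    unfolding lincomb_def using assms by (intro finsum_smult_ldistr[symmetric]) (auto simp: Pi_def image_subset_iff)
  finally show ?thesis .
qed

lemma lincomb_single:
  assumes "finite I" "z \<in> I" "r \<in> carrier (Z_inv m)" "g \<in> I \<rightarrow> carrier M"
  shows "lincomb I g (\<lambda>i. if i = z then r else 0) = r \<odot> g z"
proof -
  have "lincomb I g (\<lambda>i. if i = z then r else 0) = (\<Oplus>i\<in>I. if z = i then r \<odot> g i else \<zero>)"
    unfolding lincomb_def using assms by (intro M.finsum_cong' refl) (auto simp: Pi_def smult_zero)
  also have "\<dots> = r \<odot> g z"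
    using assms by (intro M.finsum_singleton) (auto simp: Pi_def)
  finally show ?thesis .
qed

lemma lincomb_zero:
  assumes "g \<in> I \<rightarrow> carrier M"
  shows "lincomb I g (\<lambda>_. 0) = \<zero>"
proof -
  have "lincomb I g (\<lambda>_. 0) = (\<Oplus>i\<in>I. \<zero>)"
    unfolding lincomb_def using assms by (intro M.finsum_cong' refl) (auto simp: Pi_def smult_zero)
  then show ?thesis by simp
qed

lemma finsum_swap:
  assumes "finite I" "finite J" "\<And>i j. i \<in> I \<Longrightarrow> j \<in> J \<Longrightarrow> f i j \<in> carrier M"
  shows "(\<Oplus>i\<in>I. \<Oplus>j\<in>J. f i j) = (\<Oplus>j\<in>J. \<Oplus>i\<in>I. f i j)"
  using assms(1,3)
proof (induction I rule: finite_induct)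
  case (insert i I)
  have "(\<Oplus>i'\<in>insert i I. \<Oplus>j\<in>J. f i' j) = (\<Oplus>j\<in>J. f i j) \<oplus> (\<Oplus>j\<in>J. \<Oplus>i\<in>I. f i j)"
    using insert by (subst M.finsum_insert) (auto intro!: M.finsum_closed)
  also have "\<dots> = (\<Oplus>j\<in>J. f i j \<oplus> (\<Oplus>i\<in>I. f i j))"
    using insert by (intro M.finsum_addf[symmetric]) (auto intro!: M.finsum_closed)
  also have "\<dots> = (\<Oplus>j\<in>J. \<Oplus>i'\<in>insert i I. f i' j)"
    using insert by (intro M.finsum_cong' refl) (auto intro!: M.finsum_closed simp: M.finsum_insert Pi_def)
  finally show ?case .
qed simp

end

text \<open>Elements \<open>\<Sum> f(x,y) g\<^sub>x \<and> g\<^sub>y\<close> of the exterior square are determined by the antisymmetric part of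
  the coefficient function, because \<open>2\<close> is invertible.\<close>

locale Z_inv_wedge = Z_inv_module m M for m and M :: "(rat, 'b, 'c) module_scheme" (structure) +
  fixes \<Gamma> :: "'i set" and g :: "'i \<Rightarrow> 'b"
  assumes finite_\<Gamma>: "finite \<Gamma>" and g_closed: "g \<in> \<Gamma> \<rightarrow> carrier M" and even_m: "even m"
begin

abbreviation "\<Lambda> \<equiv> exterior_square (Z_inv m) M"

sublocale L: Z_inv_module m \<Lambda>
  by (intro Z_inv_module.intro module_exterior_square Z_inv_module_axioms.intro m_pos)

definition wedge_comb :: "('i \<Rightarrow> 'i \<Rightarrow> rat) \<Rightarrow> _" where
  "wedge_comb f = L.lincomb \<Gamma> (\<lambda>x. L.lincomb \<Gamma> (\<lambda>y. wedge (Z_inv m) M (g x) (g y)) (f x)) (\<lambda>_. 1)"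

definition represents where
  "represents t f \<longleftrightarrow> (\<forall>x. coeffs (f x)) \<and> t = wedge_comb f"

lemma g_mem: "x \<in> \<Gamma> \<Longrightarrow> g x \<in> carrier M"
  using g_closed by auto

lemma wedge_mem: "x \<in> \<Gamma> \<Longrightarrow> (\<lambda>y. wedge (Z_inv m) M (g x) (g y)) \<in> \<Gamma> \<rightarrow> carrier \<Lambda>"
  using g_mem by (auto intro: wedge_closed)

lemma inner_mem:
  assumes "\<And>x. coeffs (f x)"
  shows "(\<lambda>x. L.lincomb \<Gamma> (\<lambda>y. wedge (Z_inv m) M (g x) (g y)) (f x)) \<in> \<Gamma> \<rightarrow> carrier \<Lambda>"
  using assms wedge_mem by (intro Pi_I L.lincomb_closed) auto

lemma wedge_comb_eq:
  assumes "\<And>x. coeffs (f x)"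
  shows "wedge_comb f = (\<Oplus>\<^bsub>\<Lambda>\<^esub>x\<in>\<Gamma>. L.lincomb \<Gamma> (\<lambda>y. wedge (Z_inv m) M (g x) (g y)) (f x))"
proof -
  show ?thesis
    unfolding wedge_comb_def L.lincomb_def[of _ _ "\<lambda>_. 1"] using inner_mem[of f, OF assms]
    by (intro L.M.finsum_cong' refl) (auto simp: Pi_def)
qed

lemma represents_closed: "represents t f \<Longrightarrow> t \<in> carrier \<Lambda>"
  unfolding represents_def using inner_mem by (auto simp: wedge_comb_eq intro!: L.M.finsum_closed)

lemma represents_add:
  assumes "represents t f" "represents u h"
  shows "represents (t \<oplus>\<^bsub>\<Lambda>\<^esub> u) (\<lambda>x y. f x y + h x y)"
proof -
  have f: "\<And>x. coeffs (f x)" and h: "\<And>x. coeffs (h x)" and t: "t = wedge_comb f" "u = wedge_comb h"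
    using assms by (auto simp: represents_def)
  have fh: "coeffs (\<lambda>y. f x y + h x y)" for x
    using f[of x] h[of x] m_pos by (auto intro!: Z_inv_add)
  have "wedge_comb (\<lambda>x y. f x y + h x y) = (\<Oplus>\<^bsub>\<Lambda>\<^esub>x\<in>\<Gamma>.
      L.lincomb \<Gamma> (\<lambda>y. wedge (Z_inv m) M (g x) (g y)) (f x) \<oplus>\<^bsub>\<Lambda>\<^esub> L.lincomb \<Gamma> (\<lambda>y. wedge (Z_inv m) M (g x) (g y)) (h x))"
    unfolding wedge_comb_eq[OF fh] using inner_mem[of f, OF f] inner_mem[of h, OF h] wedge_mem
    by (intro L.M.finsum_cong' refl) (auto simp: Pi_def L.lincomb_add[OF f h])
  also have "\<dots> = t \<oplus>\<^bsub>\<Lambda>\<^esub> u"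
    unfolding t wedge_comb_eq[OF f] wedge_comb_eq[OF h] by (intro L.M.finsum_addf inner_mem f h)
  finally show ?thesis using fh by (simp add: represents_def)
qed

lemma represents_smult:
  assumes "represents t f" and r: "r \<in> carrier (Z_inv m)"
  shows "represents (r \<odot>\<^bsub>\<Lambda>\<^esub> t) (\<lambda>x y. r * f x y)"
proof -
  have f: "\<And>x. coeffs (f x)" and t: "t = wedge_comb f"
    using assms by (auto simp: represents_def)
  have rf: "coeffs (\<lambda>y. r * f x y)" for x
    using f[of x] r by (auto intro!: Z_inv_mult)
  have "wedge_comb (\<lambda>x y. r * f x y) = (\<Oplus>\<^bsub>\<Lambda>\<^esub>x\<in>\<Gamma>.
      r \<odot>\<^bsub>\<Lambda>\<^esub> L.lincomb \<Gamma> (\<lambda>y. wedge (Z_inv m) M (g x) (g y)) (f x))"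
    unfolding wedge_comb_eq[OF rf] using inner_mem[of f, OF f] wedge_mem r
    by (intro L.M.finsum_cong' refl) (auto simp: Pi_def L.lincomb_smult[OF finite_\<Gamma> r f])
  also have "\<dots> = r \<odot>\<^bsub>\<Lambda>\<^esub> t"
    unfolding t wedge_comb_eq[OF f] by (intro L.finsum_smult_ldistr[symmetric] finite_\<Gamma> r inner_mem f)
  finally show ?thesis using rf by (simp add: represents_def)
qed

lemma represents_minus:
  assumes "represents t f" "represents u h"
  shows "represents (t \<ominus>\<^bsub>\<Lambda>\<^esub> u) (\<lambda>x y. f x y - h x y)"
proof -
  have u: "u \<in> carrier \<Lambda>" by (rule represents_closed[OF assms(2)])
  have m1: "- 1 \<in> carrier (Z_inv m)" by (intro Z_inv_uminus Z_inv_constants)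
  have "(- 1) \<odot>\<^bsub>\<Lambda>\<^esub> u = \<ominus>\<^bsub>\<Lambda>\<^esub> u"
    using L.smult_l_minus[of 1 u] u L.smult_one[OF u] by (simp add: Z_inv_a_inv Z_inv_constants)
  then show ?thesis
    using represents_add[OF assms(1) represents_smult[OF assms(2) m1]] by (simp add: a_minus_def)
qed

lemma represents_zero: "represents \<zero>\<^bsub>\<Lambda>\<^esub> (\<lambda>_ _. 0)"
proof -
  have c: "coeffs (\<lambda>_. 0)" by (auto intro: Z_inv_constants)
  have "wedge_comb (\<lambda>_ _. 0) = (\<Oplus>\<^bsub>\<Lambda>\<^esub>x\<in>\<Gamma>. \<zero>\<^bsub>\<Lambda>\<^esub>)"
    unfolding wedge_comb_eq[OF c] using wedge_mem by (intro L.M.finsum_cong' refl) (auto simp: L.lincomb_zero)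
  then show ?thesis using c by (simp add: represents_def)
qed

lemma represents_finsum:
  assumes "finite I" "\<And>i. i \<in> I \<Longrightarrow> represents (t i) (f i)"
  shows "represents (\<Oplus>\<^bsub>\<Lambda>\<^esub>i\<in>I. t i) (\<lambda>x y. \<Sum>i\<in>I. f i x y)"
  using assms
proof (induction I rule: finite_induct)
  case empty
  then show ?case using represents_zero by simp
next
  case (insert i I)
  then have "t \<in> I \<rightarrow> carrier \<Lambda>" "t i \<in> carrier \<Lambda>" using represents_closed by auto
  then show ?case using insert represents_add[of "t i" "f i"] by simp
qed

lemma wedge_lincomb_right:
  assumes "x \<in> carrier M" "coeffs k"
  shows "wedge (Z_inv m) M x (lincomb \<Gamma> g k) = L.lincomb \<Gamma> (\<lambda>y. wedge (Z_inv m) M x (g y)) k"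
proof -
  have "wedge (Z_inv m) M x (\<Oplus>i\<in>I. k i \<odot> g i) = (\<Oplus>\<^bsub>\<Lambda>\<^esub>i\<in>I. k i \<odot>\<^bsub>\<Lambda>\<^esub> wedge (Z_inv m) M x (g i))"
    if "finite I" "I \<subseteq> \<Gamma>" for I
    using that
  proof (induction I rule: finite_induct)
    case empty
    \<comment> \<open>The wedge with the zero vector is computed by writing that vector as 0 times
      x.\<close>
    have "wedge (Z_inv m) M x (0 \<odot> x) = 0 \<odot>\<^bsub>\<Lambda>\<^esub> wedge (Z_inv m) M x x"
      using assms by (intro wedge_smult Z_inv_constants)
    then show ?case using assms by (simp add: smult_zero L.smult_zero wedge_closed)
  next
    case (insert i I)
    have k: "k j \<in> carrier (Z_inv m)" for j using assms(2) by auto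
    have gi: "g i \<in> carrier M" and gI: "\<And>j. j \<in> I \<Longrightarrow> g j \<in> carrier M" using insert g_mem by auto
    have kg: "(\<lambda>j. k j \<odot> g j) \<in> I \<rightarrow> carrier M" "(\<lambda>j. k j \<odot>\<^bsub>\<Lambda>\<^esub> wedge (Z_inv m) M x (g j)) \<in> I \<rightarrow> carrier \<Lambda>"
      using gI k assms(1) by (auto intro!: wedge_closed)
    have "wedge (Z_inv m) M x (\<Oplus>j\<in>insert i I. k j \<odot> g j)
        = wedge (Z_inv m) M x (k i \<odot> g i \<oplus> (\<Oplus>j\<in>I. k j \<odot> g j))"
      using insert kg gi k by (subst M.finsum_insert) auto
    also have "\<dots> = k i \<odot>\<^bsub>\<Lambda>\<^esub> wedge (Z_inv m) M x (g i) \<oplus>\<^bsub>\<Lambda>\<^esub> wedge (Z_inv m) M x (\<Oplus>j\<in>I. k j \<odot> g j)"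
      using kg gi k assms(1) by (simp add: wedge_add wedge_smult M.finsum_closed)
    also have "\<dots> = (\<Oplus>\<^bsub>\<Lambda>\<^esub>j\<in>insert i I. k j \<odot>\<^bsub>\<Lambda>\<^esub> wedge (Z_inv m) M x (g j))"
      using insert kg gi k assms(1) by (subst L.M.finsum_insert) (auto intro!: wedge_closed)
    finally show ?case .
  qed
  from this[OF finite_\<Gamma> subset_refl] show ?thesis by (simp add: lincomb_def L.lincomb_def)
qed

lemma wedge_lincomb_left:
  assumes x: "x \<in> carrier M" and k: "coeffs k"
  shows "wedge (Z_inv m) M (lincomb \<Gamma> g k) x = L.lincomb \<Gamma> (\<lambda>y. wedge (Z_inv m) M (g y) x) k"
proof -
  have m1: "- 1 \<in> carrier (Z_inv m)" by (intro Z_inv_uminus Z_inv_constants)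
  have neg: "wedge (Z_inv m) M y z = (- 1) \<odot>\<^bsub>\<Lambda>\<^esub> wedge (Z_inv m) M z y" if "y \<in> carrier M" "z \<in> carrier M" for y z
    using wedge_antisymmetric[OF that(2,1)] L.smult_l_minus[of 1 "wedge (Z_inv m) M z y"] that
      L.smult_one[OF wedge_closed[OF that(2,1)]]
    by (simp add: Z_inv_a_inv Z_inv_constants wedge_closed)
  have "wedge (Z_inv m) M (lincomb \<Gamma> g k) x = (- 1) \<odot>\<^bsub>\<Lambda>\<^esub> L.lincomb \<Gamma> (\<lambda>y. wedge (Z_inv m) M x (g y)) k"
    using neg[OF lincomb_closed[OF k g_closed] x] wedge_lincomb_right[OF x k] by simp
  also have "\<dots> = (\<Oplus>\<^bsub>\<Lambda>\<^esub>y\<in>\<Gamma>. (- 1) \<odot>\<^bsub>\<Lambda>\<^esub> (k y \<odot>\<^bsub>\<Lambda>\<^esub> wedge (Z_inv m) M x (g y)))"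
    unfolding L.lincomb_def using g_mem k x by (intro L.finsum_smult_ldistr finite_\<Gamma> m1) (auto simp: image_subset_iff intro!: wedge_closed)
  also have "\<dots> = L.lincomb \<Gamma> (\<lambda>y. wedge (Z_inv m) M (g y) x) k"
    unfolding L.lincomb_def
  proof (rule L.M.finsum_cong'[OF refl])
    fix y assume y: "y \<in> \<Gamma>"
    have "(- 1) \<odot>\<^bsub>\<Lambda>\<^esub> (k y \<odot>\<^bsub>\<Lambda>\<^esub> wedge (Z_inv m) M x (g y)) = k y \<odot>\<^bsub>\<Lambda>\<^esub> ((- 1) \<odot>\<^bsub>\<Lambda>\<^esub> wedge (Z_inv m) M x (g y))"
      using L.smult_assoc1[of "- 1" "k y" "wedge (Z_inv m) M x (g y)"] L.smult_assoc1[of "k y" "- 1" "wedge (Z_inv m) M x (g y)"]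
        k m1 x g_mem[OF y] by (auto simp: wedge_closed image_subset_iff)
    then show "(- 1) \<odot>\<^bsub>\<Lambda>\<^esub> (k y \<odot>\<^bsub>\<Lambda>\<^esub> wedge (Z_inv m) M x (g y)) = k y \<odot>\<^bsub>\<Lambda>\<^esub> wedge (Z_inv m) M (g y) x"
      using neg[OF g_mem[OF y] x] by simp
  qed (use g_mem k x in \<open>auto simp: image_subset_iff intro!: wedge_closed\<close>)
  finally show ?thesis .
qed

lemma represents_wedge:
  assumes k: "coeffs k" and l: "coeffs l"
  shows "represents (wedge (Z_inv m) M (lincomb \<Gamma> g k) (lincomb \<Gamma> g l)) (\<lambda>x y. k x * l y)"
proof -
  have kl: "coeffs (\<lambda>y. k x * l y)" for x using k l by (auto intro!: Z_inv_mult)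
  have "wedge (Z_inv m) M (lincomb \<Gamma> g k) (lincomb \<Gamma> g l)
      = (\<Oplus>\<^bsub>\<Lambda>\<^esub>x\<in>\<Gamma>. k x \<odot>\<^bsub>\<Lambda>\<^esub> wedge (Z_inv m) M (g x) (lincomb \<Gamma> g l))"
    unfolding wedge_lincomb_left[OF lincomb_closed[OF l g_closed] k] by (simp add: L.lincomb_def)
  also have "\<dots> = wedge_comb (\<lambda>x y. k x * l y)"
    unfolding wedge_comb_eq[OF kl]
  proof (rule L.M.finsum_cong'[OF refl inner_mem[OF kl]])
    fix x assume x: "x \<in> \<Gamma>"
    have kx: "k x \<in> carrier (Z_inv m)" using k by auto
    show "k x \<odot>\<^bsub>\<Lambda>\<^esub> wedge (Z_inv m) M (g x) (lincomb \<Gamma> g l) = L.lincomb \<Gamma> (\<lambda>y. wedge (Z_inv m) M (g x) (g y)) (\<lambda>y. k x * l y)"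
      unfolding wedge_lincomb_right[OF g_mem[OF x] l] by (rule L.lincomb_smult[OF finite_\<Gamma> kx l wedge_mem[OF x], symmetric])
  qed
  finally show ?thesis using kl by (simp add: represents_def)
qed

text \<open>Exchanging the summation indices and using antisymmetry shows that the element equals
  its own negative; doubling is injective because m is even.\<close>

lemma represents_symmetric:
  assumes t: "represents t f" and sym: "\<And>x y. x \<in> \<Gamma> \<Longrightarrow> y \<in> \<Gamma> \<Longrightarrow> f x y = f y x"
  shows "t = \<zero>\<^bsub>\<Lambda>\<^esub>"
proof -
  have f: "\<And>x. coeffs (f x)" and t': "t = wedge_comb f"
    using t by (auto simp: represents_def)
  have fxy: "f x y \<in> carrier (Z_inv m)" for x y using f[of x] by auto
  have mem: "f x y \<odot>\<^bsub>\<Lambda>\<^esub> wedge (Z_inv m) M (g x') (g y') \<in> carrier \<Lambda>" if "x' \<in> \<Gamma>" "y' \<in> \<Gamma>" for x y x' y'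
    using that g_mem fxy by (auto intro!: wedge_closed)
  have t1: "t = (\<Oplus>\<^bsub>\<Lambda>\<^esub>x\<in>\<Gamma>. \<Oplus>\<^bsub>\<Lambda>\<^esub>y\<in>\<Gamma>. f x y \<odot>\<^bsub>\<Lambda>\<^esub> wedge (Z_inv m) M (g x) (g y))"
    unfolding t' wedge_comb_eq[OF f] by (simp add: L.lincomb_def)
  have "t = (\<Oplus>\<^bsub>\<Lambda>\<^esub>x\<in>\<Gamma>. \<Oplus>\<^bsub>\<Lambda>\<^esub>y\<in>\<Gamma>. f y x \<odot>\<^bsub>\<Lambda>\<^esub> wedge (Z_inv m) M (g y) (g x))"
    unfolding t1 by (rule L.finsum_swap[OF finite_\<Gamma> finite_\<Gamma>]) (rule mem)
  also have "\<dots> = (\<Oplus>\<^bsub>\<Lambda>\<^esub>x\<in>\<Gamma>. \<Oplus>\<^bsub>\<Lambda>\<^esub>y\<in>\<Gamma>. (- f x y) \<odot>\<^bsub>\<Lambda>\<^esub> wedge (Z_inv m) M (g x) (g y))"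
  proof -
    have "f y x \<odot>\<^bsub>\<Lambda>\<^esub> wedge (Z_inv m) M (g y) (g x) = (- f x y) \<odot>\<^bsub>\<Lambda>\<^esub> wedge (Z_inv m) M (g x) (g y)" if "x \<in> \<Gamma>" "y \<in> \<Gamma>" for x y
      using wedge_antisymmetric[OF g_mem[OF that(1)] g_mem[OF that(2)]] sym[OF that] fxy that g_mem
        L.smult_l_minus[of "f x y"] L.smult_r_minus[of "f x y"]
      by (simp add: Z_inv_a_inv wedge_closed)
    then show ?thesis
      using mem g_mem fxy by (intro L.M.finsum_cong' refl Pi_I L.M.finsum_closed) (auto intro!: wedge_closed Z_inv_uminus)
  qed
  also have "\<dots> = wedge_comb (\<lambda>x y. - f x y)"
    using f by (subst wedge_comb_eq) (auto simp: L.lincomb_def intro!: Z_inv_uminus)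
  finally have "represents t (\<lambda>x y. - f x y)"
    using f by (auto simp: represents_def intro!: Z_inv_uminus)
  \<comment> \<open>The element is represented by f and also by - f, so its double is represented by
    the zero function.\<close>
  from represents_add[OF t this] represents_zero have "t \<oplus>\<^bsub>\<Lambda>\<^esub> t = \<zero>\<^bsub>\<Lambda>\<^esub>"
    by (simp add: represents_def)
  moreover have tc: "t \<in> carrier \<Lambda>" by (rule represents_closed[OF t])
  moreover have "of_nat 2 \<odot>\<^bsub>\<Lambda>\<^esub> t = t \<oplus>\<^bsub>\<Lambda>\<^esub> t" "of_nat 2 \<odot>\<^bsub>\<Lambda>\<^esub> \<zero>\<^bsub>\<Lambda>\<^esub> = \<zero>\<^bsub>\<Lambda>\<^esub>"
    using L.smult_of_nat[OF tc, of 1] L.smult_one[OF tc] L.smult_r_null[of 2] Z_inv_constants(3)[where m = m] by (simp_all add: numeral_2_eq_2)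
  ultimately show ?thesis
    using L.smult_cancel[of 2 1 t "\<zero>\<^bsub>\<Lambda>\<^esub>"] even_m by simp
qed

lemma represents_eqI:
  assumes "represents t f" "represents u h"
    and "\<And>x y. x \<in> \<Gamma> \<Longrightarrow> y \<in> \<Gamma> \<Longrightarrow> f x y - f y x = h x y - h y x"
  shows "t = u"
proof -
  have "t \<ominus>\<^bsub>\<Lambda>\<^esub> u = \<zero>\<^bsub>\<Lambda>\<^esub>"
    by (rule represents_symmetric[OF represents_minus[OF assms(1,2)]]) (use assms(3) in \<open>simp add: algebra_simps\<close>)
  then show ?thesis
    using represents_closed[OF assms(1)] represents_closed[OF assms(2)] L.M.minus_equality[of t "\<ominus>\<^bsub>\<Lambda>\<^esub> u"]
    by (simp add: a_minus_def)
qed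

end

section \<open>Siegel units\<close>

lemma is_modular_unitD:
  assumes "is_modular_unit N f"
  shows "f holomorphic_on {\<tau>. Im \<tau> > 0}" and "Im \<tau> > 0 \<Longrightarrow> f \<tau> \<noteq> 0" and "\<not> Im \<tau> > 0 \<Longrightarrow> f \<tau> = 1"
    and "a * d - b * c = 1 \<and> [a = 1] (mod int N) \<and> [b = 0] (mod int N) \<and> [c = 0] (mod int N) \<and> [d = 1] (mod int N)
      \<Longrightarrow> Im \<tau> > 0 \<Longrightarrow> f (moebius_int a b c d \<tau>) = f \<tau>"
    and "a * d - b * c = 1 \<Longrightarrow> \<exists>F. fourier_expansion N (\<lambda>\<tau>. f (moebius_int a b c d \<tau>)) F"
    and "\<exists>F. fourier_expansion N f F \<and> (\<forall>n. fls_nth F n \<in> cyclotomic_field N)"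
proof -
  note * = assms[unfolded is_modular_unit_def]
  note ** = *[THEN conjunct2, THEN conjunct2, THEN conjunct2]
  show "f holomorphic_on {\<tau>. Im \<tau> > 0}" by (rule *[THEN conjunct1])
  show "Im \<tau> > 0 \<Longrightarrow> f \<tau> \<noteq> 0" by (rule *[THEN conjunct2, THEN conjunct1, rule_format])
  show "\<not> Im \<tau> > 0 \<Longrightarrow> f \<tau> = 1" by (rule *[THEN conjunct2, THEN conjunct2, THEN conjunct1, rule_format])
  show "a * d - b * c = 1 \<and> [a = 1] (mod int N) \<and> [b = 0] (mod int N) \<and> [c = 0] (mod int N) \<and> [d = 1] (mod int N)
      \<Longrightarrow> Im \<tau> > 0 \<Longrightarrow> f (moebius_int a b c d \<tau>) = f \<tau>"
    by (rule **[THEN conjunct1, THEN spec, THEN spec, THEN spec, THEN spec, THEN mp, THEN spec, THEN mp])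
  show "a * d - b * c = 1 \<Longrightarrow> \<exists>F. fourier_expansion N (\<lambda>\<tau>. f (moebius_int a b c d \<tau>)) F"
    by (rule **[THEN conjunct2, THEN conjunct1, THEN spec, THEN spec, THEN spec, THEN spec, THEN mp])
  show "\<exists>F. fourier_expansion N f F \<and> (\<forall>n. fls_nth F n \<in> cyclotomic_field N)"
    by (rule **[THEN conjunct2, THEN conjunct2])
qed

lemma is_modular_unit_mult:
  assumes f: "is_modular_unit N f" and g: "is_modular_unit N g"
  shows "is_modular_unit N (\<lambda>\<tau>. f \<tau> * g \<tau>)"
proof -
  have exp: "fourier_expansion N (\<lambda>\<tau>. f' \<tau> * g' \<tau>) (F * G)"
    if F: "fourier_expansion N f' F" and G: "fourier_expansion N g' G" for f' g' F G
  proof -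
    obtain h k where "h has_laurent_expansion F" "k has_laurent_expansion G"
      "\<And>\<tau>. Im \<tau> > 0 \<Longrightarrow> f' \<tau> = h (e_fun (\<tau> / of_nat N))" "\<And>\<tau>. Im \<tau> > 0 \<Longrightarrow> g' \<tau> = k (e_fun (\<tau> / of_nat N))"
      using F G unfolding fourier_expansion_def by blast
    then show ?thesis
      unfolding fourier_expansion_def by (intro exI[of _ "\<lambda>z. h z * k z"]) (auto intro: has_laurent_expansion_mult)
  qed
  have coeffs: "fls_nth (F * G) n \<in> cyclotomic_field N"
    if "\<And>n. fls_nth F n \<in> cyclotomic_field N" "\<And>n. fls_nth G n \<in> cyclotomic_field N" for F G n
    unfolding fls_times_nth(1) by (intro cyclotomic_field_sum cyclotomic_field_mult that)
  show ?thesis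
    unfolding is_modular_unit_def
  proof (intro conjI allI impI)
    show "(\<lambda>\<tau>. f \<tau> * g \<tau>) holomorphic_on {\<tau>. 0 < Im \<tau>}"
      by (intro holomorphic_on_mult is_modular_unitD(1)[OF f] is_modular_unitD(1)[OF g])
    show "f \<tau> * g \<tau> \<noteq> 0" if "0 < Im \<tau>" for \<tau>
      using is_modular_unitD(2)[OF f that] is_modular_unitD(2)[OF g that] by simp
    show "f \<tau> * g \<tau> = 1" if "\<not> 0 < Im \<tau>" for \<tau>
      by (simp only: is_modular_unitD(3)[OF f that] is_modular_unitD(3)[OF g that] mult_1)
    show "f (moebius_int a b c d \<tau>) * g (moebius_int a b c d \<tau>) = f \<tau> * g \<tau>"
      if "a * d - b * c = 1 \<and> [a = 1] (mod int N) \<and> [b = 0] (mod int N) \<and> [c = 0] (mod int N) \<and> [d = 1] (mod int N)" "0 < Im \<tau>"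
      for a b c d \<tau>
      by (simp only: is_modular_unitD(4)[OF f that] is_modular_unitD(4)[OF g that])
    show "\<exists>F. fourier_expansion N (\<lambda>\<tau>. f (moebius_int a b c d \<tau>) * g (moebius_int a b c d \<tau>)) F" if "a * d - b * c = 1" for a b c d
      using is_modular_unitD(5)[OF f that] is_modular_unitD(5)[OF g that] exp by blast
    obtain F G where F: "fourier_expansion N f F" "\<And>n. fls_nth F n \<in> cyclotomic_field N"
      and G: "fourier_expansion N g G" "\<And>n. fls_nth G n \<in> cyclotomic_field N"
      using is_modular_unitD(6)[OF f] is_modular_unitD(6)[OF g] by blast
    from exp[OF F(1) G(1)] coeffs[OF F(2) G(2)]
    show "\<exists>F. fourier_expansion N (\<lambda>\<tau>. f \<tau> * g \<tau>) F \<and> (\<forall>n. fls_nth F n \<in> cyclotomic_field N)" by blast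
  qed
qed

lemma modular_units_simps [simp]:
  "f \<in> carrier (modular_units N) \<longleftrightarrow> is_modular_unit N f"
  "f \<otimes>\<^bsub>modular_units N\<^esub> g = (\<lambda>\<tau>. f \<tau> * g \<tau>)"
  by (simp_all add: modular_units_def)

lemma level_zero_reduce: "level_zero N x \<longleftrightarrow> reduce N x = (0, 0)"
  by (simp add: reduce_def dvd_eq_mod_eq_0)

lemma level_zero_diff: "level_zero N (x - y) \<longleftrightarrow> reduce N x = reduce N y"
  by (simp add: reduce_def mod_eq_dvd_iff)

locale modular_unit_module =
  fixes N :: nat
  assumes N: "N \<ge> 1"
begin

abbreviation tensor :: "(complex \<Rightarrow> complex) \<Rightarrow> rat \<Rightarrow> unit_tensor" where
  "tensor \<equiv> pure_tensor (modular_units N) (scalars N)"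

abbreviation siegel_power :: "int \<times> int \<Rightarrow> complex \<Rightarrow> complex" where
  "siegel_power x \<equiv> (\<lambda>\<tau>. siegel_fun N x \<tau> ^ (12 * N))"

definition siegel :: "int \<times> int \<Rightarrow> unit_tensor" where
  "siegel x = siegel_unit N (reduce N x)"

sublocale T: tensor_scalars_module "modular_units N" "scalars N"
  by (intro tensor_scalars_module.intro tensor_scalars_module_axioms.intro cring_Z_inv)
     (use N in \<open>auto intro: is_modular_unit_mult\<close>)

sublocale U: Z_inv_module "6 * N" "unit_module N"
  by (intro Z_inv_module.intro Z_inv_module_axioms.intro)
     (use N T.module_tensor_scalars in \<open>auto simp: unit_module_def\<close>)

lemmas tensor_closed = T.pure_tensor_closed[folded unit_module_def, unfolded modular_units_simps]
lemmas tensor_mult = T.pure_tensor_mult[folded unit_module_def, unfolded modular_units_simps]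
lemmas tensor_smult = T.pure_tensor_smult[folded unit_module_def, unfolded modular_units_simps Z_inv_simps]

lemma modular_unit_1: "is_modular_unit N (\<lambda>_. 1)"
  using siegel_power_modular_unit[OF N, of "(0, 0)"] by (simp add: siegel_fun_def)

lemma modular_unit_power: "is_modular_unit N f \<Longrightarrow> is_modular_unit N (\<lambda>\<tau>. f \<tau> ^ n)"
  by (induction n) (simp_all add: modular_unit_1 is_modular_unit_mult)

lemma tensor_1: "s \<in> carrier (scalars N) \<Longrightarrow> tensor (\<lambda>_. 1) s = \<zero>\<^bsub>unit_module N\<^esub>"
  using tensor_mult[OF modular_unit_1 modular_unit_1, of s] tensor_closed[OF modular_unit_1, of s]
    U.M.add.l_cancel_one'[of "tensor (\<lambda>_. 1) s" "tensor (\<lambda>_. 1) s"] by simp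

lemma tensor_power:
  assumes "is_modular_unit N f" "s \<in> carrier (scalars N)"
  shows "tensor (\<lambda>\<tau>. f \<tau> ^ n) s = of_nat n \<odot>\<^bsub>unit_module N\<^esub> tensor f s"
proof (induction n)
  case 0
  then show ?case using assms by (simp add: tensor_1 U.smult_zero tensor_closed)
next
  case (Suc n)
  have "tensor (\<lambda>\<tau>. f \<tau> ^ Suc n) s = tensor f s \<oplus>\<^bsub>unit_module N\<^esub> tensor (\<lambda>\<tau>. f \<tau> ^ n) s"
    using tensor_mult[OF assms(1) modular_unit_power[OF assms(1)] assms(2)] by simp
  then show ?case
    unfolding Suc using U.smult_of_nat[OF tensor_closed[OF assms]] tensor_closed[OF assms]
    by (simp add: U.M.a_comm Z_inv_of_int[of "int n", simplified])
qed

lemma siegel_power_unit: "is_modular_unit N (siegel_power (reduce N x))"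
  by (rule siegel_power_modular_unit[OF N]) (simp add: level_zero_reduce del: split_paired_All)

text \<open>12N does not divide 6N, but it divides (6N)^2 = 12N * 3N, which is enough for its
  inverse to be a scalar.\<close>

lemma scalar_12N: "1 / of_nat (12 * N) \<in> carrier (scalars N)" "of_nat (12 * N) \<in> carrier (scalars N)"
  and dvd_12N: "12 * N dvd (6 * N) ^ 2"
proof -
  have "(6 * N) ^ 2 = 12 * N * (3 * N)" by (simp add: power2_eq_square)
  then show "12 * N dvd (6 * N) ^ 2" by (metis dvd_triv_left)
  then show "1 / of_nat (12 * N) \<in> carrier (scalars N)" using N by (intro Z_inv_inverse_of_nat[where n = 2]) auto
  show "of_nat (12 * N) \<in> carrier (scalars N)" using Z_inv_of_int[of "int (12 * N)"] by (simp only: of_int_of_nat_eq)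
qed

lemma siegel_closed: "siegel x \<in> carrier (unit_module N)"
  unfolding siegel_def siegel_unit_def by (rule tensor_closed[OF siegel_power_unit scalar_12N(1)])

text \<open>Multiplication by 12N turns the formal root into an actual modular unit, for which
  identities of functions can be used.\<close>

lemma smult_siegel: "of_nat (12 * N) \<odot>\<^bsub>unit_module N\<^esub> siegel x = tensor (siegel_power (reduce N x)) 1"
  unfolding siegel_def siegel_unit_def tensor_smult[OF siegel_power_unit scalar_12N(2,1), symmetric]
  using N by simp

lemma siegel_uminus: "siegel (- x) = siegel x"
proof (cases "reduce N x = (0, 0)")
  case True
  then have "reduce N (- x) = (0, 0)" by (simp add: level_zero_reduce[symmetric])
  then show ?thesis by (simp only: siegel_def True)
next
  case False
  then have "reduce N (- x) \<noteq> (0, 0)" by (simp add: level_zero_reduce[symmetric])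
  moreover have "level_zero N (reduce N (- x) + reduce N x)"
    by (simp only: level_zero_reduce reduce_simps) (simp add: reduce_def)
  ultimately have "siegel_power (reduce N (- x)) = siegel_power (reduce N x)"
    using False by (intro ext siegel_power_cong_uminus[OF N])
  then show ?thesis by (simp only: siegel_def siegel_unit_def)
qed

lemma siegel_zero: "reduce N x = (0, 0) \<Longrightarrow> siegel x = \<zero>\<^bsub>unit_module N\<^esub>"
  using tensor_1[OF scalar_12N(1)] by (simp add: siegel_def siegel_unit_def siegel_fun_def)

text \<open>This is u(0, q, r, s) = v(s, q) - v(r, q), free of subtractions. After multiplication by
  12N both sides are tensors of functions that agree by \<open>wp_ratio_siegel\<close>, and 12N is
  cancelled.\<close>

lemma u_unit_siegel:
  assumes dist: "distinct_torsion N q r s"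
  shows "u_unit N (0, 0) q r s \<in> carrier (unit_module N)"
    and "u_unit N (0, 0) q r s \<oplus>\<^bsub>unit_module N\<^esub>
        (siegel (r + q) \<oplus>\<^bsub>unit_module N\<^esub> siegel (r - q) \<oplus>\<^bsub>unit_module N\<^esub> (siegel s \<oplus>\<^bsub>unit_module N\<^esub> siegel s))
      = siegel (s + q) \<oplus>\<^bsub>unit_module N\<^esub> siegel (s - q) \<oplus>\<^bsub>unit_module N\<^esub> (siegel r \<oplus>\<^bsub>unit_module N\<^esub> siegel r)"
proof -
  let ?u = "u_fun N (0, 0) q r s" and ?S = "\<lambda>x. siegel_power (reduce N x)"
  have nz: "q \<noteq> (0, 0)" "r \<noteq> (0, 0)" "s \<noteq> (0, 0)"
    using dist by (auto simp: distinct_torsion_def)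
  have u: "?u = (\<lambda>\<tau>. if Im \<tau> > 0 then wp_ratio N q r s \<tau> else 1)"
    by (rule ext) (rule u_fun_wp_ratio[OF nz])
  have unit: "is_modular_unit N ?u" unfolding u by (rule wp_ratio_modular_unit[OF N dist])
  have 1: "1 \<in> carrier (scalars N)" by (rule Z_inv_constants)
  show uc: "u_unit N (0, 0) q r s \<in> carrier (unit_module N)"
    unfolding u_unit_def by (rule tensor_closed[OF unit 1])
  have rel: "?u \<tau> ^ (12 * N) * (?S (r + q) \<tau> * ?S (r - q) \<tau> * (?S s \<tau> * ?S s \<tau>)) = ?S (s + q) \<tau> * ?S (s - q) \<tau> * (?S r \<tau> * ?S r \<tau>)" for \<tau>
  proof (cases "Im \<tau> > 0")
    case True
    have "reduce N x \<noteq> (0, 0) \<and> level_zero N (reduce N x - x)" if "\<not> level_zero N x" for x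
      using that iffD2[OF level_zero_diff[of N "reduce N x" x] reduce_simps(1)] unfolding level_zero_reduce by blast
    then have "wp_ratio N q r s \<tau> ^ (12 * N) * (?S (r + q) \<tau> * ?S (r - q) \<tau> * (?S s \<tau> * ?S s \<tau>)) = ?S (s + q) \<tau> * ?S (s - q) \<tau> * (?S r \<tau> * ?S r \<tau>)"
      by (rule wp_ratio_siegel[OF N True dist])
    then show ?thesis using True by (simp only: u if_True)
  qed (simp add: u siegel_fun_def)
  have smult_add: "of_nat (12 * N) \<odot>\<^bsub>unit_module N\<^esub> (x \<oplus>\<^bsub>unit_module N\<^esub> y)
      = of_nat (12 * N) \<odot>\<^bsub>unit_module N\<^esub> x \<oplus>\<^bsub>unit_module N\<^esub> of_nat (12 * N) \<odot>\<^bsub>unit_module N\<^esub> y"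
    if "x \<in> carrier (unit_module N)" "y \<in> carrier (unit_module N)" for x y
    by (rule U.smult_r_distr[OF scalar_12N(2) that])
  have smult_u: "of_nat (12 * N) \<odot>\<^bsub>unit_module N\<^esub> u_unit N (0, 0) q r s = tensor (\<lambda>\<tau>. ?u \<tau> ^ (12 * N)) 1"
    unfolding u_unit_def by (rule tensor_power[OF unit 1, symmetric])
  note closed = siegel_closed uc U.M.add.m_closed
  note units = siegel_power_unit is_modular_unit_mult modular_unit_power[OF unit]
  show "u_unit N (0, 0) q r s \<oplus>\<^bsub>unit_module N\<^esub>
        (siegel (r + q) \<oplus>\<^bsub>unit_module N\<^esub> siegel (r - q) \<oplus>\<^bsub>unit_module N\<^esub> (siegel s \<oplus>\<^bsub>unit_module N\<^esub> siegel s))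
      = siegel (s + q) \<oplus>\<^bsub>unit_module N\<^esub> siegel (s - q) \<oplus>\<^bsub>unit_module N\<^esub> (siegel r \<oplus>\<^bsub>unit_module N\<^esub> siegel r)"
  proof (rule U.smult_cancel[OF dvd_12N])
    show "of_nat (12 * N) \<odot>\<^bsub>unit_module N\<^esub> (u_unit N (0, 0) q r s \<oplus>\<^bsub>unit_module N\<^esub>
        (siegel (r + q) \<oplus>\<^bsub>unit_module N\<^esub> siegel (r - q) \<oplus>\<^bsub>unit_module N\<^esub> (siegel s \<oplus>\<^bsub>unit_module N\<^esub> siegel s)))
      = of_nat (12 * N) \<odot>\<^bsub>unit_module N\<^esub>
        (siegel (s + q) \<oplus>\<^bsub>unit_module N\<^esub> siegel (s - q) \<oplus>\<^bsub>unit_module N\<^esub> (siegel r \<oplus>\<^bsub>unit_module N\<^esub> siegel r))"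
      by (simp only: smult_add closed smult_siegel smult_u tensor_mult[symmetric] units 1 rel)
  qed (intro closed)+
qed

text \<open>The coefficients of \<open>g\<^sub>z\<close> in terms of the family of all Siegel units, symmetrised so that
  \<open>g\<^sub>-\<^sub>z = g\<^sub>z\<close> and \<open>g\<^sub>0 = 0\<close> are visible in the coefficients.\<close>

definition siegel_coeff :: "int \<times> int \<Rightarrow> int \<times> int \<Rightarrow> rat" where
  "siegel_coeff z x = (if reduce N z = (0, 0) then 0
     else (if x = reduce N z then 1 / 2 else 0) + (if x = reduce N (- z) then 1 / 2 else 0))"

lemma half_scalar: "1 / 2 \<in> carrier (scalars N)"
  using Z_inv_inverse_of_nat[of "6 * N" 2 1] N by simp

lemma siegel_coeff_closed: "siegel_coeff z x \<in> carrier (scalars N)"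
  using N by (auto simp: siegel_coeff_def intro!: Z_inv_add half_scalar Z_inv_constants)

lemma siegel_coeff_simps:
  "siegel_coeff (reduce N z) x = siegel_coeff z x"
  "siegel_coeff (- z) x = siegel_coeff z x"
  "siegel_coeff 0 x = 0"
proof -
  have "reduce N (- z) = (0, 0) \<longleftrightarrow> reduce N z = (0, 0)" by (simp add: level_zero_reduce[symmetric])
  then show "siegel_coeff (- z) x = siegel_coeff z x"
    by (simp only: siegel_coeff_def minus_minus add.commute)
qed (simp_all add: siegel_coeff_def reduce_def[of _ 0])

end

section \<open>Coefficients of units and wedges over the subgroup\<close>

locale siegel_subgroup = modular_unit_module N + torsion_subgroup N \<Gamma> for N \<Gamma>
begin

sublocale W: Z_inv_wedge "6 * N" "unit_module N" \<Gamma> "siegel_unit N"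
proof (intro Z_inv_wedge.intro U.Z_inv_module_axioms Z_inv_wedge_axioms.intro)
  show "siegel_unit N \<in> \<Gamma> \<rightarrow> carrier (unit_module N)"
    using siegel_closed reduced by (metis Pi_I siegel_def)
qed simp_all

abbreviation comb :: "(int \<times> int \<Rightarrow> rat) \<Rightarrow> unit_tensor" where
  "comb \<equiv> U.lincomb \<Gamma> (siegel_unit N)"

text \<open>Half of g_z plus half of g_{-z} is g_z by evenness; if z and - z agree modulo N, both
  halves fall on the same index and add up to 1.\<close>

lemma comb_siegel_coeff:
  assumes "z \<in> points"
  shows "comb (siegel_coeff z) = siegel z"
proof (cases "reduce N z = (0, 0)")
  case True
  then have "siegel_coeff z = (\<lambda>_. 0)" by (simp add: siegel_coeff_def fun_eq_iff del: split_paired_All)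
  then show ?thesis using siegel_zero[OF True] U.lincomb_zero[OF W.g_closed] by simp
next
  case False
  define h :: rat where "h = 1 / 2"
  have h: "h \<in> carrier (scalars N)" unfolding h_def by (rule half_scalar)
  have mem: "reduce N z \<in> \<Gamma>" "reduce N (- z) \<in> \<Gamma>"
    using assms points_uminus[OF assms] by (simp_all add: points_def)
  have "siegel_coeff z = (\<lambda>x. (if x = reduce N z then h else 0) + (if x = reduce N (- z) then h else 0))"
    using False by (simp add: siegel_coeff_def fun_eq_iff h_def del: split_paired_All)
  then have "comb (siegel_coeff z) = comb (\<lambda>x. if x = reduce N z then h else 0) \<oplus>\<^bsub>unit_module N\<^esub> comb (\<lambda>x. if x = reduce N (- z) then h else 0)"
    using h by (simp only:) (intro U.lincomb_add W.g_closed; auto intro: Z_inv_constants)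
  also have "\<dots> = h \<odot>\<^bsub>unit_module N\<^esub> siegel z \<oplus>\<^bsub>unit_module N\<^esub> h \<odot>\<^bsub>unit_module N\<^esub> siegel (- z)"
    unfolding U.lincomb_single[OF finite_\<Gamma> mem(1) h W.g_closed] U.lincomb_single[OF finite_\<Gamma> mem(2) h W.g_closed]
    by (simp only: siegel_def)
  also have "\<dots> = siegel z"
    using U.smult_l_distr[OF h h siegel_closed[of z]] U.smult_1[OF siegel_closed[of z]]
    by (simp add: siegel_uminus h_def)
  finally show ?thesis .
qed

text \<open>The coefficients of v(s, q) - v(r, q), in which the terms at q itself have
  cancelled.\<close>

definition u_coeff :: "int \<times> int \<Rightarrow> int \<times> int \<Rightarrow> int \<times> int \<Rightarrow> int \<times> int \<Rightarrow> rat" where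
  "u_coeff q r s x = (siegel_coeff (s + q) x + siegel_coeff (s - q) x + (siegel_coeff r x + siegel_coeff r x))
     - (siegel_coeff (r + q) x + siegel_coeff (r - q) x + (siegel_coeff s x + siegel_coeff s x))"

lemma siegel_coeffs: "range (siegel_coeff z) \<subseteq> carrier (scalars N)"
  by (intro image_subsetI siegel_coeff_closed)

lemma coeffs_add:
  "range f \<subseteq> carrier (scalars N) \<Longrightarrow> range h \<subseteq> carrier (scalars N) \<Longrightarrow> range (\<lambda>x. f x + h x) \<subseteq> carrier (scalars N)"
  using N by (auto intro!: Z_inv_add)

lemma coeffs_diff:
  "range f \<subseteq> carrier (scalars N) \<Longrightarrow> range h \<subseteq> carrier (scalars N) \<Longrightarrow> range (\<lambda>x. f x - h x) \<subseteq> carrier (scalars N)"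
  using N by (auto intro!: Z_inv_diff)

lemma u_coeffs: "range (u_coeff q r s) \<subseteq> carrier (scalars N)"
  unfolding u_coeff_def[abs_def] by (intro coeffs_diff coeffs_add siegel_coeffs)

lemma u_unit_comb:
  assumes "q \<in> points" "r \<in> points" "s \<in> points" and dist: "distinct_torsion N q r s"
  shows "u_unit N (0, 0) q r s = comb (u_coeff q r s)"
proof -
  \<comment> \<open>One side of the additive relation in \<open>u_unit_siegel\<close>; exchanging
    the outer arguments gives the other, and the difference is recovered by cancellation.\<close>
  define A where "A s q r x = siegel_coeff (s + q) x + siegel_coeff (s - q) x + (siegel_coeff r x + siegel_coeff r x)" for s q r x
  have A: "range (A s q r) \<subseteq> carrier (scalars N)" for s q r
    unfolding A_def by (intro coeffs_add siegel_coeffs)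
  have comb_A: "comb (A s q r) = siegel (s + q) \<oplus>\<^bsub>unit_module N\<^esub> siegel (s - q) \<oplus>\<^bsub>unit_module N\<^esub> (siegel r \<oplus>\<^bsub>unit_module N\<^esub> siegel r)"
    if "s \<in> points" "q \<in> points" "r \<in> points" for s q r
    unfolding A_def using points_add points_diff that
    by (simp only: U.lincomb_add coeffs_add siegel_coeffs W.g_closed comb_siegel_coeff)
  have "A s q r = (\<lambda>x. u_coeff q r s x + A r q s x)"
    by (rule ext) (simp add: u_coeff_def A_def)
  then have "comb (A s q r) = comb (\<lambda>x. u_coeff q r s x + A r q s x)" by (simp only:)
  also have "\<dots> = comb (u_coeff q r s) \<oplus>\<^bsub>unit_module N\<^esub> comb (A r q s)"
    by (intro U.lincomb_add u_coeffs A W.g_closed)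
  finally have "u_unit N (0, 0) q r s \<oplus>\<^bsub>unit_module N\<^esub> comb (A r q s) = comb (u_coeff q r s) \<oplus>\<^bsub>unit_module N\<^esub> comb (A r q s)"
    using u_unit_siegel(2)[OF dist] comb_A assms(1-3) by simp
  then show ?thesis
    using u_unit_siegel(1)[OF dist] U.lincomb_closed[OF u_coeffs W.g_closed] U.lincomb_closed[OF A W.g_closed]
    by (simp only: U.M.add.right_cancel)
qed

definition degenerate :: "int \<times> int \<Rightarrow> int \<times> int \<Rightarrow> int \<times> int \<Rightarrow> bool" where
  "degenerate q r s \<longleftrightarrow> reduce N q = 0 \<or> reduce N r = 0 \<or> reduce N s = 0 \<or> reduce N q = reduce N r \<or> reduce N q = reduce N (- r)
    \<or> reduce N q = reduce N s \<or> reduce N q = reduce N (- s) \<or> reduce N r = reduce N s \<or> reduce N r = reduce N (- s)"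

definition delta_coeff :: "int \<times> int \<Rightarrow> int \<times> int \<Rightarrow> int \<times> int \<Rightarrow> int \<times> int \<Rightarrow> int \<times> int \<Rightarrow> rat" where
  "delta_coeff q r s x y = (if degenerate q r s then 0 else u_coeff q r s x * u_coeff r q s y)"

lemma level_zero_add: "level_zero N (x + y) \<longleftrightarrow> reduce N x = reduce N (- y)"
  using level_zero_diff[of N x "- y"] by (simp only: diff_minus_eq_add)

lemma distinct_torsion_degenerate:
  assumes "\<not> degenerate q r s"
  shows "distinct_torsion N q r s" and "distinct_torsion N r q s"
proof -
  have "reduce N q \<noteq> 0" "reduce N r \<noteq> 0" "reduce N s \<noteq> 0"
    and pm: "reduce N q \<noteq> reduce N r" "reduce N q \<noteq> reduce N (- r)" "reduce N q \<noteq> reduce N s" "reduce N q \<noteq> reduce N (- s)"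
      "reduce N r \<noteq> reduce N s" "reduce N r \<noteq> reduce N (- s)"
    using assms unfolding degenerate_def by blast+
  then have nz: "\<not> level_zero N q" "\<not> level_zero N r" "\<not> level_zero N s"
    by (simp_all only: level_zero_reduce zero_prod_def simp_thms)
  have plus: "\<not> level_zero N (q + r)" "\<not> level_zero N (q + s)" "\<not> level_zero N (r + s)"
    unfolding level_zero_add by (rule pm)+
  have minus: "\<not> level_zero N (q - r)" "\<not> level_zero N (r - q)" "\<not> level_zero N (s - q)" "\<not> level_zero N (s - r)"
    unfolding level_zero_diff by (rule pm pm[symmetric])+
  show "distinct_torsion N q r s"
    unfolding distinct_torsion_def ball_simps add.commute[of r q] add.commute[of s q]
    by (intro conjI TrueI nz plus minus)
  show "distinct_torsion N r q s"
    unfolding distinct_torsion_def ball_simps add.commute[of s r]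
    by (intro conjI TrueI nz plus minus)
qed

lemma alternating_form_siegel_coeff: "alternating_form N \<Gamma> (\<lambda>z. siegel_coeff z x) (\<lambda>z. siegel_coeff z y)"
  by unfold_locales (simp_all add: periodic_def siegel_coeff_simps del: split_paired_All)

text \<open>The bridge to the numerical identity: for fixed indices x and y, the two coordinate
  functionals form an alternating form. In the degenerate case the left side is 0 by definition and
  the right side by \<open>\<delta>_degenerate\<close>.\<close>

lemma delta_coeff_antisymmetric:
  "delta_coeff q r s x y - delta_coeff q r s y x = alternating_form.\<delta> (\<lambda>z. siegel_coeff z x) (\<lambda>z. siegel_coeff z y) q r s"
proof -
  interpret A: alternating_form N \<Gamma> "\<lambda>z. siegel_coeff z x" "\<lambda>z. siegel_coeff z y"
    by (rule alternating_form_siegel_coeff)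
  have u: "A.v (\<lambda>z. siegel_coeff z x') s q - A.v (\<lambda>z. siegel_coeff z x') r q = u_coeff q r s x'" for q r s x'
    by (simp add: A.v_def u_coeff_def)
  show ?thesis
  proof (cases "degenerate q r s")
    case True
    then show ?thesis using A.\<delta>_degenerate[of q r s] by (simp add: delta_coeff_def degenerate_def)
  next
    case False
    then show ?thesis unfolding A.\<delta>_def u by (simp add: delta_coeff_def mult.commute)
  qed
qed

text \<open>The distinctness test on classes modulo sign is matched with \<open>degenerate\<close>;
  in the remaining case both cross-ratios are combinations of Siegel units, so their wedge has
  product coefficients.\<close>

lemma represents_delta:
  assumes mem: "q \<in> \<Gamma>" "r \<in> \<Gamma>" "s \<in> \<Gamma>"
    and inv: "\<And>x. x \<in> \<Gamma> \<Longrightarrow> inv\<^bsub>ZN2 N\<^esub> x = reduce N (- x)"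
  shows "W.represents (delta N (0, 0) q r s) (delta_coeff q r s)"
proof -
  have red: "reduce N q = q" "reduce N r = r" "reduce N s = s" "reduce N (0, 0) = (0, 0)"
    using mem reduced by (simp_all add: reduce_def)
  have pm: "pm_class N x = pm_class N y \<longleftrightarrow> reduce N x = reduce N y \<or> reduce N x = reduce N (- y)" if "x \<in> \<Gamma>" "y \<in> \<Gamma>" for x y
  proof -
    have flip: "y = reduce N (- x)" if "x = reduce N (- y)"
      unfolding that reduce_simps minus_minus by (rule reduced[OF \<open>y \<in> \<Gamma>\<close>, symmetric])
    have swap: "{a, b} = {c, d}" if "a = d" "c = b" for a b c d :: "int \<times> int" using that by blast
    show ?thesis
      unfolding pm_class_def inv[OF that(1)] inv[OF that(2)] reduced[OF that(1)] reduced[OF that(2)]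
    proof
      assume "{x, reduce N (- x)} = {y, reduce N (- y)}"
      then show "x = y \<or> x = reduce N (- y)" by blast
    next
      assume "x = y \<or> x = reduce N (- y)"
      then show "{x, reduce N (- x)} = {y, reduce N (- y)}"
      proof
        assume "x = reduce N (- y)"
        then show ?thesis by (intro swap[of x "reduce N (- y)" y "reduce N (- x)"] flip)
      qed simp
    qed
  qed
  have zero: "(0, 0) \<in> \<Gamma>" using zero_\<Gamma> by (simp add: zero_prod_def)
  have "reduce N (- x) = (0, 0) \<longleftrightarrow> reduce N x = (0, 0)" for x
    by (simp add: level_zero_reduce[symmetric])
  then have pm0: "pm_class N (0, 0) = pm_class N x \<longleftrightarrow> reduce N x = 0" if "x \<in> \<Gamma>" for x
    unfolding pm[OF zero that] red(4) zero_prod_def by metis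
  have distinct: "distinct [pm_class N (0, 0), pm_class N q, pm_class N r, pm_class N s] \<longleftrightarrow> \<not> degenerate q r s"
    unfolding degenerate_def
    by (simp only: distinct.simps list.set insert_iff empty_iff pm0[OF mem(1)] pm0[OF mem(2)] pm0[OF mem(3)]
        pm[OF mem(1,2)] pm[OF mem(1,3)] pm[OF mem(2,3)]) blast
  have pts: "q \<in> points" "r \<in> points" "s \<in> points" using mem \<Gamma>_points by blast+
  show ?thesis
  proof (cases "degenerate q r s")
    case True
    then have "delta_coeff q r s = (\<lambda>_ _. 0)" by (simp add: delta_coeff_def fun_eq_iff)
    then show ?thesis
      using True W.represents_zero unfolding delta_def distinct by (simp add: Lambda2_def)
  next
    case False
    then have "delta_coeff q r s = (\<lambda>x y. u_coeff q r s x * u_coeff r q s y)" by (simp add: delta_coeff_def fun_eq_iff)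
    then show ?thesis
      using False W.represents_wedge[OF u_coeffs u_coeffs]
        u_unit_comb[OF pts distinct_torsion_degenerate(1)[OF False]]
        u_unit_comb[OF pts(2,1,3) distinct_torsion_degenerate(2)[OF False]]
      unfolding delta_def distinct unit_wedge_def by simp
  qed
qed

text \<open>Each side is represented by an explicit coefficient function, and the antisymmetric
  parts at every index pair agree by the numerical identity. Divisibility of N^2 by the group order
  makes the two scalar factors available in the ring.\<close>

lemma three_siegel_units:
  assumes mem: "a \<in> \<Gamma>" "b \<in> \<Gamma>" "c \<in> \<Gamma>" and c: "c = reduce N (- (a + b))"
    and inv: "\<And>x. x \<in> \<Gamma> \<Longrightarrow> inv\<^bsub>ZN2 N\<^esub> x = reduce N (- x)"
    and card: "card \<Gamma> dvd N ^ 2"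
  defines "sum_wedge \<equiv> unit_wedge N (siegel_unit N a) (siegel_unit N b)
       \<oplus>\<^bsub>Lambda2 N\<^esub> unit_wedge N (siegel_unit N b) (siegel_unit N c)
       \<oplus>\<^bsub>Lambda2 N\<^esub> unit_wedge N (siegel_unit N c) (siegel_unit N a)"
    and "first_sum \<equiv> (1 / of_nat (card \<Gamma>)) \<odot>\<^bsub>Lambda2 N\<^esub>
          (\<Oplus>\<^bsub>Lambda2 N\<^esub> x \<in> \<Gamma>. delta N (0, 0) x (reduce N (a - x)) (reduce N (b + x)))"
  shows "sum_wedge = first_sum \<oplus>\<^bsub>Lambda2 N\<^esub>
       ((1 / (4 * of_nat (card \<Gamma>) ^ 2)) \<odot>\<^bsub>Lambda2 N\<^esub>
          (\<Oplus>\<^bsub>Lambda2 N\<^esub> x \<in> \<Gamma>. \<Oplus>\<^bsub>Lambda2 N\<^esub> y \<in> \<Gamma>.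
             delta N (0, 0) a (reduce N (b + (x + x))) y
             \<ominus>\<^bsub>Lambda2 N\<^esub> delta N (0, 0) b (reduce N (a + (x + x))) y
             \<ominus>\<^bsub>Lambda2 N\<^esub> delta N (0, 0) (reduce N (a + b)) (reduce N (b + (x + x))) y))"
    and "(\<And>x. x \<in> \<Gamma> \<Longrightarrow> reduce N (x + x) = 0 \<Longrightarrow> x = 0) \<Longrightarrow> sum_wedge = first_sum"
proof -
  let ?E = siegel_coeff and ?n = "of_nat (card \<Gamma>) :: rat"
  have pts: "a \<in> points" "b \<in> points" using mem \<Gamma>_points by blast+
  have mem_reduce: "reduce N (a - x) \<in> \<Gamma>" "reduce N (b + x) \<in> \<Gamma>" "reduce N (a + b) \<in> \<Gamma>"
    "reduce N (b + (x + x)) \<in> \<Gamma>" "reduce N (a + (x + x)) \<in> \<Gamma>" if "x \<in> \<Gamma>" for x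
    using pts \<Gamma>_points[OF that] points_add points_diff unfolding points_def[symmetric] mem_Collect_eq
    by (auto simp: points_def del: simp_thms)
  have unit: "siegel_unit N z = comb (?E z)" if "z \<in> \<Gamma>" for z
    using comb_siegel_coeff[OF \<Gamma>_points[OF that]] reduced[OF that] by (simp add: siegel_def)
  have wedge: "W.represents (unit_wedge N (siegel_unit N z) (siegel_unit N z')) (\<lambda>x y. ?E z x * ?E z' y)"
    if "z \<in> \<Gamma>" "z' \<in> \<Gamma>" for z z'
    unfolding unit_wedge_def unit[OF that(1)] unit[OF that(2)] by (rule W.represents_wedge[OF siegel_coeffs siegel_coeffs])
  have lhs: "W.represents sum_wedge (\<lambda>x y. ?E a x * ?E b y + ?E b x * ?E c y + ?E c x * ?E a y)"
    unfolding sum_wedge_def Lambda2_def by (intro W.represents_add wedge mem)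
  \<comment> \<open>(6N)^4 is 1296 times the square of N^2, and 4 divides 1296.\<close>
  have "4 * card \<Gamma> ^ 2 dvd (6 * N) ^ 4"
  proof -
    have "4 * card \<Gamma> ^ 2 dvd 1296 * (N ^ 2) ^ 2" by (intro mult_dvd_mono dvd_power_same card) simp
    then show ?thesis by (simp add: power_mult_distrib flip: power_mult)
  qed
  from Z_inv_inverse_of_nat[OF U.m_pos this] have scalar2: "1 / (4 * ?n ^ 2) \<in> carrier (scalars N)" by simp
  have "card \<Gamma> dvd (6 * N) ^ 2"
    using card by (simp add: power_mult_distrib dvd_mult)
  then have scalar1: "1 / ?n \<in> carrier (scalars N)" by (rule Z_inv_inverse_of_nat[OF U.m_pos])
  have rhs1: "W.represents first_sum (\<lambda>x y. 1 / ?n * (\<Sum>z\<in>\<Gamma>. delta_coeff z (reduce N (a - z)) (reduce N (b + z)) x y))"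
    unfolding first_sum_def Lambda2_def
    by (intro W.represents_smult W.represents_finsum scalar1 finite_\<Gamma> represents_delta inv mem_reduce)
  let ?D = "\<lambda>z z'. delta N (0, 0) a (reduce N (b + (z + z))) z'
             \<ominus>\<^bsub>Lambda2 N\<^esub> delta N (0, 0) b (reduce N (a + (z + z))) z'
             \<ominus>\<^bsub>Lambda2 N\<^esub> delta N (0, 0) (reduce N (a + b)) (reduce N (b + (z + z))) z'"
  have rhs2: "W.represents ((1 / (4 * ?n ^ 2)) \<odot>\<^bsub>Lambda2 N\<^esub> (\<Oplus>\<^bsub>Lambda2 N\<^esub> z \<in> \<Gamma>. \<Oplus>\<^bsub>Lambda2 N\<^esub> z' \<in> \<Gamma>. ?D z z'))
      (\<lambda>x y. 1 / (4 * ?n ^ 2) * (\<Sum>z\<in>\<Gamma>. \<Sum>z'\<in>\<Gamma>. delta_coeff a (reduce N (b + (z + z))) z' x y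
          - delta_coeff b (reduce N (a + (z + z))) z' x y - delta_coeff (reduce N (a + b)) (reduce N (b + (z + z))) z' x y))"
    unfolding Lambda2_def
    by (intro W.represents_smult W.represents_finsum W.represents_minus scalar2 finite_\<Gamma> represents_delta inv mem mem_reduce)
  have w: "?E a x * ?E b y + ?E b x * ?E c y + ?E c x * ?E a y - (?E a y * ?E b x + ?E b y * ?E c x + ?E c y * ?E a x)
      = alternating_form.w (\<lambda>z. ?E z x) (\<lambda>z. ?E z y) a b + alternating_form.w (\<lambda>z. ?E z x) (\<lambda>z. ?E z y) b (a + b)
        + alternating_form.w (\<lambda>z. ?E z x) (\<lambda>z. ?E z y) (a + b) a" for x y
  proof -
    interpret A: alternating_form N \<Gamma> "\<lambda>z. ?E z x" "\<lambda>z. ?E z y" by (rule alternating_form_siegel_coeff)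
    \<comment> \<open>The point c is the negative of a + b modulo N, and the coefficients are even
      and periodic.\<close>
    have "?E c t = ?E (a + b) t" for t unfolding c siegel_coeff_simps by (rule refl)
    then show ?thesis unfolding A.w_def by simp
  qed
  have d: "alternating_form.\<delta> (\<lambda>z. ?E z x) (\<lambda>z. ?E z y) q r s
      = delta_coeff (reduce N q) (reduce N r) (reduce N s) x y - delta_coeff (reduce N q) (reduce N r) (reduce N s) y x" for x y q r s
    unfolding delta_coeff_antisymmetric
    by (rule alternating_form.\<delta>_reduce[OF alternating_form_siegel_coeff, symmetric])
  have d1: "(\<Sum>z\<in>\<Gamma>. alternating_form.\<delta> (\<lambda>z. ?E z x) (\<lambda>z. ?E z y) z (a - z) (b + z))
      = (\<Sum>z\<in>\<Gamma>. delta_coeff z (reduce N (a - z)) (reduce N (b + z)) x y)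
        - (\<Sum>z\<in>\<Gamma>. delta_coeff z (reduce N (a - z)) (reduce N (b + z)) y x)" for x y
    unfolding d sum_subtractf[symmetric] by (intro sum.cong refl) (simp only: reduced)
  show "sum_wedge = first_sum \<oplus>\<^bsub>Lambda2 N\<^esub> ((1 / (4 * ?n ^ 2)) \<odot>\<^bsub>Lambda2 N\<^esub> (\<Oplus>\<^bsub>Lambda2 N\<^esub> z \<in> \<Gamma>. \<Oplus>\<^bsub>Lambda2 N\<^esub> z' \<in> \<Gamma>. ?D z z'))"
  proof (rule W.represents_eqI[OF lhs W.represents_add[OF rhs1 rhs2, folded Lambda2_def]])
    fix x y
    let ?\<delta> = "alternating_form.\<delta> (\<lambda>z. ?E z x) (\<lambda>z. ?E z y)"
    let ?F = "\<lambda>x y. \<Sum>z\<in>\<Gamma>. \<Sum>z'\<in>\<Gamma>. delta_coeff a (reduce N (b + (z + z))) z' x y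
          - delta_coeff b (reduce N (a + (z + z))) z' x y - delta_coeff (reduce N (a + b)) (reduce N (b + (z + z))) z' x y"
    have "(\<Sum>z\<in>\<Gamma>. \<Sum>z'\<in>\<Gamma>. ?\<delta> a (b + (z + z)) z' - ?\<delta> b (a + (z + z)) z' - ?\<delta> (a + b) (b + (z + z)) z') = ?F x y - ?F y x"
      unfolding d sum_subtractf[symmetric] by (intro sum.cong refl) (simp add: reduced mem del: reduce_simps split_paired_All)
    then show "?E a x * ?E b y + ?E b x * ?E c y + ?E c x * ?E a y - (?E a y * ?E b x + ?E b y * ?E c x + ?E c y * ?E a x)
      = (1 / ?n * (\<Sum>z\<in>\<Gamma>. delta_coeff z (reduce N (a - z)) (reduce N (b + z)) x y) + 1 / (4 * ?n ^ 2) * ?F x y)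
        - (1 / ?n * (\<Sum>z\<in>\<Gamma>. delta_coeff z (reduce N (a - z)) (reduce N (b + z)) y x) + 1 / (4 * ?n ^ 2) * ?F y x)"
      unfolding w alternating_form.three_term_identity[OF alternating_form_siegel_coeff pts] d1
      by (simp only: right_diff_distrib)
  qed
  assume odd: "\<And>x. x \<in> \<Gamma> \<Longrightarrow> reduce N (x + x) = 0 \<Longrightarrow> x = 0"
  show "sum_wedge = first_sum"
  proof (rule W.represents_eqI[OF lhs rhs1])
    fix x y
    show "?E a x * ?E b y + ?E b x * ?E c y + ?E c x * ?E a y - (?E a y * ?E b x + ?E b y * ?E c x + ?E c y * ?E a x)
      = 1 / ?n * (\<Sum>z\<in>\<Gamma>. delta_coeff z (reduce N (a - z)) (reduce N (b + z)) x y)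
        - 1 / ?n * (\<Sum>z\<in>\<Gamma>. delta_coeff z (reduce N (a - z)) (reduce N (b + z)) y x)"
      unfolding w right_diff_distrib[symmetric] d1[symmetric]
      by (rule alternating_form.three_term_identity_odd[OF alternating_form_siegel_coeff pts]) (rule odd)
  qed
qed

end

section \<open>The group of torsion points in reduced representatives\<close>

lemma group_ZN2: "group (ZN2 N)"
  unfolding ZN2_def by (intro DirProd_group group_integer_mod_group)

lemma ZN2_mult: "x \<otimes>\<^bsub>ZN2 N\<^esub> y = reduce N (x + y)"
  by (cases x; cases y) (simp add: ZN2_def reduce_def)

lemma ZN2_one: "\<one>\<^bsub>ZN2 N\<^esub> = (0, 0)"
  by (simp add: ZN2_def)

lemma ZN2_carrier:
  assumes "N \<ge> 1"
  shows "carrier (ZN2 N) = {0..<int N} \<times> {0..<int N}"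
    and "x \<in> carrier (ZN2 N) \<Longrightarrow> reduce N x = x"
  using assms by (auto simp: ZN2_def carrier_integer_mod_group reduce_def)

lemma ZN2_inv:
  assumes "N \<ge> 1" "x \<in> carrier (ZN2 N)"
  shows "inv\<^bsub>ZN2 N\<^esub> x = reduce N (- x)"
proof (rule group.inv_equality[OF group_ZN2 _ assms(2)])
  show "reduce N (- x) \<in> carrier (ZN2 N)"
    using assms(1) by (simp add: ZN2_carrier(1) reduce_def)
  show "reduce N (- x) \<otimes>\<^bsub>ZN2 N\<^esub> x = \<one>\<^bsub>ZN2 N\<^esub>"
    by (simp add: ZN2_mult ZN2_one) (simp add: reduce_def)
qed

lemma ZN2_square: "x [^]\<^bsub>ZN2 N\<^esub> (2::nat) = reduce N (x + x)"
proof -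
  interpret group "ZN2 N" by (rule group_ZN2)
  have "x [^]\<^bsub>ZN2 N\<^esub> Suc (Suc 0) = reduce N (reduce N (reduce N (0, 0) + x) + x)"
    unfolding nat_pow_Suc nat_pow_0 ZN2_mult ZN2_one by (simp add: reduce_def)
  also have "\<dots> = reduce N (x + x)" by (simp add: reduce_def mod_simps)
  finally show ?thesis by (simp only: numeral_2_eq_2)
qed

lemma card_subgroup_ZN2:
  assumes "N \<ge> 1" "subgroup G (ZN2 N)"
  shows "card G dvd N ^ 2"
proof -
  have "Coset.order (ZN2 N) = N ^ 2"
    by (simp add: Coset.order_def ZN2_carrier(1)[OF assms(1)] power2_eq_square)
  then show ?thesis using group.lagrange[OF group_ZN2 assms(2)] by (metis dvd_triv_right)
qed

lemma (in group) odd_order_square_eq_one: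
  assumes H: "subgroup H G" "odd (card H)" and x: "x \<in> H" "x [^] (2::nat) = \<one>"
  shows "x = \<one>"
proof -
  interpret H: group "G\<lparr>carrier := H\<rparr>" by (rule subgroup.subgroup_is_group[OF H(1) group_axioms])
  have xG: "x \<in> carrier G" using subgroup.mem_carrier[OF H(1) x(1)] .
  obtain k where k: "card H = 2 * k + 1" using H(2) by (elim oddE)
  have "x [^] card H = \<one>"
    using H.pow_order_eq_1[of x] x(1) nat_pow_consistent[of x "card H" H] by (simp add: Coset.order_def)
  moreover have "x [^] (2 * k + 1) = (x [^] (2::nat)) [^] k \<otimes> x"
    using xG by (simp add: nat_pow_pow)
  ultimately show ?thesis using xG x(2) k by simp
qed

lemma torsion_subgroup_ZN2:
  assumes N: "N \<ge> 1" and G: "subgroup G (ZN2 N)"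
  shows "torsion_subgroup N G"
proof
  show "finite G"
    using subgroup.subset[OF G] finite_subset by (auto simp: ZN2_carrier(1)[OF N])
  show "0 \<in> G" using subgroup.one_closed[OF G] by (simp add: ZN2_one zero_prod_def)
  show "reduce N x = x" if "x \<in> G" for x by (rule ZN2_carrier(2)[OF N subgroup.mem_carrier[OF G that]])
  show "reduce N (x - y) \<in> G" if "x \<in> G" "y \<in> G" for x y
    using subgroup.m_closed[OF G that(1) subgroup.m_inv_closed[OF G that(2)]]
    unfolding ZN2_mult ZN2_inv[OF N subgroup.mem_carrier[OF G that(2)]] by simp
qed

theorem theorem4p3:
  fixes N :: nat and G :: "(int \<times> int) set" and a b c :: "int \<times> int"
  assumes "N \<ge> 1"
    and "subgroup G (ZN2 N)"
    and "a \<in> G" and "b \<in> G" and "c \<in> G"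
    and "a \<otimes>\<^bsub>ZN2 N\<^esub> b \<otimes>\<^bsub>ZN2 N\<^esub> c = \<one>\<^bsub>ZN2 N\<^esub>"
  shows
    "(unit_wedge N (siegel_unit N a) (siegel_unit N b)
       \<oplus>\<^bsub>Lambda2 N\<^esub> unit_wedge N (siegel_unit N b) (siegel_unit N c)
       \<oplus>\<^bsub>Lambda2 N\<^esub> unit_wedge N (siegel_unit N c) (siegel_unit N a)
     = ((1 / of_nat (card G)) \<odot>\<^bsub>Lambda2 N\<^esub>
          (\<Oplus>\<^bsub>Lambda2 N\<^esub> x \<in> G.
             delta N \<one>\<^bsub>ZN2 N\<^esub> x (a \<otimes>\<^bsub>ZN2 N\<^esub> inv\<^bsub>ZN2 N\<^esub> x) (b \<otimes>\<^bsub>ZN2 N\<^esub> x)))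
       \<oplus>\<^bsub>Lambda2 N\<^esub>
       ((1 / (4 * of_nat (card G) ^ 2)) \<odot>\<^bsub>Lambda2 N\<^esub>
          (\<Oplus>\<^bsub>Lambda2 N\<^esub> x \<in> G. \<Oplus>\<^bsub>Lambda2 N\<^esub> y \<in> G.
             delta N \<one>\<^bsub>ZN2 N\<^esub> a (b \<otimes>\<^bsub>ZN2 N\<^esub> x [^]\<^bsub>ZN2 N\<^esub> (2 :: nat)) y
             \<ominus>\<^bsub>Lambda2 N\<^esub> delta N \<one>\<^bsub>ZN2 N\<^esub> b (a \<otimes>\<^bsub>ZN2 N\<^esub> x [^]\<^bsub>ZN2 N\<^esub> (2 :: nat)) y
             \<ominus>\<^bsub>Lambda2 N\<^esub> delta N \<one>\<^bsub>ZN2 N\<^esub> (a \<otimes>\<^bsub>ZN2 N\<^esub> b) (b \<otimes>\<^bsub>ZN2 N\<^esub> x [^]\<^bsub>ZN2 N\<^esub> (2 :: nat)) y)))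
     \<and> (odd (card G) \<longrightarrow>
       unit_wedge N (siegel_unit N a) (siegel_unit N b)
         \<oplus>\<^bsub>Lambda2 N\<^esub> unit_wedge N (siegel_unit N b) (siegel_unit N c)
         \<oplus>\<^bsub>Lambda2 N\<^esub> unit_wedge N (siegel_unit N c) (siegel_unit N a)
       = (1 / of_nat (card G)) \<odot>\<^bsub>Lambda2 N\<^esub>
           (\<Oplus>\<^bsub>Lambda2 N\<^esub> x \<in> G.
              delta N \<one>\<^bsub>ZN2 N\<^esub> x (a \<otimes>\<^bsub>ZN2 N\<^esub> inv\<^bsub>ZN2 N\<^esub> x) (b \<otimes>\<^bsub>ZN2 N\<^esub> x)))"
proof -
  interpret siegel_subgroup N G
    by (intro siegel_subgroup.intro modular_unit_module.intro torsion_subgroup_ZN2 assms)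
  have inv: "inv\<^bsub>ZN2 N\<^esub> x = reduce N (- x)" if "x \<in> G" for x
    by (rule ZN2_inv[OF assms(1) subgroup.mem_carrier[OF assms(2) that]])
  have "reduce N (c + (a + b)) = (0, 0)"
    using assms(6) by (simp add: ZN2_mult ZN2_one add.commute)
  then have c: "c = reduce N (- (a + b))"
    using level_zero_add[of c "a + b"] reduced[OF assms(5)] by (simp only: level_zero_reduce simp_thms)
  have points: "a \<in> points" "b \<in> points" using assms(3,4) \<Gamma>_points by blast+
  \<comment> \<open>Rewriting the group inverse is possible only for elements of G, hence under the
    sum, and the congruence rule for finite sums requires summands in the carrier. The other group
    operations are rewritten unconditionally.\<close>
  have closed: "delta N (0, 0) x (reduce N (a - x)) (reduce N (b + x)) \<in> carrier (Lambda2 N)" if "x \<in> G" for x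
  proof -
    have "reduce N (a - x) \<in> G" "reduce N (b + x) \<in> G"
      using points_diff[OF points(1) \<Gamma>_points[OF that]] points_add[OF points(2) \<Gamma>_points[OF that]]
      by (simp_all add: points_def)
    then show ?thesis
      unfolding Lambda2_def using that by (intro W.represents_closed[OF represents_delta] inv)
  qed
  have first_sum: "(\<Oplus>\<^bsub>Lambda2 N\<^esub> x \<in> G. delta N \<one>\<^bsub>ZN2 N\<^esub> x (a \<otimes>\<^bsub>ZN2 N\<^esub> inv\<^bsub>ZN2 N\<^esub> x) (b \<otimes>\<^bsub>ZN2 N\<^esub> x))
      = (\<Oplus>\<^bsub>Lambda2 N\<^esub> x \<in> G. delta N (0, 0) x (reduce N (a - x)) (reduce N (b + x)))"
    using closed
    by (intro W.L.M.finsum_cong'[folded Lambda2_def] refl Pi_I) (simp_all add: ZN2_mult ZN2_one inv)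
  have odd: "x = 0" if "odd (card G)" "x \<in> G" "reduce N (x + x) = 0" for x
    using group.odd_order_square_eq_one[OF group_ZN2 assms(2) that(1,2)] that(3)
    by (simp add: ZN2_square ZN2_one zero_prod_def)
  show ?thesis
    unfolding first_sum
    unfolding ZN2_mult ZN2_one ZN2_square reduce_simps
    using three_siegel_units[OF assms(3-5) c inv card_subgroup_ZN2[OF assms(1,2)]] odd by blast
qed

end
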